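(* Let $\equiv$ be an equivalence relation on the positive integers with the property that $n \equiv m$ if and only if $nk \equiv mk$, for all positive integers $n$, $m$ and $k$. Then there is a torsion-free abelian group $G$ such that for all positive integers $n$ and $m$ the endomorphism rings of $G^n$ and $G^m$ are isomorphic (as rings) if and only if $n \equiv m$. Moreover, $G^n$ and $G^m$ are isomorphic (as abelian groups) if and only if $n = m$.
   Context: $G^n$ denotes the direct sum of $n$ copies of the abelian group $G$. *)

theory Defs
  imports "HOL-Algebra.Product_Groups" "HOL-Algebra.QuotRing"
begin

text \<open>
  A statement in HOL cannot say that a group exists in some type or other, so the type that holds
  the carrier has to be fixed. The elements of this type serve only as labels. Every group with
  at most as many elements as the powerset of the powerset of the natural numbers has a copy
  whose carrier is a set of labels.
\<close>

type_synonym label = "nat set set"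

text \<open>
  Abelian groups are written multiplicatively, as \<^const>\<open>comm_group\<close>: the \<open>n\<close>-th power of \<open>x\<close>
  is the multiple \<open>nx\<close>.
\<close>

definition torsion_free :: "('a, 'b) monoid_scheme \<Rightarrow> bool" where
  "torsion_free G \<longleftrightarrow>
     (\<forall>x \<in> carrier G. \<forall>n::nat. 0 < n \<longrightarrow> x [^]\<^bsub>G\<^esub> n = \<one>\<^bsub>G\<^esub> \<longrightarrow> x = \<one>\<^bsub>G\<^esub>)"

definition direct_power :: "('a, 'b) monoid_scheme \<Rightarrow> nat \<Rightarrow> (nat \<Rightarrow> 'a) monoid" where
  "direct_power G n = sum_group {..<n} (\<lambda>_. G)"

text \<open>
  The set \<^term>\<open>hom G G\<close> leaves the values of a homomorphism outside the carrier open. An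
  endomorphism is represented by the one homomorphism that is \<^const>\<open>undefined\<close> there, so that two
  endomorphisms are equal as soon as they agree on the carrier.
\<close>

definition endomorphism_ring :: "('a, 'b) monoid_scheme \<Rightarrow> ('a \<Rightarrow> 'a) ring" where
  "endomorphism_ring G =
     \<lparr> carrier = hom G G \<inter> extensional (carrier G),
       mult = (\<lambda>f g. compose (carrier G) f g),
       one = (\<lambda>x \<in> carrier G. x),
       zero = (\<lambda>x \<in> carrier G. \<one>\<^bsub>G\<^esub>),
       add = (\<lambda>f g. \<lambda>x \<in> carrier G. f x \<otimes>\<^bsub>G\<^esub> g x) \<rparr>"

lemma carrier_direct_power:
  assumes "comm_group G"
  shows "carrier (direct_power G n) = ({..<n} \<rightarrow>\<^sub>E carrier G)"
  using assms unfolding direct_power_def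
  by (subst carrier_sum_group) (auto simp: comm_group.axioms(2))

lemma comm_group_direct_power:
  assumes "comm_group G"
  shows "comm_group (direct_power G n)"
proof (rule group.group_comm_groupI)
  interpret comm_group G by fact
  show "group (direct_power G n)"
    unfolding direct_power_def by simp
  fix x y
  assume "x \<in> carrier (direct_power G n)" "y \<in> carrier (direct_power G n)"
  then show "x \<otimes>\<^bsub>direct_power G n\<^esub> y = y \<otimes>\<^bsub>direct_power G n\<^esub> x"
    unfolding carrier_direct_power [OF assms]
    by (auto simp: direct_power_def PiE_iff fun_eq_iff m_comm)
qed

lemma ring_endomorphism_ring:
  assumes "comm_group G"
  shows "ring (endomorphism_ring G)"
proof -
  interpret comm_group G by fact
  let ?E = "endomorphism_ring G"
  have closed: "\<And>f x. f \<in> hom G G \<Longrightarrow> x \<in> carrier G \<Longrightarrow> f x \<in> carrier G"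
    by (auto simp: hom_def)
  have mlt: "\<And>f x y. f \<in> hom G G \<Longrightarrow> x \<in> carrier G \<Longrightarrow> y \<in> carrier G
      \<Longrightarrow> f (x \<otimes>\<^bsub>G\<^esub> y) = f x \<otimes>\<^bsub>G\<^esub> f y"
    by (auto simp: hom_def)
  have ext: "\<And>f x. f \<in> extensional (carrier G) \<Longrightarrow> x \<notin> carrier G \<Longrightarrow> f x = undefined"
    by (simp add: extensional_def)
  note defs = endomorphism_ring_def compose_def fun_eq_iff restrict_apply
  have "abelian_group ?E"
  proof (rule abelian_groupI)
    fix f assume f: "f \<in> carrier ?E"
    let ?g = "\<lambda>x \<in> carrier G. inv\<^bsub>G\<^esub> (f x)"
    have "?g \<in> carrier ?E"
      using f by (auto simp: defs closed mlt inv_mult intro!: homI)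
    moreover have "?g \<oplus>\<^bsub>?E\<^esub> f = \<zero>\<^bsub>?E\<^esub>"
      using f by (auto simp: defs closed)
    ultimately show "\<exists>g \<in> carrier ?E. g \<oplus>\<^bsub>?E\<^esub> f = \<zero>\<^bsub>?E\<^esub>" by blast
  qed (auto simp: defs closed mlt ext m_ac intro!: homI)
  moreover have "monoid ?E"
    by (rule monoidI) (auto simp: defs closed mlt ext intro!: homI)
  ultimately show ?thesis
    by (rule ringI) (auto simp: defs closed mlt ext)
qed

end

theory Submission
  imports Defs "HOL-Analysis.Product_Vector" "HOL-Library.Function_Algebras"
    "HOL-Computational_Algebra.Primes" "HOL-Library.Infinite_Set" "HOL-Library.Countable"
    "HOL-Algebra.Subrings"
begin

text \<open>
  Let \<open>H\<close> be the group of the quotients \<open>n / m\<close> with \<open>n \<equiv> m\<close>; by cancellation \<open>n / m \<in> H\<close> conversely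
  implies \<open>n \<equiv> m\<close>. The direct limit \<open>U\<close> of the rings of integer matrices has for every rational
  \<open>q > 0\<close> a module \<open>P\<^sub>q\<close> of rank \<open>q\<close>, with \<open>P\<^sub>q\<^sup>n\<close> isomorphic to \<open>P\<^sub>n\<^sub>q\<close>. Encoding operators by
  subgroups that are infinitely divisible by distinct primes turns a module into a group whose
  endomorphisms are exactly those of the module. This gives groups \<open>A\<^sub>q\<close> with \<open>A\<^sub>q\<^sup>n\<close> isomorphic
  to \<open>A\<^sub>n\<^sub>q\<close>, pairwise non-isomorphic because the rank is an invariant. The groups
  \<open>B\<^sub>q = A\<^sub>q \<times> \<int>\<^sup>\<nat>\<close> inherit both properties, as \<open>A\<^sub>q\<close> has no nonzero homomorphism to \<open>\<int>\<close>, and have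
  the summand \<open>\<int>\<close>.

  Encode the direct sum of the \<open>B\<^sub>h\<close> for \<open>h \<in> H\<close>, with its projections as operators, into a group \<open>G\<close>.
  The endomorphisms of \<open>G\<^sup>n\<close> are the graded endomorphisms of the direct sum of the \<open>B\<^sub>q\<close> for
  \<open>q \<in> n H\<close>. They do not see the labels of the summands, so \<open>n H = m H\<close> makes the rings isomorphic.
  Conversely, an isomorphism carries the projection onto \<open>\<int>\<close> inside one summand \<open>B\<^sub>q\<close> to an equivalent
  of such a projection \<open>e\<close> inside some \<open>B\<^sub>q\<^sub>'\<close>; since the left ideal generated by \<open>e\<close> is additively
  \<open>B\<^sub>q\<^sub>'\<close>, it follows that \<open>q = q'\<close>. An isomorphism between \<open>G\<^sup>n\<close> and \<open>G\<^sup>m\<close> respects the labels, hence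
  yields \<open>B\<^sub>n\<close> isomorphic to \<open>B\<^sub>m\<close> and \<open>n = m\<close>.
\<close>

section \<open>Abelian groups as subgroups of real vector spaces\<close>

instantiation "fun" :: (type, real_vector) real_vector
begin

definition "scaleR c f = (\<lambda>x. c *\<^sub>R f x)" for f :: "'a \<Rightarrow> 'b"

instance
  by standard (simp_all add: scaleR_fun_def fun_eq_iff scaleR_add_right scaleR_add_left)

end

lemma scaleR_fun_apply [simp]: "(c *\<^sub>R f) x = c *\<^sub>R f x"
  by (simp add: scaleR_fun_def)

text \<open>Inside a real vector space every group is torsion-free, and rational multiples of its
  elements exist without constructing a divisible hull.\<close>

definition grp :: "'a::ab_group_add set \<Rightarrow> 'a monoid" where
  "grp S = \<lparr>carrier = S, monoid.mult = (+), one = 0\<rparr>"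

definition subgp :: "'a::ab_group_add set \<Rightarrow> bool" where
  "subgp S \<longleftrightarrow> 0 \<in> S \<and> (\<forall>x\<in>S. \<forall>y\<in>S. x - y \<in> S)"

lemma grp_simps [simp]:
  "carrier (grp S) = S" "x \<otimes>\<^bsub>grp S\<^esub> y = x + y" "\<one>\<^bsub>grp S\<^esub> = 0"
  by (simp_all add: grp_def)

lemma subgp_0 [simp]: "subgp S \<Longrightarrow> 0 \<in> S"
  and subgp_diff: "subgp S \<Longrightarrow> x \<in> S \<Longrightarrow> y \<in> S \<Longrightarrow> x - y \<in> S"
  by (simp_all add: subgp_def)

lemma subgp_neg: "subgp S \<Longrightarrow> x \<in> S \<Longrightarrow> - x \<in> S"
  using subgp_diff[of S 0 x] by simp

lemma subgp_add: "subgp S \<Longrightarrow> x \<in> S \<Longrightarrow> y \<in> S \<Longrightarrow> x + y \<in> S"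
  using subgp_diff[of S x "- y"] subgp_neg by auto

lemma comm_group_grp: "subgp S \<Longrightarrow> comm_group (grp S)"
  by (rule comm_groupI) (auto simp: subgp_add add_ac intro!: bexI[of _ "- _"] subgp_neg)

lemma group_grp: "subgp S \<Longrightarrow> group (grp S)"
  by (simp add: comm_group_grp comm_group.axioms(2))

lemma subgp_sum: "subgp S \<Longrightarrow> (\<And>i. i \<in> I \<Longrightarrow> f i \<in> S) \<Longrightarrow> sum f I \<in> S"
  by (induction I rule: infinite_finite_induct) (auto intro: subgp_add)

lemma subgp_scaleR_nat: "subgp (S :: 'a::real_vector set) \<Longrightarrow> x \<in> S \<Longrightarrow> real n *\<^sub>R x \<in> S"
  by (induction n) (auto simp: scaleR_add_left intro: subgp_add)

lemma subgp_scaleR_int: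
  assumes "subgp (S :: 'a::real_vector set)" "x \<in> S" "c \<in> \<int>"
  shows "c *\<^sub>R x \<in> S"
proof -
  obtain k where "c = of_int k" using assms(3) by (rule Ints_cases)
  then consider n where "c = real n" | n where "c = - real n"
    by (cases k rule: int_cases2) auto
  then show ?thesis
    by cases (use assms in \<open>auto simp: subgp_scaleR_nat subgp_neg\<close>)
qed

lemma subgp_Times: "subgp S \<Longrightarrow> subgp T \<Longrightarrow> subgp (S \<times> T)"
  by (auto simp: subgp_def zero_prod_def)

lemma hom_grp_iff: "f \<in> hom (grp S) (grp T) \<longleftrightarrow>
    (\<forall>x\<in>S. f x \<in> T) \<and> (\<forall>x\<in>S. \<forall>y\<in>S. f (x + y) = f x + f y)"
  by (auto simp: hom_def)

lemma hom_in: "f \<in> hom (grp S) (grp T) \<Longrightarrow> x \<in> S \<Longrightarrow> f x \<in> T"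
  and hom_add: "f \<in> hom (grp S) (grp T) \<Longrightarrow> x \<in> S \<Longrightarrow> y \<in> S \<Longrightarrow> f (x + y) = f x + f y"
  by (auto simp: hom_grp_iff)

lemma hom_grp_subset:
  assumes "f \<in> hom (grp S) (grp T)" "S' \<subseteq> S" "f ` S' \<subseteq> T'"
  shows "f \<in> hom (grp S') (grp T')"
  using assms(2,3) hom_add[OF assms(1)] unfolding hom_grp_iff by (simp add: subset_iff image_subset_iff)

lemma hom_0: "f \<in> hom (grp S) (grp T) \<Longrightarrow> subgp S \<Longrightarrow> f 0 = 0"
  using hom_add[of f S T 0 0] by simp

lemma hom_neg: "f \<in> hom (grp S) (grp T) \<Longrightarrow> subgp S \<Longrightarrow> x \<in> S \<Longrightarrow> f (- x) = - f x"
  using hom_add[of f S T x "- x"] hom_0[of f S T] subgp_neg[of S x] by (simp add: eq_neg_iff_add_eq_0 add.commute)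

lemma hom_diff: "f \<in> hom (grp S) (grp T) \<Longrightarrow> subgp S \<Longrightarrow> x \<in> S \<Longrightarrow> y \<in> S \<Longrightarrow> f (x - y) = f x - f y"
  using hom_add[of f S T x "- y"] hom_neg[of f S T y] subgp_neg[of S y] by simp

lemma subgp_hom_image:
  assumes "f \<in> hom (grp S) (grp T)" "subgp S"
  shows "subgp (f ` S)"
  unfolding subgp_def
proof (intro conjI ballI)
  show "0 \<in> f ` S" using hom_0[OF assms] subgp_0[OF assms(2)] by (metis imageI)
  fix a b assume "a \<in> f ` S" "b \<in> f ` S"
  then obtain x y where "x \<in> S" "a = f x" "y \<in> S" "b = f y" by blast
  then show "a - b \<in> f ` S"
    using hom_diff[OF assms] subgp_diff[OF assms(2)] by (metis imageI)
qed

lemma hom_sum: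
  assumes "f \<in> hom (grp S) (grp T)" "subgp S" "\<And>i. i \<in> I \<Longrightarrow> g i \<in> S"
  shows "f (sum g I) = (\<Sum>i\<in>I. f (g i))"
  using assms(3)
  by (induction I rule: infinite_finite_induct)
     (use assms in \<open>auto simp: hom_0 hom_add subgp_sum\<close>)

lemma hom_scaleR_nat:
  fixes f :: "'a::real_vector \<Rightarrow> 'b::real_vector"
  assumes "f \<in> hom (grp S) (grp T)" "subgp S" "x \<in> S"
  shows "f (real n *\<^sub>R x) = real n *\<^sub>R f x"
  by (induction n)
     (use assms in \<open>auto simp: hom_0 hom_add scaleR_add_left subgp_scaleR_nat\<close>)

lemma hom_scaleR_int:
  fixes f :: "'a::real_vector \<Rightarrow> 'b::real_vector"
  assumes "f \<in> hom (grp S) (grp T)" "subgp S" "x \<in> S" "c \<in> \<int>"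
  shows "f (c *\<^sub>R x) = c *\<^sub>R f x"
proof -
  obtain k where "c = of_int k" using assms(4) by (rule Ints_cases)
  then consider n where "c = real n" | n where "c = - real n"
    by (cases k rule: int_cases2) auto
  then show ?thesis
    by cases (use assms in \<open>auto simp: hom_scaleR_nat hom_neg subgp_scaleR_nat\<close>)
qed

lemma hom_grp_compose:
  "f \<in> hom (grp S) (grp T) \<Longrightarrow> g \<in> hom (grp T) (grp U) \<Longrightarrow> (\<lambda>x. g (f x)) \<in> hom (grp S) (grp U)"
  by (auto simp: hom_grp_iff)

lemma grp_isoI:
  assumes "f \<in> hom (grp S) (grp T)" "g \<in> T \<rightarrow> S"
    "\<And>x. x \<in> S \<Longrightarrow> g (f x) = x" "\<And>y. y \<in> T \<Longrightarrow> f (g y) = y"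
  shows "f \<in> iso (grp S) (grp T)"
  using assms by (auto simp: iso_def hom_grp_iff intro!: bij_betwI[where g = g])

lemma iso_grp_inverse:
  assumes "f \<in> iso (grp S) (grp T)" "subgp S"
  obtains g where "g \<in> hom (grp T) (grp S)" "\<And>x. x \<in> S \<Longrightarrow> g (f x) = x"
    "\<And>y. y \<in> T \<Longrightarrow> f (g y) = y"
proof
  have bij: "bij_betw f S T" and hom: "f \<in> hom (grp S) (grp T)"
    using assms(1) by (auto simp: iso_def)
  show "inv_into S f \<in> hom (grp T) (grp S)"
    using group.iso_set_sym[OF group_grp[OF assms(2)] assms(1)] by (simp add: iso_def)
  show "inv_into S f (f x) = x" if "x \<in> S" for x
    using that bij by (simp add: bij_betw_def)
  show "f (inv_into S f y) = y" if "y \<in> T" for y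
    using that bij by (simp add: bij_betw_def f_inv_into_f)
qed

section \<open>Localisation at a prime\<close>

text \<open>For prime \<open>p\<close> this is the localisation of \<open>M\<close> at
  \<open>p\<close>, formed inside the ambient space: denominators prime to \<open>p\<close> are
  allowed.\<close>

definition loc :: "nat \<Rightarrow> 'a::real_vector set \<Rightarrow> 'a set" where
  "loc p M = {x. \<exists>d>0. coprime d p \<and> real d *\<^sub>R x \<in> M}"

lemma locI: "d > 0 \<Longrightarrow> coprime d p \<Longrightarrow> real d *\<^sub>R x \<in> M \<Longrightarrow> x \<in> loc p M"
  by (auto simp: loc_def)

lemma locE:
  assumes "x \<in> loc p M"
  obtains d where "d > 0" "coprime d p" "real d *\<^sub>R x \<in> M"
  using assms by (auto simp: loc_def)

lemma loc_incl: "M \<subseteq> loc p M"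
  by (auto intro!: locI[of 1])

lemma subgp_loc:
  assumes "subgp M"
  shows "subgp (loc p M)"
  unfolding subgp_def
proof (intro conjI ballI)
  show "0 \<in> loc p M" using assms by (intro locI[of 1]) auto
  fix x y assume "x \<in> loc p M" "y \<in> loc p M"
  then obtain c d where cd: "c > 0" "coprime c p" "real c *\<^sub>R x \<in> M"
    "d > 0" "coprime d p" "real d *\<^sub>R y \<in> M" by (metis locE)
  have "real (c * d) *\<^sub>R (x - y) = real d *\<^sub>R (real c *\<^sub>R x) - real c *\<^sub>R (real d *\<^sub>R y)"
    by (simp add: scaleR_diff_right mult_ac)
  then have "real (c * d) *\<^sub>R (x - y) \<in> M"
    using assms cd by (metis subgp_diff subgp_scaleR_nat)
  then show "x - y \<in> loc p M" using cd by (intro locI[of "c * d"]) auto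
qed

lemma loc_scaleR_divide:
  assumes "x \<in> loc p M" "n > 0" "coprime n p"
  shows "x /\<^sub>R real n \<in> loc p M"
proof -
  obtain d where d: "d > 0" "coprime d p" "real d *\<^sub>R x \<in> M" using assms(1) by (rule locE)
  then show ?thesis using assms by (intro locI[of "d * n"]) (auto simp: mult.assoc)
qed

lemma loc_loc: "loc p (loc p M) = loc p M"
proof
  show "loc p (loc p M) \<subseteq> loc p M"
  proof
    fix x assume "x \<in> loc p (loc p M)"
    then obtain c d where "c > 0" "coprime c p" "d > 0" "coprime d p"
      "real d *\<^sub>R real c *\<^sub>R x \<in> M" by (meson locE)
    then show "x \<in> loc p M" by (intro locI[of "d * c"]) auto
  qed
qed (rule loc_incl)

text \<open>The least denominator of \<open>x\<close> is 1: for a prime factor \<open>p\<close> of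
  it there is another denominator prime to \<open>p\<close>, and the gcd of two denominators is
  again a denominator.\<close>

lemma loc_all_primes:
  assumes M: "subgp M" and x: "\<And>p. prime p \<Longrightarrow> x \<in> loc p M"
  shows "x \<in> M"
proof -
  let ?D = "\<lambda>d::nat. d > 0 \<and> real d *\<^sub>R x \<in> M"
  have "\<exists>d. ?D d" using x[of 2] by (auto elim: locE)
  define d where "d = (LEAST d. ?D d)"
  have d: "?D d" unfolding d_def using \<open>\<exists>d. ?D d\<close> by (rule LeastI_ex)
  have least: "d \<le> c" if "?D c" for c unfolding d_def using that by (rule Least_le)
  have "d = 1"
  proof (rule ccontr)
    assume "d \<noteq> 1"
    then obtain p where p: "prime p" "p dvd d" using prime_factor_nat by blast
    then obtain c where c: "c > 0" "coprime c p" "real c *\<^sub>R x \<in> M" using x by (metis locE)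
    \<comment> \<open>By Bezout \<open>gcd c d\<close> is a denominator too, so minimality gives
      \<open>d dvd c\<close>. This is absurd, as \<open>p\<close> divides \<open>d\<close> but not
      \<open>c\<close>.\<close>
    obtain a b where ab: "a * int c + b * int d = gcd (int c) (int d)"
      using bezout_int by blast
    have "real (gcd c d) *\<^sub>R x = of_int a *\<^sub>R (real c *\<^sub>R x) + of_int b *\<^sub>R (real d *\<^sub>R x)"
    proof -
      have "real (gcd c d) = of_int (gcd (int c) (int d))" by (simp add: gcd_int_int_eq)
      then have "real (gcd c d) = of_int a * real c + of_int b * real d"
        unfolding ab[symmetric] by simp
      then show ?thesis by (simp add: scaleR_add_left)
    qed
    also have "\<dots> \<in> M" by (rule subgp_add[OF M]; rule subgp_scaleR_int[OF M]) (use c d in auto)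
    finally have "d \<le> gcd c d" using c by (intro least) auto
    then have "d dvd c" using d by (metis gcd_dvd1 gcd_dvd2 dvd_imp_le le_antisym)
    then have "p dvd gcd c p" using p by auto
    with c(2) p(1) show False by (auto simp: coprime_iff_gcd_eq_1)
  qed
  with d show ?thesis by simp
qed

text \<open>The quotients are formed in the ambient space, so for prime \<open>p\<close> the
  condition says that the localisation at \<open>p\<close> has no nonzero infinitely
  \<open>p\<close>-divisible element.\<close>

definition reduced :: "nat \<Rightarrow> 'a::real_vector set \<Rightarrow> bool" where
  "reduced p M \<longleftrightarrow> (\<forall>x. (\<forall>k. x /\<^sub>R real (p ^ k) \<in> loc p M) \<longrightarrow> x = 0)"

lemma reducedD: "reduced p M \<Longrightarrow> (\<And>k. x /\<^sub>R real (p ^ k) \<in> loc p M) \<Longrightarrow> x = 0"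
  by (simp add: reduced_def)

lemma reduced_loc: "reduced p M \<Longrightarrow> reduced p (loc p M)"
  by (simp add: reduced_def loc_loc)

lemma reduced_subset: "reduced p M \<Longrightarrow> N \<subseteq> M \<Longrightarrow> reduced p N"
  unfolding reduced_def loc_def by blast

text \<open>Linear maps carry infinite divisibility in the localisation of \<open>M\<close> to
  infinite divisibility in that of \<open>N i\<close>. Hence all coordinates vanish, and they
  separate points.\<close>

lemma reduced_coordinates:
  fixes l :: "'i \<Rightarrow> 'a::real_vector \<Rightarrow> 'b::real_vector"
  assumes lin: "\<And>i. linear (l i)"
    and sep: "\<And>x. (\<And>i. l i x = 0) \<Longrightarrow> x = 0"
    and into: "\<And>i x. x \<in> M \<Longrightarrow> l i x \<in> N i"
    and red: "\<And>i. reduced p (N i)"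
  shows "reduced p M"
  unfolding reduced_def
proof (intro allI impI)
  fix x assume x: "\<forall>k. x /\<^sub>R real (p ^ k) \<in> loc p M"
  show "x = 0"
  proof (rule sep, rule reducedD[OF red])
    fix i k
    obtain d where d: "d > 0" "coprime d p" "real d *\<^sub>R (x /\<^sub>R real (p ^ k)) \<in> M"
      using x by (meson locE)
    have "l i (real d *\<^sub>R (x /\<^sub>R real (p ^ k))) = real d *\<^sub>R (l i x /\<^sub>R real (p ^ k))"
      by (simp only: linear_cmul[OF lin])
    with into[OF d(3), of i] show "l i x /\<^sub>R real (p ^ k) \<in> loc p (N i)"
      using d(1,2) by (intro locI[of d]) simp_all
  qed
qed

lemma reduced_Ints:
  assumes "prime p"
  shows "reduced p (\<int> :: real set)"
  unfolding reduced_def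
proof (intro allI impI, rule ccontr)
  fix x :: real assume x: "\<forall>k. x /\<^sub>R real (p ^ k) \<in> loc p \<int>" and "x \<noteq> 0"
  have "x /\<^sub>R real (p ^ 0) \<in> loc p \<int>" using x by blast
  then have "x \<in> loc p \<int>" by simp
  then obtain c where c: "c > 0" "real c *\<^sub>R x \<in> \<int>" by (rule locE)
  then obtain a where a: "real c * x = of_int a" by (metis Ints_cases real_scaleR_def)
  with c \<open>x \<noteq> 0\<close> have "a \<noteq> 0" by auto
  \<comment> \<open>Clearing denominators leaves \<open>int p ^ k\<close> dividing
    \<open>int d * a\<close>, where \<open>d\<close> is prime to \<open>p\<close>.\<close>
  have "int p ^ k dvd a" for k
  proof -
    obtain d where d: "d > 0" "coprime d p" "real d *\<^sub>R (x /\<^sub>R real (p ^ k)) \<in> \<int>"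
      using x by (meson locE)
    then obtain b where "real d *\<^sub>R (x /\<^sub>R real (p ^ k)) = of_int b" by (meson Ints_cases)
    then have b: "real d * x = of_int b * real (p ^ k)"
      using prime_gt_0_nat[OF assms] by (simp add: field_simps)
    have "real d * (x * real c) = of_int b * real (p ^ k) * real c"
      using b by simp
    then have "real d * of_int a = of_int b * real (p ^ k) * real c"
      by (simp add: a[symmetric] mult_ac)
    then have "real_of_int (int d * a) = real_of_int (b * int p ^ k * int c)"
      by simp
    then have "int d * a = b * int p ^ k * int c" by (simp only: of_int_eq_iff)
    then have "int p ^ k dvd int d * a" by simp
    moreover have "coprime (int p ^ k) (int d)" using d(2) by (simp add: coprime_commute)
    ultimately show ?thesis by (simp add: coprime_dvd_mult_right_iff)
  qed
  \<comment> \<open>The exponent \<bar>a\<bar> is large enough for a contradiction, since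
    \<open>n < p ^ n\<close>.\<close>
  then have "int p ^ nat \<bar>a\<bar> \<le> \<bar>a\<bar>" using \<open>a \<noteq> 0\<close> by (intro zdvd_imp_le) auto
  moreover
  have "nat \<bar>a\<bar> < p ^ nat \<bar>a\<bar>" using prime_gt_1_nat[OF assms] by (simp add: power_gt_expt)
  then have "int (nat \<bar>a\<bar>) < int p ^ nat \<bar>a\<bar>" by (simp only: of_nat_less_iff flip: of_nat_power)
  ultimately show False by simp
qed

section \<open>Realising a module by infinitely divisible subgroups\<close>

definition dec :: "(nat \<Rightarrow> 'a \<Rightarrow> 'a) \<Rightarrow> nat \<Rightarrow> 'a \<times> 'a \<Rightarrow> 'a::real_vector" where
  "dec \<psi> j v = (if j = 0 then fst v else if j = 1 then snd v else if j = 2 then snd v - fst v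
     else snd v - \<psi> (j - 3) (fst v))"

text \<open>
  The group \<open>realize e \<psi> M\<close> consists of the pairs over the rational span of \<open>M\<close> that are integral
  at every prime up to the rational span of one subgroup of \<open>M \<times> M\<close>: the kernel of \<open>dec \<psi> j\<close> for
  the prime \<open>e j\<close>, and \<open>0\<close> for a prime outside the range of \<open>e\<close>. These kernels are the second
  and the first summand, the diagonal and the graphs of the operators. A homomorphism preserves
  them as the sets of infinitely divisible elements, hence is \<open>f \<times> f\<close> with \<open>f\<close> commuting with
  all operators.
\<close>

definition realize :: "(nat \<Rightarrow> nat) \<Rightarrow> (nat \<Rightarrow> 'a \<Rightarrow> 'a) \<Rightarrow> 'a::real_vector set \<Rightarrow> ('a \<times> 'a) set" where
  "realize e \<psi> M = {v. (\<forall>j. dec \<psi> j v \<in> loc (e j) M) \<and>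
     (\<forall>p. prime p \<longrightarrow> p \<notin> range e \<longrightarrow> fst v \<in> loc p M \<and> snd v \<in> loc p M)}"

text \<open>Reducedness is asked only at the primes \<open>e j\<close>. Thus \<open>M\<close> may
  itself contain elements infinitely divisible by other primes, which permits realising a sum of
  groups that are already realised.\<close>

locale realizable =
  fixes e :: "nat \<Rightarrow> nat" and \<psi> :: "nat \<Rightarrow> 'a::real_vector \<Rightarrow> 'a" and M :: "'a set"
  assumes inj_e: "inj e"
    and prime_e: "prime (e j)"
    and subgp_M: "subgp M"
    and linear_op: "linear (\<psi> k)"
    and op_closed: "x \<in> M \<Longrightarrow> \<psi> k x \<in> M"
    and reduced_M: "reduced (e j) M"
begin

lemma coprime_e: "i \<noteq> j \<Longrightarrow> coprime (e i ^ k) (e j)"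
  using inj_e prime_e by (auto simp: inj_eq intro: primes_coprime)

lemma linear_dec: "linear (dec \<psi> j)"
proof (rule linearI)
  show "dec \<psi> j (v + w) = dec \<psi> j v + dec \<psi> j w" for v w
    by (auto simp: dec_def linear_add[OF linear_op])
  show "dec \<psi> j (c *\<^sub>R v) = c *\<^sub>R dec \<psi> j v" for c v
    by (auto simp: dec_def linear_scale[OF linear_op] scaleR_diff_right)
qed

lemma dec_closed: "fst v \<in> M \<Longrightarrow> snd v \<in> M \<Longrightarrow> dec \<psi> j v \<in> M"
  by (auto simp: dec_def intro!: subgp_diff subgp_M op_closed)

lemma subgp_realize: "subgp (realize e \<psi> M)"
  unfolding subgp_def
proof (intro conjI ballI)
  have sub: "subgp (loc p M)" for p by (rule subgp_loc[OF subgp_M])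
  show "0 \<in> realize e \<psi> M"
    by (simp add: realize_def linear_0[OF linear_dec] subgp_0[OF sub])
  fix v w assume "v \<in> realize e \<psi> M" "w \<in> realize e \<psi> M"
  then show "v - w \<in> realize e \<psi> M"
    unfolding realize_def mem_Collect_eq linear_diff[OF linear_dec] fst_diff snd_diff
    by (meson subgp_diff[OF sub])
qed

lemma realize_incl: "M \<times> M \<subseteq> realize e \<psi> M"
proof
  fix v assume "v \<in> M \<times> M"
  then have v: "fst v \<in> M" "snd v \<in> M" by auto
  have "x \<in> loc p M" if "x \<in> M" for x p using that loc_incl by blast
  then show "v \<in> realize e \<psi> M"
    using v dec_closed[OF v] by (simp add: realize_def)
qed

text \<open>At the prime \<open>e j\<close> only the value of \<open>dec \<psi> j\<close> counts,
  and it is 0; at every other prime \<open>e j ^ k\<close> is invertible.\<close>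

lemma realize_divide:
  assumes v: "v \<in> M \<times> M" "dec \<psi> j v = 0"
  shows "v /\<^sub>R real (e j ^ k) \<in> realize e \<psi> M"
proof -
  have pos: "e j ^ k > 0" using prime_gt_0_nat[OF prime_e[of j]] by simp
  have "dec \<psi> i (v /\<^sub>R real (e j ^ k)) \<in> loc (e i) M" for i
  proof (cases "i = j")
    case True
    then show ?thesis
      using v subgp_loc[OF subgp_M] by (simp add: linear_scale[OF linear_dec])
  next
    case False
    have "dec \<psi> i v \<in> M" using v(1) by (intro dec_closed) auto
    then have "dec \<psi> i v \<in> loc (e i) M" using loc_incl by blast
    then show ?thesis
      unfolding linear_scale[OF linear_dec] using pos coprime_e False by (intro loc_scaleR_divide) auto
  qed
  moreover have "x /\<^sub>R real (e j ^ k) \<in> loc p M" if "prime p" "p \<notin> range e" "x \<in> M" for p x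
  proof (rule loc_scaleR_divide[OF _ pos])
    show "x \<in> loc p M" using that loc_incl by blast
    show "coprime (e j ^ k) p" using that prime_e by (auto intro: primes_coprime)
  qed
  moreover have "fst v \<in> M" "snd v \<in> M" using v(1) by auto
  ultimately show ?thesis
    by (simp add: realize_def)
qed

lemma realize_dec: "v \<in> realize e \<psi> M \<Longrightarrow> dec \<psi> j v \<in> loc (e j) M"
  by (simp add: realize_def)

text \<open>The maps \<open>dec \<psi> 0\<close> and \<open>dec \<psi> 1\<close> read off the two
  coordinates, so the group lies in the rational span of M \<times> M.\<close>

lemma realize_denominator:
  assumes "v \<in> realize e \<psi> M"
  obtains d where "d > 0" "real d *\<^sub>R v \<in> M \<times> M"
proof -
  have "fst v \<in> loc (e 0) M" "snd v \<in> loc (e 1) M"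
    using realize_dec[OF assms, of 0] realize_dec[OF assms, of 1] by (simp_all add: dec_def)
  then obtain c d where cd: "c > 0" "real c *\<^sub>R fst v \<in> M" "d > 0" "real d *\<^sub>R snd v \<in> M"
    by (meson locE)
  have "real d *\<^sub>R real c *\<^sub>R fst v \<in> M" "real c *\<^sub>R real d *\<^sub>R snd v \<in> M"
    using cd by (simp_all only: subgp_scaleR_nat subgp_M)
  then have "real (c * d) *\<^sub>R v \<in> M \<times> M"
    by (cases v) (simp add: mult.commute)
  with cd show ?thesis by (intro that[of "c * d"]) auto
qed

text \<open>The first pair gives integrality of \<open>x\<close> at \<open>e 0\<close>, the second
  at every other \<open>e j\<close>, where \<open>dec \<psi> j (0, x) = x\<close>. At primes outside
  the range of \<open>e\<close> the coordinates are tested directly.\<close>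

lemma realize_dec_coordinates:
  assumes "(x, 0) \<in> realize e \<psi> M" "(0, x) \<in> realize e \<psi> M"
  shows "x \<in> M"
proof (rule loc_all_primes[OF subgp_M])
  fix p :: nat assume p: "prime p"
  show "x \<in> loc p M"
  proof (cases "p \<in> range e")
    case False
    then show ?thesis using assms(1) p by (simp add: realize_def)
  next
    case True
    then obtain j where j: "p = e j" by blast
    show ?thesis
    proof (cases "j = 0")
      case True
      then show ?thesis using realize_dec[OF assms(1), of j] j by (simp add: dec_def)
    next
      case False
      then show ?thesis
        using realize_dec[OF assms(2), of j] j
        by (simp add: dec_def linear_0[OF linear_op] split: if_splits)
    qed
  qed
qed

end

text \<open>The extension of a homomorphism on \<open>M\<close> to the rational span of \<open>M\<close>; a junk value elsewhere.\<close>

definition qext :: "'a::real_vector set \<Rightarrow> ('a \<Rightarrow> 'b::real_vector) \<Rightarrow> 'a \<Rightarrow> 'b" where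
  "qext M f x = (let d = (SOME d. d > 0 \<and> real d *\<^sub>R x \<in> M) in f (real d *\<^sub>R x) /\<^sub>R real d)"

text \<open>The choice of the denominator does not matter: two denominators \<open>c\<close> and
  \<open>d\<close> are compared at \<open>c * d\<close>.\<close>

lemma qext_eq:
  assumes f: "f \<in> hom (grp M) (grp N)" and M: "subgp M" and d: "d > 0" "real d *\<^sub>R x \<in> M"
  shows "qext M f x = f (real d *\<^sub>R x) /\<^sub>R real d"
proof -
  define c where "c = (SOME d. d > 0 \<and> real d *\<^sub>R x \<in> M)"
  have c: "c > 0" "real c *\<^sub>R x \<in> M"
    unfolding c_def using someI[of "\<lambda>d. d > 0 \<and> real d *\<^sub>R x \<in> M" d] d by auto
  have "real c *\<^sub>R f (real d *\<^sub>R x) = f (real c *\<^sub>R real d *\<^sub>R x)"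
    using hom_scaleR_nat[OF f M d(2)] by simp
  also have "\<dots> = f (real d *\<^sub>R real c *\<^sub>R x)" by (simp add: mult.commute)
  also have "\<dots> = real d *\<^sub>R f (real c *\<^sub>R x)"
    using hom_scaleR_nat[OF f M c(2)] by simp
  finally have "f (real c *\<^sub>R x) = real c *\<^sub>R f (real d *\<^sub>R x) /\<^sub>R real d"
    using d(1) by simp
  then show ?thesis
    using c(1) unfolding qext_def c_def[symmetric] by simp
qed

lemma qext_base: "f \<in> hom (grp M) (grp N) \<Longrightarrow> subgp M \<Longrightarrow> x \<in> M \<Longrightarrow> qext M f x = f x"
  using qext_eq[of f M N 1 x] by simp

lemma qext_add:
  assumes f: "f \<in> hom (grp M) (grp N)" and M: "subgp M"
    and c: "c > 0" "real c *\<^sub>R x \<in> M" and d: "d > 0" "real d *\<^sub>R y \<in> M"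
  shows "qext M f (x + y) = qext M f x + qext M f y"
proof -
  have x: "real (c * d) *\<^sub>R x \<in> M"
    using subgp_scaleR_nat[OF M c(2), of d] by (simp add: mult.commute)
  have y: "real (c * d) *\<^sub>R y \<in> M"
    using subgp_scaleR_nat[OF M d(2), of c] by simp
  have cd: "c * d > 0" using c d by simp
  have xy: "real (c * d) *\<^sub>R (x + y) \<in> M"
    unfolding scaleR_add_right by (rule subgp_add[OF M x y])
  show ?thesis
    unfolding qext_eq[OF f M cd x] qext_eq[OF f M cd y] qext_eq[OF f M cd xy]
      scaleR_add_right hom_add[OF f x y] ..
qed

lemma qext_loc:
  assumes f: "f \<in> hom (grp M) (grp N)" and M: "subgp M" and x: "x \<in> loc p M"
  shows "qext M f x \<in> loc p N"
proof -
  obtain d where d: "d > 0" "coprime d p" "real d *\<^sub>R x \<in> M" using x by (rule locE)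
  show ?thesis
    using d hom_in[OF f d(3)] by (intro locI[of d]) (auto simp: qext_eq[OF f M d(1,3)])
qed

section \<open>Homomorphisms between realised groups and their base maps\<close>

locale realizable_pair = R1: realizable e \<psi> M + R2: realizable e \<psi>' M'
  for e and \<psi> :: "nat \<Rightarrow> 'a::real_vector \<Rightarrow> 'a" and M
    and \<psi>' :: "nat \<Rightarrow> 'b::real_vector \<Rightarrow> 'b" and M'
begin

text \<open>The element \<open>v\<close> is divisible by all powers of \<open>e j\<close> in the
  source, hence so is \<open>\<phi> v\<close> in the target. Its value under
  \<open>dec \<psi>' j\<close> is then infinitely divisible in the localisation of
  \<open>M'\<close>, which is reduced.\<close>

lemma hom_dec:
  assumes \<phi>: "\<phi> \<in> hom (grp (realize e \<psi> M)) (grp (realize e \<psi>' M'))"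
    and v: "v \<in> M \<times> M" "dec \<psi> j v = 0"
  shows "dec \<psi>' j (\<phi> v) = 0"
proof (rule reducedD[OF R2.reduced_M[of j]])
  fix k
  let ?w = "v /\<^sub>R real (e j ^ k)"
  have w: "?w \<in> realize e \<psi> M" using v by (rule R1.realize_divide)
  have "real (e j ^ k) *\<^sub>R ?w = v" using R1.prime_e[of j] by auto
  then have "real (e j ^ k) *\<^sub>R \<phi> ?w = \<phi> v"
    using hom_scaleR_nat[OF \<phi> R1.subgp_realize w, of "e j ^ k"] by metis
  moreover have "real (e j ^ k) \<noteq> 0" using prime_gt_0_nat[OF R1.prime_e[of j]] by simp
  ultimately have "\<phi> ?w = \<phi> v /\<^sub>R real (e j ^ k)"
    by (metis inverse_nonzero_iff_nonzero scaleR_left_imp_eq scaleR_one scaleR_scaleR left_inverse)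
  moreover have "dec \<psi>' j (\<phi> ?w) \<in> loc (e j) M'"
    using hom_in[OF \<phi> w] by (auto simp: realize_def)
  ultimately show "dec \<psi>' j (\<phi> v) /\<^sub>R real (e j ^ k) \<in> loc (e j) M'"
    by (simp add: linear_scale[OF R2.linear_dec])
qed

definition base :: "('a \<times> 'a \<Rightarrow> 'b \<times> 'b) \<Rightarrow> 'a \<Rightarrow> 'b" where
  "base \<phi> x = fst (\<phi> (x, 0))"

text \<open>Kernels 1 and 0 make \<phi> diagonal on M \<times> M, kernel 2 makes the two diagonal
  entries equal, and kernel \<open>k + 3\<close>, the graph of \<open>\<psi> k\<close>, gives the
  commutation. The values lie in \<open>M'\<close> and not only in its rational span because both
  \<open>(base \<phi> x, 0)\<close> and \<open>(0, base \<phi> x)\<close> lie in the target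
  group.\<close>

lemma base:
  assumes \<phi>: "\<phi> \<in> hom (grp (realize e \<psi> M)) (grp (realize e \<psi>' M'))"
  shows hom_eq_base: "x \<in> M \<Longrightarrow> y \<in> M \<Longrightarrow> \<phi> (x, y) = (base \<phi> x, base \<phi> y)"
    and base_hom: "base \<phi> \<in> hom (grp M) (grp M')"
    and base_op: "x \<in> M \<Longrightarrow> base \<phi> (\<psi> k x) = \<psi>' k (base \<phi> x)"
proof -
  note M = R1.subgp_M
  have inR: "(x, y) \<in> realize e \<psi> M" if "x \<in> M" "y \<in> M" for x y
    using R1.realize_incl that by blast
  have add: "\<phi> (x, y) = \<phi> (x, 0) + \<phi> (0, y)" if "x \<in> M" "y \<in> M" for x y
    using hom_add[OF \<phi> inR inR, of x 0 0 y] that M by simp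
  have x0: "\<phi> (x, 0) = (base \<phi> x, 0)" if "x \<in> M" for x
    using hom_dec[OF \<phi>, of "(x, 0)" 1] that M by (simp add: dec_def base_def prod_eq_iff)
  have y0: "fst (\<phi> (0, y)) = 0" if "y \<in> M" for y
    using hom_dec[OF \<phi>, of "(0, y)" 0] that M by (simp add: dec_def)
  have y: "\<phi> (0, y) = (0, base \<phi> y)" if "y \<in> M" for y
    using hom_dec[OF \<phi>, of "(y, y)" 2] that M add[of y y] x0[of y] y0[of y]
    by (simp add: dec_def prod_eq_iff)
  show eq: "\<phi> (x, y) = (base \<phi> x, base \<phi> y)" if "x \<in> M" "y \<in> M" for x y
    using add[OF that] x0 y that by simp
  show "base \<phi> (\<psi> k x) = \<psi>' k (base \<phi> x)" if "x \<in> M" for x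
    using hom_dec[OF \<phi>, of "(x, \<psi> k x)" "k + 3"] that R1.op_closed eq
    by (simp add: dec_def)
  show "base \<phi> \<in> hom (grp M) (grp M')"
    unfolding hom_grp_iff
  proof (intro conjI ballI)
    fix x assume x: "x \<in> M"
    have "(base \<phi> x, 0) \<in> realize e \<psi>' M'" "(0, base \<phi> x) \<in> realize e \<psi>' M'"
      using hom_in[OF \<phi> inR, of x 0] hom_in[OF \<phi> inR, of 0 x] x M x0[of x] y[of x] by auto
    then show "base \<phi> x \<in> M'" by (rule R2.realize_dec_coordinates)
    fix y assume "y \<in> M"
    then show "base \<phi> (x + y) = base \<phi> x + base \<phi> y"
      using hom_add[OF \<phi> inR inR, of x 0 y 0] x M by (simp add: base_def)
  qed
qed

text \<open>A positive multiple of \<open>v\<close> lies in M \<times> M, where the base map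
  determines the homomorphism, and the target is torsion-free.\<close>

lemma hom_realize_eqI:
  assumes \<phi>: "\<phi> \<in> hom (grp (realize e \<psi> M)) (grp (realize e \<psi>' M'))"
    and \<phi>': "\<phi>' \<in> hom (grp (realize e \<psi> M)) (grp (realize e \<psi>' M'))"
    and eq: "\<And>x. x \<in> M \<Longrightarrow> base \<phi> x = base \<phi>' x"
    and v: "v \<in> realize e \<psi> M"
  shows "\<phi> v = \<phi>' v"
proof -
  obtain d where d: "d > 0" "real d *\<^sub>R v \<in> M \<times> M"
    using v by (rule R1.realize_denominator)
  obtain x y where xy: "real d *\<^sub>R v = (x, y)" "x \<in> M" "y \<in> M" using d(2) by blast
  have "\<phi> (real d *\<^sub>R v) = \<phi>' (real d *\<^sub>R v)"
    unfolding xy(1) using xy hom_eq_base[OF \<phi>] hom_eq_base[OF \<phi>'] eq by simp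
  then have "real d *\<^sub>R \<phi> v = real d *\<^sub>R \<phi>' v"
    using hom_scaleR_nat[OF \<phi> R1.subgp_realize v] hom_scaleR_nat[OF \<phi>' R1.subgp_realize v] by simp
  with d(1) show ?thesis by simp
qed

definition lift :: "('a \<Rightarrow> 'b) \<Rightarrow> 'a \<times> 'a \<Rightarrow> 'b \<times> 'b" where
  "lift f v = (qext M f (fst v), qext M f (snd v))"

text \<open>As \<open>f\<close> commutes with the operators, its rational extension intertwines the
  maps \<open>dec\<close>; it also preserves integrality at each prime. So all conditions defining
  the realised group are preserved.\<close>

lemma lift_hom:
  assumes f: "f \<in> hom (grp M) (grp M')" and comm: "\<And>k x. x \<in> M \<Longrightarrow> f (\<psi> k x) = \<psi>' k (f x)"
  shows "lift f \<in> hom (grp (realize e \<psi> M)) (grp (realize e \<psi>' M'))"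
    and "x \<in> M \<Longrightarrow> base (lift f) x = f x"
proof -
  note M = R1.subgp_M
  show "base (lift f) x = f x" if "x \<in> M"
    using that by (simp add: base_def lift_def qext_base[OF f M])
  have lift_dec: "dec \<psi>' j (lift f v) = qext M f (dec \<psi> j v)" if "v \<in> realize e \<psi> M" for v j
  proof -
    obtain d where d: "d > 0" "real d *\<^sub>R v \<in> M \<times> M" using \<open>v \<in> _\<close> by (rule R1.realize_denominator)
    then have x: "real d *\<^sub>R fst v \<in> M" and y: "real d *\<^sub>R snd v \<in> M"
      by (auto simp: mem_Times_iff)
    have z: "real d *\<^sub>R dec \<psi> j v \<in> M"
      using R1.dec_closed[of "real d *\<^sub>R v" j] x y by (simp add: linear_scale[OF R1.linear_dec])
    have "f (real d *\<^sub>R dec \<psi> j v) = dec \<psi>' j (f (real d *\<^sub>R fst v), f (real d *\<^sub>R snd v))"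
      unfolding dec_def
      using x y comm[OF x] R1.op_closed[OF x]
      by (simp add: scaleR_diff_right hom_diff[OF f M] linear_scale[OF R1.linear_op])
    then show ?thesis
      unfolding lift_def qext_eq[OF f M d(1) z] qext_eq[OF f M d(1) x] qext_eq[OF f M d(1) y]
      by (simp only: scaleR_Pair[symmetric] linear_scale[OF R2.linear_dec])
  qed
  show "lift f \<in> hom (grp (realize e \<psi> M)) (grp (realize e \<psi>' M'))"
    unfolding hom_grp_iff
  proof (intro conjI ballI)
    fix v assume v: "v \<in> realize e \<psi> M"
    then show "lift f v \<in> realize e \<psi>' M'"
      using lift_dec[OF v] qext_loc[OF f M]
      by (auto simp: realize_def) (auto simp: lift_def)
    fix w assume w: "w \<in> realize e \<psi> M"
    obtain c where c: "c > 0" "real c *\<^sub>R v \<in> M \<times> M" using v by (rule R1.realize_denominator)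
    obtain d where d: "d > 0" "real d *\<^sub>R w \<in> M \<times> M" using w by (rule R1.realize_denominator)
    show "lift f (v + w) = lift f v + lift f w"
      using c(2) d(2)
      by (auto simp: lift_def mem_Times_iff qext_add[OF f M c(1) _ d(1)])
  qed
qed

text \<open>An isomorphism and its inverse act on the pairs \<open>(x, x)\<close> through their base
  maps, which are therefore inverse to each other.\<close>

lemma iso_base:
  assumes "\<phi> \<in> iso (grp (realize e \<psi> M)) (grp (realize e \<psi>' M'))"
  shows "base \<phi> \<in> iso (grp M) (grp M')"
proof -
  interpret inv: realizable_pair e \<psi>' M' \<psi> M by unfold_locales
  have \<phi>: "\<phi> \<in> hom (grp (realize e \<psi> M)) (grp (realize e \<psi>' M'))"
    using assms by (simp add: iso_def)
  obtain \<chi> where \<chi>: "\<chi> \<in> hom (grp (realize e \<psi>' M')) (grp (realize e \<psi> M))"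
    and l: "\<And>v. v \<in> realize e \<psi> M \<Longrightarrow> \<chi> (\<phi> v) = v"
    and r: "\<And>v. v \<in> realize e \<psi>' M' \<Longrightarrow> \<phi> (\<chi> v) = v"
    using iso_grp_inverse[OF assms R1.subgp_realize] by metis
  note b = base_hom[OF \<phi>] and b' = inv.base_hom[OF \<chi>]
  show ?thesis
  proof (rule grp_isoI[OF b])
    show "inv.base \<chi> \<in> M' \<rightarrow> M" using hom_in[OF b'] by blast
    show "inv.base \<chi> (base \<phi> x) = x" if "x \<in> M" for x
      using hom_eq_base[OF \<phi> that that] inv.hom_eq_base[OF \<chi>, of "base \<phi> x" "base \<phi> x"]
        l[of "(x, x)"] hom_in[OF b that] R1.realize_incl that by auto
    show "base \<phi> (inv.base \<chi> y) = y" if "y \<in> M'" for y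
      using inv.hom_eq_base[OF \<chi> that that] hom_eq_base[OF \<phi>, of "inv.base \<chi> y" "inv.base \<chi> y"]
        r[of "(y, y)"] hom_in[OF b' that] R2.realize_incl that by auto
  qed
qed

text \<open>The composites of the lifts of \<open>f\<close> and of its inverse have the identity as
  base map, and a homomorphism is determined by its base map.\<close>

lemma iso_lift:
  assumes f: "f \<in> iso (grp M) (grp M')" and comm: "\<And>k x. x \<in> M \<Longrightarrow> f (\<psi> k x) = \<psi>' k (f x)"
  shows "grp (realize e \<psi> M) \<cong> grp (realize e \<psi>' M')"
proof -
  interpret inv: realizable_pair e \<psi>' M' \<psi> M by unfold_locales
  interpret one: realizable_pair e \<psi> M \<psi> M by unfold_locales
  interpret one': realizable_pair e \<psi>' M' \<psi>' M' by unfold_locales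
  have fh: "f \<in> hom (grp M) (grp M')" using f by (simp add: iso_def)
  obtain g where g: "g \<in> hom (grp M') (grp M)" and gf: "\<And>x. x \<in> M \<Longrightarrow> g (f x) = x"
    and fg: "\<And>y. y \<in> M' \<Longrightarrow> f (g y) = y"
    using iso_grp_inverse[OF f R1.subgp_M] by metis
  have gcomm: "g (\<psi>' k y) = \<psi> k (g y)" if "y \<in> M'" for k y
    using comm[of "g y" k] hom_in[OF g that] fg[OF that] gf R1.op_closed by metis
  note lf = lift_hom[OF fh comm] and lg = inv.lift_hom[OF g gcomm]
  have base_eq: "\<And>x. x \<in> M \<Longrightarrow> one.base (\<lambda>v. inv.lift g (lift f v)) x = x"
    "\<And>x. x \<in> M' \<Longrightarrow> one'.base (\<lambda>v. lift f (inv.lift g v)) x = x"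
    using hom_in[OF fh] hom_in[OF g] gf fg R1.subgp_M R2.subgp_M hom_0[OF fh] hom_0[OF g]
    by (auto simp: one.base_def one'.base_def lift_def inv.lift_def
        qext_base[OF fh R1.subgp_M] qext_base[OF g R2.subgp_M])
  have "lift f \<in> iso (grp (realize e \<psi> M)) (grp (realize e \<psi>' M'))"
  proof (rule grp_isoI[OF lf(1)])
    show "inv.lift g \<in> realize e \<psi>' M' \<rightarrow> realize e \<psi> M" using hom_in[OF lg(1)] by blast
    show "inv.lift g (lift f v) = v" if "v \<in> realize e \<psi> M" for v
      by (rule one.hom_realize_eqI[where \<phi>' = "\<lambda>v. v", OF hom_grp_compose[OF lf(1) lg(1)] _ _ that])
         (auto simp: base_eq one.base_def[of "\<lambda>v. v"] hom_grp_iff)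
    show "lift f (inv.lift g v) = v" if "v \<in> realize e \<psi>' M'" for v
      by (rule one'.hom_realize_eqI[where \<phi>' = "\<lambda>v. v", OF hom_grp_compose[OF lg(1) lf(1)] _ _ that])
         (auto simp: base_eq one'.base_def[of "\<lambda>v. v"] hom_grp_iff)
  qed
  then show ?thesis by (rule is_isoI)
qed

end

section \<open>Commutants\<close>

text \<open>With the operators regarded as scalars, this is the ring of module endomorphisms of
  \<open>M\<close>.\<close>

definition commutant :: "(nat \<Rightarrow> 'a \<Rightarrow> 'a) \<Rightarrow> 'a::ab_group_add set \<Rightarrow> ('a \<Rightarrow> 'a) ring" where
  "commutant \<psi> M = (endomorphism_ring (grp M))
     \<lparr>carrier := {f \<in> carrier (endomorphism_ring (grp M)). \<forall>k. \<forall>x\<in>M. f (\<psi> k x) = \<psi> k (f x)}\<rparr>"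

lemma carrier_endomorphism_ring_grp:
  "carrier (endomorphism_ring (grp M)) = hom (grp M) (grp M) \<inter> extensional M"
  by (simp add: endomorphism_ring_def)

lemma commutant_iff: "f \<in> carrier (commutant \<psi> M) \<longleftrightarrow>
    f \<in> hom (grp M) (grp M) \<and> f \<in> extensional M \<and> (\<forall>k. \<forall>x\<in>M. f (\<psi> k x) = \<psi> k (f x))"
  by (auto simp: commutant_def carrier_endomorphism_ring_grp)

lemma commutant_simps:
  "f \<otimes>\<^bsub>commutant \<psi> M\<^esub> g = compose M f g"
  "f \<oplus>\<^bsub>commutant \<psi> M\<^esub> g = (\<lambda>x\<in>M. f x + g x)"
  "\<one>\<^bsub>commutant \<psi> M\<^esub> = (\<lambda>x\<in>M. x)"
  "\<zero>\<^bsub>commutant \<psi> M\<^esub> = (\<lambda>x\<in>M. 0)"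
  by (simp_all add: commutant_def endomorphism_ring_def)

lemma endomorphism_ring_grp_simps:
  "f \<otimes>\<^bsub>endomorphism_ring (grp M)\<^esub> g = compose M f g"
  "f \<oplus>\<^bsub>endomorphism_ring (grp M)\<^esub> g = (\<lambda>x\<in>M. f x + g x)"
  "\<one>\<^bsub>endomorphism_ring (grp M)\<^esub> = (\<lambda>x\<in>M. x)"
  "\<zero>\<^bsub>endomorphism_ring (grp M)\<^esub> = (\<lambda>x\<in>M. 0)"
  by (simp_all add: endomorphism_ring_def)

lemma commutant_apply:
  assumes "x \<in> M"
  shows "(f \<otimes>\<^bsub>commutant \<psi> M\<^esub> g) x = f (g x)"
    and "(f \<oplus>\<^bsub>commutant \<psi> M\<^esub> g) x = f x + g x"
    and "\<zero>\<^bsub>commutant \<psi> M\<^esub> x = 0"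
  using assms by (simp_all add: commutant_simps compose_def)

lemma restrict_in_commutant:
  assumes "\<And>x. x \<in> M \<Longrightarrow> f x \<in> M" "\<And>x y. x \<in> M \<Longrightarrow> y \<in> M \<Longrightarrow> f (x + y) = f x + f y"
    "\<And>k x. x \<in> M \<Longrightarrow> f (\<psi> k x) = \<psi> k (f x)" "\<And>k x. x \<in> M \<Longrightarrow> \<psi> k x \<in> M" "subgp M"
  shows "restrict f M \<in> carrier (commutant \<psi> M)"
  using assms by (simp add: commutant_iff hom_grp_iff subgp_add)

lemma commutant_eqI:
  assumes "f \<in> carrier (commutant \<psi> M)" "g \<in> carrier (commutant \<psi> M)" "\<And>x. x \<in> M \<Longrightarrow> f x = g x"
  shows "f = g"
  using assms by (auto simp: commutant_iff intro: extensionalityI)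

lemma ring_commutant:
  assumes M: "subgp M" and \<psi>: "\<And>k. \<psi> k \<in> hom (grp M) (grp M)"
  shows "ring (commutant \<psi> M)"
proof -
  let ?E = "endomorphism_ring (grp M)"
  let ?H = "{f \<in> carrier ?E. \<forall>k. \<forall>x\<in>M. f (\<psi> k x) = \<psi> k (f x)}"
  interpret E: ring ?E by (rule ring_endomorphism_ring[OF comm_group_grp[OF M]])
  have app: "f x \<in> M" if "f \<in> carrier ?E" "x \<in> M" for f x
    using that by (auto simp: carrier_endomorphism_ring_grp hom_grp_iff)
  have \<psi>M: "\<psi> k x \<in> M" if "x \<in> M" for k x using hom_in[OF \<psi> that] .
  have "subring ?H ?E"
  proof (rule E.subringI)
    show "\<one>\<^bsub>?E\<^esub> \<in> ?H"
      using E.one_closed \<psi>M by (auto simp: endomorphism_ring_grp_simps)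
  next
    fix f assume f: "f \<in> ?H"
    then have fE: "f \<in> carrier ?E" and nE: "\<ominus>\<^bsub>?E\<^esub> f \<in> carrier ?E" by auto
    \<comment> \<open>The additive inverse in the endomorphism ring is characterised only by the
      ring axioms; its pointwise value is read off from the sum being zero.\<close>
    have neg: "(\<ominus>\<^bsub>?E\<^esub> f) x = - f x" if "x \<in> M" for x
    proof -
      have "(f \<oplus>\<^bsub>?E\<^esub> \<ominus>\<^bsub>?E\<^esub> f) x = \<zero>\<^bsub>?E\<^esub> x" using E.r_neg[OF fE] by simp
      then have "f x + (\<ominus>\<^bsub>?E\<^esub> f) x = 0" using that by (simp add: endomorphism_ring_grp_simps)
      then show ?thesis by (simp add: add_eq_0_iff)
    qed
    show "\<ominus>\<^bsub>?E\<^esub> f \<in> ?H"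
      using f nE by (simp add: neg \<psi>M app hom_neg[OF \<psi> M])
  next
    fix f g assume fg: "f \<in> ?H" "g \<in> ?H"
    then have "f \<otimes>\<^bsub>?E\<^esub> g \<in> carrier ?E" "f \<oplus>\<^bsub>?E\<^esub> g \<in> carrier ?E" by auto
    then show "f \<otimes>\<^bsub>?E\<^esub> g \<in> ?H" "f \<oplus>\<^bsub>?E\<^esub> g \<in> ?H"
      using fg by (simp_all add: endomorphism_ring_grp_simps compose_def \<psi>M app hom_add[OF \<psi>])
  qed auto
  then show ?thesis unfolding commutant_def by (rule E.subring_is_ring)
qed

text \<open>The isomorphism is conjugation by \<open>f\<close>. The operators have to correspond
  only as sets, not index by index, so that the summands of a direct sum may be relabelled.\<close>

lemma commutant_conj:
  assumes M: "subgp M" and N: "subgp N"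
    and f: "f \<in> hom (grp M) (grp N)" and g: "g \<in> hom (grp N) (grp M)"
    and gf: "\<And>x. x \<in> M \<Longrightarrow> g (f x) = x" and fg: "\<And>y. y \<in> N \<Longrightarrow> f (g y) = y"
    and \<psi>: "\<And>k. \<psi> k \<in> hom (grp M) (grp M)" and \<psi>': "\<And>k. \<psi>' k \<in> hom (grp N) (grp N)"
    and op: "\<And>k. \<exists>l. \<forall>x\<in>M. f (\<psi> k x) = \<psi>' l (f x)"
    and op': "\<And>l. \<exists>k. \<forall>x\<in>M. f (\<psi> k x) = \<psi>' l (f x)"
  shows "commutant \<psi> M \<simeq> commutant \<psi>' N"
proof -
  let ?C = "commutant \<psi> M" and ?D = "commutant \<psi>' N"
  let ?h = "\<lambda>a. \<lambda>y\<in>N. f (a (g y))" and ?k = "\<lambda>b. \<lambda>x\<in>M. g (b (f x))"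
  note fM = hom_in[OF f] and gN = hom_in[OF g] and \<psi>M = hom_in[OF \<psi>] and \<psi>N = hom_in[OF \<psi>']
  have aH: "a \<in> hom (grp M) (grp M)" if "a \<in> carrier ?C" for a using that by (simp add: commutant_iff)
  have bH: "b \<in> hom (grp N) (grp N)" if "b \<in> carrier ?D" for b using that by (simp add: commutant_iff)
  note aM = hom_in[OF aH] and bN = hom_in[OF bH]
  have h: "?h a \<in> carrier ?D" if a: "a \<in> carrier ?C" for a
  proof (rule restrict_in_commutant)
    show "f (a (g y)) \<in> N" if "y \<in> N" for y by (rule fM[OF aM[OF a gN[OF that]]])
    show "f (a (g (x + y))) = f (a (g x)) + f (a (g y))" if "x \<in> N" "y \<in> N" for x y
      using that by (simp add: hom_add[OF g] hom_add[OF f] hom_add[OF aH[OF a]] aM[OF a] gN)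
    show "f (a (g (\<psi>' l y))) = \<psi>' l (f (a (g y)))" if y: "y \<in> N" for l y
    proof -
      obtain k where k: "\<And>x. x \<in> M \<Longrightarrow> f (\<psi> k x) = \<psi>' l (f x)" using op' by blast
      have "f (\<psi> k (g y)) = \<psi>' l y" using k[OF gN[OF y]] fg[OF y] by simp
      then have "g (\<psi>' l y) = \<psi> k (g y)" using gf[OF \<psi>M[OF gN[OF y]], of k] by simp
      moreover have "a (\<psi> k (g y)) = \<psi> k (a (g y))" using a gN[OF y] unfolding commutant_iff by blast
      ultimately show ?thesis using k[OF aM[OF a gN[OF y]]] by simp
    qed
  qed (use \<psi>N N in auto)
  have k: "?k b \<in> carrier ?C" if b: "b \<in> carrier ?D" for b
  proof (rule restrict_in_commutant)
    show "g (b (f y)) \<in> M" if "y \<in> M" for y by (rule gN[OF bN[OF b fM[OF that]]])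
    show "g (b (f (x + y))) = g (b (f x)) + g (b (f y))" if "x \<in> M" "y \<in> M" for x y
      using that by (simp add: hom_add[OF g] hom_add[OF f] hom_add[OF bH[OF b]] bN[OF b] fM)
    show "g (b (f (\<psi> k x))) = \<psi> k (g (b (f x)))" if x: "x \<in> M" for k x
    proof -
      obtain l where l: "\<And>x. x \<in> M \<Longrightarrow> f (\<psi> k x) = \<psi>' l (f x)" using op by blast
      have bx: "b (f x) \<in> N" by (rule bN[OF b fM[OF x]])
      have "b (f (\<psi> k x)) = \<psi>' l (b (f x))" using b fM[OF x] unfolding l[OF x] commutant_iff by blast
      also have "\<dots> = f (\<psi> k (g (b (f x))))" using l[OF gN[OF bx]] fg[OF bx] by simp
      finally show ?thesis using gf[OF \<psi>M[OF gN[OF bx]]] by simp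
    qed
  qed (use \<psi>M M in auto)
  have "?h \<in> ring_iso ?C ?D"
  proof (rule ring_iso_memI)
    show "bij_betw ?h (carrier ?C) (carrier ?D)"
    proof (rule bij_betwI[where g = ?k])
      show "?k (?h a) = a" if "a \<in> carrier ?C" for a
        by (rule commutant_eqI[OF k[OF h[OF that]] that]) (simp add: fM gf aM[OF that])
      show "?h (?k b) = b" if "b \<in> carrier ?D" for b
        by (rule commutant_eqI[OF h[OF k[OF that]] that]) (simp add: gN fg bN[OF that])
      show "?h \<in> carrier ?C \<rightarrow> carrier ?D" by (intro Pi_I h)
      show "?k \<in> carrier ?D \<rightarrow> carrier ?C" by (intro Pi_I k)
    qed
    show "?h a \<in> carrier ?D" if "a \<in> carrier ?C" for a by (rule h[OF that])
    show "?h (a \<otimes>\<^bsub>?C\<^esub> b) = ?h a \<otimes>\<^bsub>?D\<^esub> ?h b" if "a \<in> carrier ?C" "b \<in> carrier ?C" for a b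
      by (rule ext) (simp add: commutant_simps compose_def gN fM aM[OF that(2)] gf)
    show "?h (a \<oplus>\<^bsub>?C\<^esub> b) = ?h a \<oplus>\<^bsub>?D\<^esub> ?h b" if "a \<in> carrier ?C" "b \<in> carrier ?C" for a b
      by (rule ext) (simp add: commutant_simps gN aM[OF that(1)] aM[OF that(2)] hom_add[OF f])
    show "?h \<one>\<^bsub>?C\<^esub> = \<one>\<^bsub>?D\<^esub>"
      by (rule ext) (simp add: commutant_simps gN fg)
  qed
  then show ?thesis by (auto simp: is_ring_iso_def)
qed

text \<open>Passing to the base map is inverse to lifting. It is multiplicative because an
  endomorphism maps \<open>(x, 0)\<close> to \<open>(base \<chi> x, 0)\<close>.\<close>

lemma (in realizable) endomorphism_ring_realize:
  "endomorphism_ring (grp (realize e \<psi> M)) \<simeq> commutant \<psi> M"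
proof -
  interpret realizable_pair e \<psi> M \<psi> M by unfold_locales
  let ?R = "realize e \<psi> M" and ?E = "endomorphism_ring (grp (realize e \<psi> M))"
  let ?h = "\<lambda>\<phi>. \<lambda>x\<in>M. base \<phi> x" and ?l = "\<lambda>f. \<lambda>v\<in>?R. lift f v"
  have restr_hom: "restrict \<phi> S \<in> hom (grp S) (grp T)" if "\<phi> \<in> hom (grp S) (grp T)" "subgp S"
    for \<phi> :: "'z::ab_group_add \<Rightarrow> 'y::ab_group_add" and S T
    using that by (auto simp: hom_grp_iff subgp_add)
  have \<phi>E: "\<phi> \<in> carrier ?E \<longleftrightarrow> \<phi> \<in> hom (grp ?R) (grp ?R) \<and> \<phi> \<in> extensional ?R" for \<phi>
    by (simp add: carrier_endomorphism_ring_grp)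
  have R0: "(x, 0) \<in> ?R" if "x \<in> M" for x using realize_incl that subgp_M by auto
  have h: "?h \<phi> \<in> carrier (commutant \<psi> M)" if "\<phi> \<in> carrier ?E" for \<phi>
    using that hom_in[OF base_hom] hom_add[OF base_hom] base_op op_closed subgp_M
    by (intro restrict_in_commutant) (auto simp: \<phi>E)
  have f: "f \<in> hom (grp M) (grp M)" "\<And>k x. x \<in> M \<Longrightarrow> f (\<psi> k x) = \<psi> k (f x)"
    if "f \<in> carrier (commutant \<psi> M)" for f
    using that by (auto simp: commutant_iff)
  have l: "?l f \<in> carrier ?E" if "f \<in> carrier (commutant \<psi> M)" for f
    using lift_hom(1)[OF f[OF that]] by (simp add: \<phi>E restr_hom subgp_realize)
  have "?h \<in> ring_iso ?E (commutant \<psi> M)"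
  proof (rule ring_iso_memI)
    show "?h \<phi> \<in> carrier (commutant \<psi> M)" if "\<phi> \<in> carrier ?E" for \<phi> by (rule h[OF that])
    show "bij_betw ?h (carrier ?E) (carrier (commutant \<psi> M))"
    proof (rule bij_betwI[where g = ?l])
      show "?h (?l a) = a" if "a \<in> carrier (commutant \<psi> M)" for a
        by (rule commutant_eqI[OF h[OF l[OF that]] that])
           (use lift_hom(2)[OF f[OF that]] R0 in \<open>simp add: base_def\<close>)
      show "?l (?h \<phi>) = \<phi>" if \<phi>: "\<phi> \<in> carrier ?E" for \<phi>
      proof (rule extensionalityI)
        fix v assume v: "v \<in> ?R"
        note hh = f[OF h[OF \<phi>]]
        have "lift (?h \<phi>) v = \<phi> v"
          by (rule hom_realize_eqI[OF lift_hom(1)[OF hh] _ _ v])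
             (use \<phi> lift_hom(2)[OF hh] in \<open>simp_all add: \<phi>E\<close>)
        with v show "?l (?h \<phi>) v = \<phi> v" by simp
      qed (use \<phi> in \<open>auto simp: \<phi>E\<close>)
      show "?h \<in> carrier ?E \<rightarrow> carrier (commutant \<psi> M)" by (intro Pi_I h)
      show "?l \<in> carrier (commutant \<psi> M) \<rightarrow> carrier ?E" by (intro Pi_I l)
    qed
    show "?h \<one>\<^bsub>?E\<^esub> = \<one>\<^bsub>commutant \<psi> M\<^esub>"
      using R0 by (auto simp: commutant_simps endomorphism_ring_grp_simps base_def fun_eq_iff)
    fix \<phi> \<chi> assume \<phi>: "\<phi> \<in> carrier ?E" and \<chi>: "\<chi> \<in> carrier ?E"
    have "base (compose ?R \<phi> \<chi>) x = base \<phi> (base \<chi> x)" if "x \<in> M" for x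
    proof -
      have "\<chi> (x, 0) = (base \<chi> x, 0)"
        using \<chi> hom_eq_base[of \<chi> x 0] hom_0[OF base_hom[of \<chi>] subgp_M] that subgp_M by (simp add: \<phi>E)
      then show ?thesis using R0[OF that] by (simp add: base_def compose_def)
    qed
    then show "?h (\<phi> \<otimes>\<^bsub>?E\<^esub> \<chi>) = ?h \<phi> \<otimes>\<^bsub>commutant \<psi> M\<^esub> ?h \<chi>"
      using \<chi> hom_in[OF base_hom[of \<chi>]]
      by (auto simp: commutant_simps endomorphism_ring_grp_simps compose_def fun_eq_iff \<phi>E)
    show "?h (\<phi> \<oplus>\<^bsub>?E\<^esub> \<chi>) = ?h \<phi> \<oplus>\<^bsub>commutant \<psi> M\<^esub> ?h \<chi>"
      using R0 by (auto simp: commutant_simps endomorphism_ring_grp_simps base_def fun_eq_iff)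
  qed
  then show ?thesis by (auto simp: is_ring_iso_def)
qed

section \<open>Graded endomorphisms of a direct sum\<close>

text \<open>Elements are total functions that vanish outside \<open>I\<close>, so the same
  projections act on sums over different index sets.\<close>

definition direct_sum :: "'i set \<Rightarrow> ('i \<Rightarrow> 'a set) \<Rightarrow> ('i \<Rightarrow> 'a::real_vector) set" where
  "direct_sum I C = {F. finite {i. F i \<noteq> 0} \<and> (\<forall>i\<in>I. F i \<in> C i) \<and> (\<forall>i. i \<notin> I \<longrightarrow> F i = 0)}"

definition single :: "'i \<Rightarrow> 'a \<Rightarrow> 'i \<Rightarrow> 'a::zero" where
  "single i x = (\<lambda>j. if j = i then x else 0)"

text \<open>The projections are enumerated by natural numbers to fit the operator sequence of a
  realisation. An index outside \<open>I\<close> gives the zero operator on the direct sum.\<close>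

definition proj :: "nat \<Rightarrow> ('i::countable \<Rightarrow> 'a) \<Rightarrow> 'i \<Rightarrow> 'a::zero" where
  "proj k F = single (from_nat k) (F (from_nat k))"

lemma single_same [simp]: "single i x i = x"
  by (simp add: single_def)

lemma single_0 [simp]: "single i 0 = 0"
  by (simp add: single_def fun_eq_iff)

lemma single_add: "single i (x + y) = single i x + single i (y :: 'a::real_vector)"
  by (auto simp: single_def fun_eq_iff)

lemma proj_to_nat [simp]: "proj (to_nat i) F = single i (F i)"
  by (simp add: proj_def)

lemma linear_proj: "linear (proj k :: ('i::countable \<Rightarrow> 'a::real_vector) \<Rightarrow> _)"
  by (rule linearI) (auto simp: proj_def single_def fun_eq_iff)

lemma direct_sumD: "F \<in> direct_sum I C \<Longrightarrow> i \<in> I \<Longrightarrow> F i \<in> C i"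
  by (simp add: direct_sum_def)

lemma direct_sum_outside: "F \<in> direct_sum I C \<Longrightarrow> i \<notin> I \<Longrightarrow> F i = 0"
  by (simp add: direct_sum_def)

lemma subgp_direct_sum:
  assumes "\<And>i. i \<in> I \<Longrightarrow> subgp (C i)"
  shows "subgp (direct_sum I C)"
  unfolding subgp_def
proof (intro conjI ballI)
  show "0 \<in> direct_sum I C" using assms by (simp add: direct_sum_def)
  fix F G assume F: "F \<in> direct_sum I C" and G: "G \<in> direct_sum I C"
  have "{i. (F - G) i \<noteq> 0} \<subseteq> {i. F i \<noteq> 0} \<union> {i. G i \<noteq> 0}" by auto
  then have "finite {i. (F - G) i \<noteq> 0}"
    using F G by (elim finite_subset) (simp add: direct_sum_def)
  then show "F - G \<in> direct_sum I C"
    using F G subgp_diff[OF assms] by (simp add: direct_sum_def)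
qed

lemma single_in_direct_sum:
  assumes "\<And>i. i \<in> I \<Longrightarrow> subgp (C i)" "i \<in> I" "x \<in> C i"
  shows "single i x \<in> direct_sum I C"
proof -
  have "{j. single i x j \<noteq> 0} \<subseteq> {i}" by (auto simp: single_def)
  then have "finite {j. single i x j \<noteq> 0}" by (rule finite_subset) simp
  then show ?thesis using assms by (auto simp: direct_sum_def single_def)
qed

lemma proj_in_direct_sum:
  assumes "\<And>i. i \<in> I \<Longrightarrow> subgp (C i)" "F \<in> direct_sum I C"
  shows "proj k F \<in> direct_sum I C"
proof (cases "from_nat k \<in> I")
  case True
  then show ?thesis unfolding proj_def
    by (intro single_in_direct_sum assms(1) direct_sumD[OF assms(2)])
next
  case False
  then show ?thesis
    using direct_sum_outside[OF assms(2) False] subgp_0[OF subgp_direct_sum, of I C] assms(1) by (simp add: proj_def)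
qed

lemma proj_hom_direct_sum:
  assumes "\<And>i. i \<in> I \<Longrightarrow> subgp (C i)"
  shows "proj k \<in> hom (grp (direct_sum I C)) (grp (direct_sum I C))"
  using proj_in_direct_sum[of I C] assms by (simp add: hom_grp_iff linear_add[OF linear_proj])

text \<open>Every \<open>C i\<close> has an infinite cyclic direct summand: it is generated by
  \<open>u i\<close>, and \<open>g i\<close> is the coordinate on it.\<close>

locale pointed_family =
  fixes I :: "'i::countable set" and C :: "'i \<Rightarrow> 'a::real_vector set"
    and g :: "'i \<Rightarrow> 'a \<Rightarrow> real" and u :: "'i \<Rightarrow> 'a"
  assumes subgp_C: "i \<in> I \<Longrightarrow> subgp (C i)"
    and g_hom: "i \<in> I \<Longrightarrow> g i \<in> hom (grp (C i)) (grp \<int>)"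
    and u_in: "i \<in> I \<Longrightarrow> u i \<in> C i"
    and g_u: "i \<in> I \<Longrightarrow> g i (u i) = 1"
begin

abbreviation "M \<equiv> direct_sum I C"
abbreviation "D \<equiv> commutant proj M"

lemma subgp_M: "subgp M"
  by (rule subgp_direct_sum[OF subgp_C])

lemma single_M: "i \<in> I \<Longrightarrow> x \<in> C i \<Longrightarrow> single i x \<in> M"
  by (rule single_in_direct_sum[OF subgp_C])

lemma ring_D: "ring D"
  by (rule ring_commutant[OF subgp_M proj_hom_direct_sum[OF subgp_C]])

lemma D_hom: "d \<in> carrier D \<Longrightarrow> d \<in> hom (grp M) (grp M)"
  by (simp add: commutant_iff)

lemma D_in: "d \<in> carrier D \<Longrightarrow> F \<in> M \<Longrightarrow> d F \<in> M"
  by (rule hom_in[OF D_hom])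

lemma D_single: "d \<in> carrier D \<Longrightarrow> F \<in> M \<Longrightarrow> d (single i (F i)) = single i (d F i)"
  using proj_to_nat[of i] by (metis commutant_iff)

lemma D_single': "d \<in> carrier D \<Longrightarrow> i \<in> I \<Longrightarrow> x \<in> C i \<Longrightarrow> d (single i x) = single i (d (single i x) i)"
  using D_single[of d "single i x" i] single_M by simp

lemma D_component: "d \<in> carrier D \<Longrightarrow> i \<in> I \<Longrightarrow> x \<in> C i \<Longrightarrow> d (single i x) i \<in> C i"
  by (rule direct_sumD[OF D_in[OF _ single_M]])

text \<open>These are operators of rank one. \<open>E i (u i)\<close> is the projection onto the
  cyclic summand of component \<open>i\<close>, and the operators \<open>E i b\<close> with
  \<open>b\<close> in \<open>C i\<close> form the left ideal that it generates, a copy of the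
  additive group \<open>C i\<close>.\<close>

definition E :: "'i \<Rightarrow> 'a \<Rightarrow> ('i \<Rightarrow> 'a) \<Rightarrow> 'i \<Rightarrow> 'a" where
  "E i b = (\<lambda>F\<in>M. single i (g i (F i) *\<^sub>R b))"

definition P :: "'i \<Rightarrow> ('i \<Rightarrow> 'a) \<Rightarrow> 'i \<Rightarrow> 'a" where
  "P i = (\<lambda>F\<in>M. single i (F i))"

lemma g_Ints: "i \<in> I \<Longrightarrow> F \<in> M \<Longrightarrow> g i (F i) \<in> \<int>"
  using hom_in[OF g_hom, of i "F i"] direct_sumD[of F I C i] by simp

lemma g_add: "i \<in> I \<Longrightarrow> F \<in> M \<Longrightarrow> G \<in> M \<Longrightarrow> g i (F i + G i) = g i (F i) + g i (G i)"
  using hom_add[OF g_hom, of i "F i" "G i"] direct_sumD[of _ I C i] by simp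

lemma g_scale_in: "i \<in> I \<Longrightarrow> F \<in> M \<Longrightarrow> b \<in> C i \<Longrightarrow> g i (F i) *\<^sub>R b \<in> C i"
  by (rule subgp_scaleR_int[OF subgp_C _ g_Ints])

text \<open>The last condition says that \<open>k\<close> depends only on component
  \<open>i\<close>, and the values are put back into component \<open>i\<close>; hence the map
  respects the grading.\<close>

lemma factor_in_D:
  fixes k :: "('i \<Rightarrow> 'a) \<Rightarrow> 'a"
  assumes i: "i \<in> I" and k: "\<And>F. F \<in> M \<Longrightarrow> k F \<in> C i"
    "\<And>F G. F \<in> M \<Longrightarrow> G \<in> M \<Longrightarrow> k (F + G) = k F + k G"
    "\<And>F. F \<in> M \<Longrightarrow> k (single i (F i)) = k F"
  shows "(\<lambda>F\<in>M. single i (k F)) \<in> carrier D"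
proof (rule restrict_in_commutant)
  show "single i (k F) \<in> M" if "F \<in> M" for F by (rule single_M[OF i k(1)[OF that]])
  show "single i (k (F + G)) = single i (k F) + single i (k G)" if "F \<in> M" "G \<in> M" for F G
    by (simp add: k(2)[OF that] single_add)
  show "single i (k (proj n F)) = proj n (single i (k F))" if F: "F \<in> M" for n F
  proof (cases "from_nat n = i")
    case True
    then show ?thesis by (simp add: proj_def k(3)[OF F])
  next
    case False
    have G: "proj n F \<in> M" by (rule proj_in_direct_sum[OF subgp_C F])
    have "k 0 = 0" using k(2)[OF subgp_0[OF subgp_M] subgp_0[OF subgp_M]] by simp
    then have "k (proj n F) = 0"
      using k(3)[OF G] False by (simp add: proj_def single_def[of "from_nat n"])
    then show ?thesis using False by (simp add: proj_def single_def[of i])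
  qed
qed (use proj_in_direct_sum[OF subgp_C] subgp_M in auto)

lemma E_in: "i \<in> I \<Longrightarrow> b \<in> C i \<Longrightarrow> E i b \<in> carrier D"
  unfolding E_def
  by (rule factor_in_D) (simp_all add: g_scale_in g_add scaleR_add_left)

lemma P_in: "i \<in> I \<Longrightarrow> P i \<in> carrier D"
  unfolding P_def by (rule factor_in_D) (simp_all add: direct_sumD)

lemma E_apply: "F \<in> M \<Longrightarrow> E i b F = single i (g i (F i) *\<^sub>R b)"
  by (simp add: E_def)

lemma E_single_u: "i \<in> I \<Longrightarrow> E i b (single i (u i)) = single i b"
  by (simp add: E_apply single_M u_in g_u)

lemma P_apply: "F \<in> M \<Longrightarrow> P i F = single i (F i)"
  by (simp add: P_def)

text \<open>A graded endomorphism maps component \<open>i\<close> to itself and commutes with the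
  integer factor \<open>g i (F i)\<close>.\<close>

lemma mult_E:
  assumes "d \<in> carrier D" "i \<in> I" "b \<in> C i"
  shows "d \<otimes>\<^bsub>D\<^esub> E i b = E i (d (single i b) i)"
proof (rule commutant_eqI)
  interpret ring D by (rule ring_D)
  show "d \<otimes>\<^bsub>D\<^esub> E i b \<in> carrier D" "E i (d (single i b) i) \<in> carrier D"
    using assms E_in D_component by auto
  fix F assume F: "F \<in> M"
  have "d (single i (g i (F i) *\<^sub>R b)) = d (g i (F i) *\<^sub>R single i b)"
    by (rule arg_cong[where f = d]) (auto simp: single_def fun_eq_iff)
  also have "\<dots> = g i (F i) *\<^sub>R d (single i b)"
    by (rule hom_scaleR_int[OF D_hom[OF assms(1)] subgp_M single_M[OF assms(2,3)] g_Ints[OF assms(2) F]])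
  also have "\<dots> = g i (F i) *\<^sub>R single i (d (single i b) i)"
    using D_single'[OF assms] by simp
  also have "\<dots> = single i (g i (F i) *\<^sub>R (d (single i b) i))"
    by (auto simp: single_def fun_eq_iff)
  finally show "(d \<otimes>\<^bsub>D\<^esub> E i b) F = E i (d (single i b) i) F"
    using F by (simp add: commutant_apply E_apply)
qed

lemma E_mult_E: "i \<in> I \<Longrightarrow> b \<in> C i \<Longrightarrow> c \<in> C i \<Longrightarrow> E i b \<otimes>\<^bsub>D\<^esub> E i c = E i (g i c *\<^sub>R b)"
  using mult_E[of "E i b" i c] by (simp add: E_in E_apply single_M)

lemma E_inject: "i \<in> I \<Longrightarrow> E i b = E i c \<Longrightarrow> b = c"
  using E_single_u[of i b] E_single_u[of i c] single_same by metis

lemma E_add: "i \<in> I \<Longrightarrow> E i (b + c) = E i b \<oplus>\<^bsub>D\<^esub> E i c"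
  by (auto simp: E_def commutant_simps fun_eq_iff scaleR_add_right single_def)

text \<open>The corner ring of \<open>E i (u i)\<close> consists of its integer multiples, and the
  only idempotent integers are 0 and 1.\<close>

lemma E_idempotent:
  assumes i: "i \<in> I" and f: "f \<in> carrier D" "E i (u i) \<otimes>\<^bsub>D\<^esub> f = f" "f \<otimes>\<^bsub>D\<^esub> E i (u i) = f"
    "f \<otimes>\<^bsub>D\<^esub> f = f"
  shows "f = \<zero>\<^bsub>D\<^esub> \<or> f = E i (u i)"
proof -
  define b where "b = f (single i (u i)) i"
  have b: "b \<in> C i" unfolding b_def by (intro D_component i f u_in)
  have fb: "f = E i b" using mult_E[OF f(1) i u_in[OF i]] f(3) by (simp add: b_def)
  have "E i (g i b *\<^sub>R u i) = E i b" using f(2) E_mult_E[OF i u_in[OF i] b] fb by simp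
  then have gb: "b = g i b *\<^sub>R u i" using E_inject[OF i] by metis
  have "E i (g i b *\<^sub>R b) = E i b" using f(4) E_mult_E[OF i b b] fb by simp
  then have "g i b *\<^sub>R b = b" by (rule E_inject[OF i])
  then have "b = 0 \<or> g i b = 1" by (metis scaleR_cancel_right scaleR_one)
  then show ?thesis
  proof
    assume "b = 0"
    then show ?thesis by (auto simp: fb E_def commutant_simps fun_eq_iff)
  next
    assume "g i b = 1"
    then show ?thesis using gb fb by simp
  qed
qed

end

text \<open>Division with remainder by the least positive element of \<open>S\<close> leaves a
  remainder in \<open>S\<close>, which must be 0.\<close>

lemma Ints_subgroup_least:
  assumes S: "subgp S" "S \<subseteq> \<int>" and x: "x \<in> S" "x \<noteq> (0::real)"
  obtains c where "c \<in> S" "c > 0" "\<And>y. y \<in> S \<Longrightarrow> y / c \<in> \<int>"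
proof -
  have "\<bar>x\<bar> \<in> S" using x(1) subgp_neg[OF S(1)] by (auto simp: abs_if)
  moreover obtain k where "x = of_int k" using S(2) x(1) by (auto elim: Ints_cases)
  then have "\<bar>x\<bar> = real (nat \<bar>k\<bar>)" by simp
  ultimately have "\<exists>n>0. real n \<in> S" using x(2) by (metis of_nat_0_less_iff zero_less_abs_iff)
  then obtain n where n: "n > 0" "real n \<in> S" "\<And>m. m > 0 \<Longrightarrow> real m \<in> S \<Longrightarrow> n \<le> m"
    using exists_least_iff[of "\<lambda>n. n > 0 \<and> real n \<in> S"] by (metis not_le)
  show ?thesis
  proof (rule that[of "real n"])
    fix y assume y: "y \<in> S"
    then obtain k where k: "y = of_int k" using S(2) by (auto elim: Ints_cases)
    let ?m = "k mod int n"
    have "?m = k - k div int n * int n" by (simp add: minus_div_mult_eq_mod)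
    then have "real_of_int ?m = y - of_int (k div int n) * real n" unfolding k by simp
    then have mS: "real_of_int ?m \<in> S"
      using subgp_diff[OF S(1) y subgp_scaleR_int[OF S(1) n(2), of "of_int (k div int n)"]] by simp
    have m: "0 \<le> ?m" "?m < int n" using n(1) by simp_all
    have "?m = 0"
    proof (rule ccontr)
      assume "?m \<noteq> 0"
      then have "n \<le> nat ?m" using m mS by (intro n(3)) simp_all
      then show False using m n(1) by linarith
    qed
    then obtain l where "k = int n * l" by blast
    then show "y / real n \<in> \<int>" using n(1) k by simp
  qed (use n in auto)
qed

section \<open>Ring isomorphisms recognise the summands\<close>

context
  fixes I I' :: "'i::countable set" and C C' :: "'i \<Rightarrow> 'a::real_vector set"
    and g g' :: "'i \<Rightarrow> 'a \<Rightarrow> real" and u u' :: "'i \<Rightarrow> 'a" and \<Phi>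
  assumes A: "pointed_family I C g u" and B: "pointed_family I' C' g' u'"
    and \<Phi>: "\<Phi> \<in> ring_iso (commutant proj (direct_sum I C)) (commutant proj (direct_sum I' C'))"
begin

interpretation A: pointed_family I C g u by (rule A)
interpretation B: pointed_family I' C' g' u' by (rule B)
interpretation RA: ring A.D by (rule A.ring_D)
interpretation RB: ring B.D by (rule B.ring_D)

text \<open>The image \<open>e'\<close> of the primitive idempotent \<open>e = E q (u q)\<close> is
  concentrated in one component \<open>q'\<close>. There it is equivalent to the projection
  \<open>z\<close> onto the cyclic summand, that is, \<open>e' = v v'\<close> and
  \<open>z = v' v\<close>. Right multiplication by \<open>v\<close> identifies the left ideals of
  \<open>e'\<close> and \<open>z\<close>, which are additively \<open>C q\<close> and
  \<open>C' q'\<close>.\<close>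

lemma summand_correspondence:
  assumes q: "q \<in> I"
  obtains q' where "q' \<in> I'" "grp (C q) \<cong> grp (C' q')"
proof -
  define \<Psi> where "\<Psi> = inv_into (carrier A.D) \<Phi>"
  have \<Psi>: "\<Psi> \<in> ring_iso B.D A.D"
    unfolding \<Psi>_def by (rule ring_iso_set_sym[OF A.ring_D \<Phi>])
  note \<Phi>E = ring_iso_memE[OF \<Phi>] and \<Psi>E = ring_iso_memE[OF \<Psi>]
  have \<Psi>\<Phi>: "\<Psi> (\<Phi> d) = d" if "d \<in> carrier A.D" for d
    using that bij_betw_inv_into_left[OF \<Phi>E(5)] by (simp add: \<Psi>_def)
  have \<Phi>\<Psi>: "\<Phi> (\<Psi> d) = d" if "d \<in> carrier B.D" for d
    using that bij_betw_inv_into_right[OF \<Phi>E(5)] by (simp add: \<Psi>_def)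
  have \<Phi>0: "\<Phi> \<zero>\<^bsub>A.D\<^esub> = \<zero>\<^bsub>B.D\<^esub>"
    by (rule ring_hom_zero[OF _ A.ring_D B.ring_D]) (use \<Phi> in \<open>simp add: ring_iso_def\<close>)
  have \<Psi>0: "\<Psi> \<zero>\<^bsub>B.D\<^esub> = \<zero>\<^bsub>A.D\<^esub>"
    using \<Phi>0 \<Psi>\<Phi>[OF RA.zero_closed] by simp

  define e where "e = A.E q (u q)"
  define e' where "e' = \<Phi> e"
  have eD: "e \<in> carrier A.D" unfolding e_def by (intro A.E_in q A.u_in)
  have e'D: "e' \<in> carrier B.D" unfolding e'_def by (rule \<Phi>E(1)[OF eD])
  have ee: "e \<otimes>\<^bsub>A.D\<^esub> e = e"
    unfolding e_def using A.E_mult_E[OF q A.u_in[OF q] A.u_in[OF q]] A.g_u[OF q] by simp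
  have e'e': "e' \<otimes>\<^bsub>B.D\<^esub> e' = e'"
    unfolding e'_def using \<Phi>E(2)[OF eD eD] ee by simp
  have "e \<noteq> \<zero>\<^bsub>A.D\<^esub>"
  proof
    assume "e = \<zero>\<^bsub>A.D\<^esub>"
    then have "e (single q (u q)) = 0"
      using A.single_M[OF q A.u_in[OF q]] by (simp add: commutant_apply)
    then have "single q (u q) = 0" using A.E_single_u[OF q] by (simp add: e_def)
    then have "u q = 0" using single_same[of q "u q"] by simp
    then show False using A.g_u[OF q] hom_0[OF A.g_hom[OF q] A.subgp_C[OF q]] by simp
  qed
  then have e'0: "e' \<noteq> \<zero>\<^bsub>B.D\<^esub>"
    using \<Psi>0 \<Psi>\<Phi>[OF eD] by (auto simp: e'_def)
  have idem: "f = \<zero>\<^bsub>B.D\<^esub> \<or> f = e'"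
    if f: "f \<in> carrier B.D" "e' \<otimes>\<^bsub>B.D\<^esub> f = f" "f \<otimes>\<^bsub>B.D\<^esub> e' = f" "f \<otimes>\<^bsub>B.D\<^esub> f = f" for f
  proof -
    have fD: "\<Psi> f \<in> carrier A.D" by (rule \<Psi>E(1)[OF f(1)])
    have "e \<otimes>\<^bsub>A.D\<^esub> \<Psi> f = \<Psi> f" "\<Psi> f \<otimes>\<^bsub>A.D\<^esub> e = \<Psi> f" "\<Psi> f \<otimes>\<^bsub>A.D\<^esub> \<Psi> f = \<Psi> f"
      using \<Psi>E(2)[OF e'D f(1)] \<Psi>E(2)[OF f(1) e'D] \<Psi>E(2)[OF f(1) f(1)] f \<Psi>\<Phi>[OF eD]
      by (simp_all add: e'_def)
    then have "\<Psi> f = \<zero>\<^bsub>A.D\<^esub> \<or> \<Psi> f = e"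
      using A.E_idempotent[OF q fD] by (simp add: e_def)
    then show ?thesis using \<Phi>\<Psi>[OF f(1)] \<Phi>0 by (auto simp: e'_def)
  qed

  \<comment> \<open>A component on which \<open>e'\<close> does not vanish serves as
    \<open>q'\<close>.\<close>
  have "\<exists>F\<in>B.M. e' F \<noteq> 0"
  proof (rule ccontr)
    assume "\<not> ?thesis"
    then have "e' = \<zero>\<^bsub>B.D\<^esub>"
      by (intro commutant_eqI[OF e'D RB.zero_closed]) (simp add: commutant_apply)
    with e'0 show False by contradiction
  qed
  then obtain F1 where F1: "F1 \<in> B.M" "e' F1 \<noteq> 0" by blast
  then obtain q' where q'nz: "e' F1 q' \<noteq> 0" by (auto simp: fun_eq_iff)
  have q': "q' \<in> I'"
    using direct_sum_outside[OF B.D_in[OF e'D F1(1)], of q'] q'nz by blast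
  define b1 where "b1 = F1 q'"
  have b1: "b1 \<in> C' q'" unfolding b1_def by (rule direct_sumD[OF F1(1) q'])
  have e'b1: "e' (single q' b1) \<noteq> 0"
  proof
    assume "e' (single q' b1) = 0"
    then have "single q' (e' F1 q') = 0" using B.D_single[OF e'D F1(1), of q'] by (simp add: b1_def)
    then show False using q'nz single_same[of q' "e' F1 q'"] by simp
  qed

  have P: "B.P q' \<in> carrier B.D" by (rule B.P_in[OF q'])
  have PM: "B.P q' F \<in> B.M" if "F \<in> B.M" for F by (rule B.D_in[OF P that])
  have comm: "B.P q' \<otimes>\<^bsub>B.D\<^esub> d = d \<otimes>\<^bsub>B.D\<^esub> B.P q'" if d: "d \<in> carrier B.D" for d
    by (rule commutant_eqI[OF RB.m_closed[OF P d] RB.m_closed[OF d P]])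
       (simp add: commutant_apply B.P_apply B.D_in[OF d] B.D_single[OF d])
  have PP: "B.P q' \<otimes>\<^bsub>B.D\<^esub> B.P q' = B.P q'"
    by (rule commutant_eqI[OF RB.m_closed[OF P P] P])
       (simp add: commutant_apply PM, simp add: B.P_apply B.single_M[OF q'] direct_sumD[OF _ q'])
  \<comment> \<open>The projection \<open>B.P q'\<close> is central, so its product with
    \<open>e'\<close> is an idempotent below \<open>e'\<close>. It is nonzero at \<open>F1\<close>,
    and primitivity makes it equal to \<open>e'\<close>.\<close>
  have e'P: "e' = B.P q' \<otimes>\<^bsub>B.D\<^esub> e'"
  proof -
    let ?f = "B.P q' \<otimes>\<^bsub>B.D\<^esub> e'"
    have fD: "?f \<in> carrier B.D" using P e'D by simp
    have fe: "?f \<otimes>\<^bsub>B.D\<^esub> e' = ?f" using P e'D e'e' by (simp add: RB.m_assoc)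
    have ef: "e' \<otimes>\<^bsub>B.D\<^esub> ?f = ?f"
      using comm[OF e'D] P e'D e'e' by (metis RB.m_assoc)
    have "?f \<otimes>\<^bsub>B.D\<^esub> ?f = ?f"
      using PP ef P e'D fD by (metis RB.m_assoc)
    then have "?f = \<zero>\<^bsub>B.D\<^esub> \<or> ?f = e'" by (intro idem fD fe ef)
    moreover have "?f F1 \<noteq> 0"
    proof
      assume "?f F1 = 0"
      then have "single q' (e' F1 q') = 0"
        using F1(1) by (simp add: commutant_apply B.P_apply B.D_in[OF e'D])
      then show False using q'nz single_same[of q' "e' F1 q'"] by simp
    qed
    then have "?f \<noteq> \<zero>\<^bsub>B.D\<^esub>" by (metis commutant_apply(3)[OF F1(1)])
    ultimately show ?thesis by simp
  qed

  define z where "z = B.E q' (u' q')"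
  have zD: "z \<in> carrier B.D" unfolding z_def by (intro B.E_in q' B.u_in)
  \<comment> \<open>A nonzero element of \<open>z D e'\<close> is needed. If there were none, the
    preimage of \<open>z\<close> would kill component \<open>q\<close>, so \<open>e t w = 0\<close>
    for that preimage \<open>w\<close> and every graded endomorphism \<open>t\<close> of the first
    sum; transported back, \<open>e' y z = 0\<close> for all \<open>y\<close>.\<close>
  have "\<exists>d\<in>carrier B.D. z \<otimes>\<^bsub>B.D\<^esub> (d \<otimes>\<^bsub>B.D\<^esub> e') \<noteq> \<zero>\<^bsub>B.D\<^esub>"
  proof (rule ccontr)
    assume neg: "\<not> ?thesis"
    let ?w = "\<Psi> z"
    have wD: "?w \<in> carrier A.D" by (rule \<Psi>E(1)[OF zD])
    have w0: "?w (single q b) = 0" if b: "b \<in> C q" for b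
    proof -
      have bD: "A.E q b \<in> carrier A.D" by (rule A.E_in[OF q b])
      have be: "A.E q b \<otimes>\<^bsub>A.D\<^esub> e = A.E q b"
        unfolding e_def using A.E_mult_E[OF q b A.u_in[OF q]] A.g_u[OF q] by simp
      have "z \<otimes>\<^bsub>B.D\<^esub> (\<Phi> (A.E q b) \<otimes>\<^bsub>B.D\<^esub> e') = \<zero>\<^bsub>B.D\<^esub>"
        using neg \<Phi>E(1)[OF bD] by blast
      then have "z \<otimes>\<^bsub>B.D\<^esub> \<Phi> (A.E q b) = \<zero>\<^bsub>B.D\<^esub>"
        using \<Phi>E(2)[OF bD eD] be by (simp add: e'_def)
      then have "?w \<otimes>\<^bsub>A.D\<^esub> A.E q b = \<zero>\<^bsub>A.D\<^esub>"
        using \<Psi>E(2)[OF zD \<Phi>E(1)[OF bD]] \<Psi>0 \<Psi>\<Phi>[OF bD] by simp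
      then have "(?w \<otimes>\<^bsub>A.D\<^esub> A.E q b) (single q (u q)) = 0"
        using A.single_M[OF q A.u_in[OF q]] by (simp add: commutant_apply)
      then show ?thesis
        using A.single_M[OF q A.u_in[OF q]] A.E_single_u[OF q] by (simp add: commutant_apply)
    qed
    \<comment> \<open>This choice satisfies \<open>y z = y\<close> and has \<open>e' y\<close>
      nonzero, because \<open>e'\<close> does not kill \<open>b1\<close>.\<close>
    define y where "y = B.E q' b1"
    have yD: "y \<in> carrier B.D" unfolding y_def by (intro B.E_in q' b1)
    let ?t = "\<Psi> y"
    have tD: "?t \<in> carrier A.D" by (rule \<Psi>E(1)[OF yD])
    have twD: "?t \<otimes>\<^bsub>A.D\<^esub> ?w \<in> carrier A.D" using tD wD by simp
    have "e \<otimes>\<^bsub>A.D\<^esub> (?t \<otimes>\<^bsub>A.D\<^esub> ?w) = \<zero>\<^bsub>A.D\<^esub>"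
    proof (rule commutant_eqI)
      show "e \<otimes>\<^bsub>A.D\<^esub> (?t \<otimes>\<^bsub>A.D\<^esub> ?w) \<in> carrier A.D" using eD twD by simp
      fix F assume F: "F \<in> A.M"
      have "(?t \<otimes>\<^bsub>A.D\<^esub> ?w) (single q (F q)) = ?t (?w (single q (F q)))"
        using A.single_M[OF q direct_sumD[OF F q]] by (simp add: commutant_apply)
      also have "\<dots> = 0"
        using w0[OF direct_sumD[OF F q]] hom_0[OF A.D_hom[OF tD] A.subgp_M] by simp
      finally have "single q ((?t \<otimes>\<^bsub>A.D\<^esub> ?w) F q) = 0" using A.D_single[OF twD F] by simp
      then have "(?t \<otimes>\<^bsub>A.D\<^esub> ?w) F q = 0" by (metis single_same zero_fun_apply)
      then have "e ((?t \<otimes>\<^bsub>A.D\<^esub> ?w) F) = 0"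
        using A.D_in[OF twD F] hom_0[OF A.g_hom[OF q] A.subgp_C[OF q]]
        by (simp add: e_def A.E_apply)
      then show "(e \<otimes>\<^bsub>A.D\<^esub> (?t \<otimes>\<^bsub>A.D\<^esub> ?w)) F = \<zero>\<^bsub>A.D\<^esub> F"
        using F by (simp add: commutant_apply)
    qed simp
    then have "\<Phi> e \<otimes>\<^bsub>B.D\<^esub> (\<Phi> ?t \<otimes>\<^bsub>B.D\<^esub> \<Phi> ?w) = \<zero>\<^bsub>B.D\<^esub>"
      using \<Phi>E(2)[OF eD twD] \<Phi>E(2)[OF tD wD] \<Phi>0 by simp
    then have "e' \<otimes>\<^bsub>B.D\<^esub> (y \<otimes>\<^bsub>B.D\<^esub> z) = \<zero>\<^bsub>B.D\<^esub>"
      using \<Phi>\<Psi>[OF yD] \<Phi>\<Psi>[OF zD] by (simp add: e'_def)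
    moreover have "y \<otimes>\<^bsub>B.D\<^esub> z = y"
      unfolding y_def z_def using B.E_mult_E[OF q' b1 B.u_in[OF q']] B.g_u[OF q'] by simp
    ultimately have "(e' \<otimes>\<^bsub>B.D\<^esub> y) (single q' (u' q')) = 0"
      using B.single_M[OF q' B.u_in[OF q']] by (simp add: commutant_apply)
    then have "e' (single q' b1) = 0"
      using B.single_M[OF q' B.u_in[OF q']] B.E_single_u[OF q'] by (simp add: commutant_apply y_def)
    with e'b1 show False by contradiction
  qed
  then obtain d where dD: "d \<in> carrier B.D"
    and nz: "z \<otimes>\<^bsub>B.D\<^esub> (d \<otimes>\<^bsub>B.D\<^esub> e') \<noteq> \<zero>\<^bsub>B.D\<^esub>" by blast

  let ?de = "d \<otimes>\<^bsub>B.D\<^esub> e'"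
  have deD: "?de \<in> carrier B.D" using dD e'D by simp
  \<comment> \<open>An integer-valued functional: composing \<open>?de\<close> with \<open>z\<close>
    maps \<open>F\<close> to \<open>k F\<close> times \<open>u' q'\<close> in component
    \<open>q'\<close>. It factors through \<open>e'\<close>.\<close>
  define k where "k F = g' q' (?de F q')" for F
  have k_Ints: "k F \<in> \<int>" if "F \<in> B.M" for F
    unfolding k_def by (rule B.g_Ints[OF q' B.D_in[OF deD that]])
  have k_add: "k (F + G) = k F + k G" if "F \<in> B.M" "G \<in> B.M" for F G
    unfolding k_def using B.g_add[OF q' B.D_in[OF deD that(1)] B.D_in[OF deD that(2)]]
    by (simp add: hom_add[OF B.D_hom[OF deD] that])
  have k_hom: "k \<in> hom (grp B.M) (grp \<int>)" using k_Ints k_add by (simp add: hom_grp_iff)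
  have k_single: "k (single q' (F q')) = k F" if "F \<in> B.M" for F
    unfolding k_def using B.D_single[OF deD that] by simp
  have k_e': "k (e' F) = k F" if F: "F \<in> B.M" for F
  proof -
    have "?de (e' F) = (?de \<otimes>\<^bsub>B.D\<^esub> e') F" by (simp add: commutant_apply(1)[OF F])
    also have "?de \<otimes>\<^bsub>B.D\<^esub> e' = ?de" using dD e'D e'e' by (simp add: RB.m_assoc)
    finally show ?thesis by (simp add: k_def)
  qed
  have "\<exists>F\<in>B.M. k F \<noteq> 0"
  proof (rule ccontr)
    assume neg: "\<not> ?thesis"
    have "z \<otimes>\<^bsub>B.D\<^esub> ?de = \<zero>\<^bsub>B.D\<^esub>"
    proof (rule commutant_eqI[OF RB.m_closed[OF zD deD] RB.zero_closed])
      fix F assume F: "F \<in> B.M"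
      then have "z (?de F) = 0"
        using neg B.E_apply[OF B.D_in[OF deD F]] by (simp add: z_def k_def)
      then show "(z \<otimes>\<^bsub>B.D\<^esub> ?de) F = \<zero>\<^bsub>B.D\<^esub> F" using F by (simp add: commutant_apply)
    qed
    with nz show False by contradiction
  qed
  then obtain F2 where F2: "F2 \<in> B.M" "k F2 \<noteq> 0" by blast
  \<comment> \<open>The image of \<open>k\<close> is generated by some \<open>c > 0\<close>.
    Division by \<open>c\<close> makes the functional surjective onto the integers, and
    \<open>F0\<close> is mapped to the generator.\<close>
  have "subgp (k ` B.M)"
    by (rule subgp_hom_image[OF k_hom B.subgp_M])
  moreover have "k ` B.M \<subseteq> \<int>" using k_Ints by blast
  ultimately obtain c where c: "c \<in> k ` B.M" "c > 0" "\<And>x. x \<in> k ` B.M \<Longrightarrow> x / c \<in> \<int>"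
    using F2 Ints_subgroup_least[of "k ` B.M" "k F2"] by blast
  then obtain F0 where F0: "F0 \<in> B.M" "k F0 = c" by blast

  \<comment> \<open>\<open>v'\<close> is the normalised functional followed by the inclusion of the
    cyclic summand; \<open>v\<close> below sends the generator of that summand to
    \<open>e' F0\<close>.\<close>
  define v' where "v' = (\<lambda>F\<in>B.M. single q' ((k F / c) *\<^sub>R u' q'))"
  have v'D: "v' \<in> carrier B.D"
    unfolding v'_def
  proof (rule B.factor_in_D[OF q'])
    show "(k F / c) *\<^sub>R u' q' \<in> C' q'" if "F \<in> B.M" for F
      by (rule subgp_scaleR_int[OF B.subgp_C[OF q'] B.u_in[OF q']]) (use c that in blast)
  qed (simp_all add: k_add k_single add_divide_distrib scaleR_add_left)
  define b0 where "b0 = e' F0 q'"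
  have b0: "b0 \<in> C' q'" unfolding b0_def by (rule direct_sumD[OF B.D_in[OF e'D F0(1)] q'])
  note sb0 = B.single_M[OF q' b0]
  have sb0_eq: "single q' b0 = e' F0"
  proof -
    have "e' F0 = B.P q' (e' F0)"
      using commutant_apply(1)[OF F0(1), of proj "B.P q'" e'] e'P by simp
    then show ?thesis using B.P_apply[OF B.D_in[OF e'D F0(1)]] by (simp add: b0_def)
  qed
  define v where "v = B.E q' b0"
  have vD: "v \<in> carrier B.D" unfolding v_def by (intro B.E_in q' b0)
  have e'v: "e' \<otimes>\<^bsub>B.D\<^esub> v = v"
  proof -
    have "e' (single q' b0) = single q' b0"
      unfolding sb0_eq using commutant_apply(1)[OF F0(1), of proj e' e'] e'e' by simp
    then show ?thesis unfolding v_def using B.mult_E[OF e'D q' b0] by simp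
  qed
  have v'e': "v' \<otimes>\<^bsub>B.D\<^esub> e' = v'"
    by (rule commutant_eqI[OF RB.m_closed[OF v'D e'D] v'D])
       (simp add: commutant_apply v'_def B.D_in[OF e'D] k_e')
  have v'b0: "v' (single q' b0) = single q' (u' q')"
    using sb0 c(2) k_e'[OF F0(1)] F0(2) by (simp add: v'_def sb0_eq)
  have v'v: "v' \<otimes>\<^bsub>B.D\<^esub> v = z"
    unfolding v_def z_def using B.mult_E[OF v'D q' b0] v'b0 by simp
  have vz: "v \<otimes>\<^bsub>B.D\<^esub> z = v"
    unfolding v_def z_def using B.E_mult_E[OF q' b0 B.u_in[OF q']] B.g_u[OF q'] by simp
  \<comment> \<open>As \<open>v' v = z\<close>, the product \<open>v v'\<close> is a nonzero
    idempotent below \<open>e'\<close>, hence equal to \<open>e'\<close> by primitivity.\<close>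
  have vv': "v \<otimes>\<^bsub>B.D\<^esub> v' = e'"
  proof -
    let ?f = "v \<otimes>\<^bsub>B.D\<^esub> v'"
    have fD: "?f \<in> carrier B.D" using vD v'D by simp
    have "e' \<otimes>\<^bsub>B.D\<^esub> ?f = ?f" using e'v vD v'D e'D by (metis RB.m_assoc)
    moreover have "?f \<otimes>\<^bsub>B.D\<^esub> e' = ?f" using v'e' vD v'D e'D by (metis RB.m_assoc)
    moreover have "?f \<otimes>\<^bsub>B.D\<^esub> ?f = ?f"
    proof -
      have "?f \<otimes>\<^bsub>B.D\<^esub> ?f = v \<otimes>\<^bsub>B.D\<^esub> (v' \<otimes>\<^bsub>B.D\<^esub> v) \<otimes>\<^bsub>B.D\<^esub> v'"
        using vD v'D by (simp add: RB.m_assoc)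
      then show ?thesis by (simp add: v'v vz)
    qed
    ultimately have "?f = \<zero>\<^bsub>B.D\<^esub> \<or> ?f = e'" by (intro idem fD)
    moreover have "?f \<noteq> \<zero>\<^bsub>B.D\<^esub>"
    proof
      assume f0: "?f = \<zero>\<^bsub>B.D\<^esub>"
      have "v = v \<otimes>\<^bsub>B.D\<^esub> (v' \<otimes>\<^bsub>B.D\<^esub> v)" by (simp add: v'v vz)
      also have "\<dots> = ?f \<otimes>\<^bsub>B.D\<^esub> v" using vD v'D by (simp add: RB.m_assoc)
      finally have "v = \<zero>\<^bsub>B.D\<^esub>" using f0 vD by simp
      then have "z = \<zero>\<^bsub>B.D\<^esub>" using v'v v'D by simp
      then show False using nz deD by simp
    qed
    ultimately show ?thesis by blast
  qed

  \<comment> \<open>Right multiplication by \<open>v\<close> takes the image of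
    \<open>A.E q b\<close> to \<open>B.E q' (j b)\<close>.\<close>
  define j where "j b = \<Phi> (A.E q b) (single q' b0) q'" for b
  have \<Phi>Ev: "\<Phi> (A.E q b) \<otimes>\<^bsub>B.D\<^esub> v = B.E q' (j b)" if "b \<in> C q" for b
    unfolding v_def j_def by (rule B.mult_E[OF \<Phi>E(1)[OF A.E_in[OF q that]] q' b0])
  have Ebe: "A.E q b \<otimes>\<^bsub>A.D\<^esub> e = A.E q b" if "b \<in> C q" for b
    unfolding e_def using A.E_mult_E[OF q that A.u_in[OF q]] A.g_u[OF q] by simp
  have \<Phi>Ee': "\<Phi> (A.E q b) \<otimes>\<^bsub>B.D\<^esub> e' = \<Phi> (A.E q b)" if "b \<in> C q" for b
    unfolding e'_def using \<Phi>E(2)[OF A.E_in[OF q that] eD] Ebe[OF that] by simp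
  have j_hom: "j \<in> hom (grp (C q)) (grp (C' q'))"
    unfolding hom_grp_iff
  proof (intro conjI ballI)
    fix b assume b: "b \<in> C q"
    show "j b \<in> C' q'" unfolding j_def by (rule B.D_component[OF \<Phi>E(1)[OF A.E_in[OF q b]] q' b0])
    fix b2 assume b2: "b2 \<in> C q"
    have "\<Phi> (A.E q (b + b2)) = \<Phi> (A.E q b) \<oplus>\<^bsub>B.D\<^esub> \<Phi> (A.E q b2)"
      unfolding A.E_add[OF q] by (rule \<Phi>E(3)[OF A.E_in[OF q b] A.E_in[OF q b2]])
    then show "j (b + b2) = j b + j b2"
      unfolding j_def by (simp add: commutant_apply(2)[OF sb0])
  qed
  have "bij_betw j (C q) (C' q')"
    unfolding bij_betw_def
  proof (intro conjI equalityI subsetI inj_onI)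
    fix b b2 assume b: "b \<in> C q" "b2 \<in> C q" and eq: "j b = j b2"
    \<comment> \<open>Multiplying by \<open>v'\<close> undoes the multiplication by
      \<open>v\<close>, since \<open>v v' = e'\<close> is a right identity on the left
      ideal.\<close>
    have rep: "\<Phi> (A.E q a) = B.E q' (j a) \<otimes>\<^bsub>B.D\<^esub> v'" if "a \<in> C q" for a
    proof -
      have "\<Phi> (A.E q a) = \<Phi> (A.E q a) \<otimes>\<^bsub>B.D\<^esub> (v \<otimes>\<^bsub>B.D\<^esub> v')"
        unfolding vv' by (rule \<Phi>Ee'[OF that, symmetric])
      also have "\<dots> = (\<Phi> (A.E q a) \<otimes>\<^bsub>B.D\<^esub> v) \<otimes>\<^bsub>B.D\<^esub> v'"
        using vD v'D \<Phi>E(1)[OF A.E_in[OF q that]] by (simp add: RB.m_assoc)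
      finally show ?thesis by (simp add: \<Phi>Ev[OF that])
    qed
    have "\<Phi> (A.E q b) = \<Phi> (A.E q b2)" unfolding rep[OF b(1)] rep[OF b(2)] eq ..
    from arg_cong[OF this, of \<Psi>] have "A.E q b = A.E q b2"
      unfolding \<Psi>\<Phi>[OF A.E_in[OF q b(1)]] \<Psi>\<Phi>[OF A.E_in[OF q b(2)]] .
    then show "b = b2" by (rule A.E_inject[OF q])
  next
    fix b' assume b': "b' \<in> C' q'"
    \<comment> \<open>This element lies in the left ideal of \<open>e'\<close>, so its preimage has
      the form \<open>A.E q b\<close>; this \<open>b\<close> is mapped to \<open>b'\<close>.\<close>
    let ?y = "B.E q' b' \<otimes>\<^bsub>B.D\<^esub> v'"
    have ED: "B.E q' b' \<in> carrier B.D" by (rule B.E_in[OF q' b'])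
    have yD: "?y \<in> carrier B.D" using ED v'D by simp
    have ye': "?y \<otimes>\<^bsub>B.D\<^esub> e' = ?y" using ED v'D e'D v'e' by (simp add: RB.m_assoc)
    define b where "b = \<Psi> ?y (single q (u q)) q"
    have b: "b \<in> C q" unfolding b_def by (rule A.D_component[OF \<Psi>E(1)[OF yD] q A.u_in[OF q]])
    have "\<Psi> ?y \<otimes>\<^bsub>A.D\<^esub> e = \<Psi> ?y"
      using \<Psi>E(2)[OF yD e'D] ye' \<Psi>\<Phi>[OF eD] by (simp add: e'_def)
    then have "\<Psi> ?y = A.E q b"
      using A.mult_E[OF \<Psi>E(1)[OF yD] q A.u_in[OF q]] by (simp add: e_def b_def)
    then have "\<Phi> (A.E q b) = ?y" using \<Phi>\<Psi>[OF yD] by simp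
    then have "j b = ?y (single q' b0) q'" by (simp add: j_def)
    also have "\<dots> = b'"
      by (simp add: commutant_apply(1)[OF sb0] v'b0 B.E_single_u[OF q'])
    finally show "b' \<in> j ` C q" using b by blast
  qed (use hom_in[OF j_hom] in auto)
  then have "j \<in> iso (grp (C q)) (grp (C' q'))" using j_hom by (simp add: iso_def)
  then show ?thesis using q' by (intro that) (auto intro: is_isoI)
qed

end

section \<open>Periodic block diagonal matrices\<close>

definition stage :: "nat \<Rightarrow> nat \<Rightarrow> (nat \<Rightarrow> nat \<Rightarrow> real) set" where
  "stage r N = {X. (\<forall>i j. X i j \<in> \<int>) \<and> (\<forall>i j. X i j \<noteq> 0 \<longrightarrow> i div r = j div N) \<and>
     (\<forall>i j. X (i + r) (j + N) = X i j)}"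

text \<open>
  These matrices have identical diagonal blocks of some size \<open>q N \<times> N\<close>. They form a right module
  of rank \<open>q\<close> over the ring \<open>pmat 1\<close>, the direct limit of the integer matrix rings.
\<close>

definition pmat :: "rat \<Rightarrow> (nat \<Rightarrow> nat \<Rightarrow> real) set" where
  "pmat q = {X. \<exists>r N. r > 0 \<and> N > 0 \<and> of_nat r = q * of_nat N \<and> X \<in> stage r N}"

text \<open>Right multiplication by the matrix with period \<open>N\<close> that has a single entry \<open>1\<close> per
  diagonal block, at position \<open>(a, b)\<close>.\<close>

definition rmul :: "nat \<times> nat \<times> nat \<Rightarrow> (nat \<Rightarrow> nat \<Rightarrow> real) \<Rightarrow> nat \<Rightarrow> nat \<Rightarrow> real" where
  "rmul = (\<lambda>(N, a, b) X i j. if a < N \<and> b < N \<and> j mod N = b then X i (j - b + a) else 0)"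

definition rop :: "nat \<Rightarrow> (nat \<Rightarrow> nat \<Rightarrow> real) \<Rightarrow> nat \<Rightarrow> nat \<Rightarrow> real" where
  "rop k = rmul (from_nat k)"

lemma stageD:
  assumes "X \<in> stage r N"
  shows "X i j \<in> \<int>" "X i j \<noteq> 0 \<Longrightarrow> i div r = j div N" "X (i + r) (j + N) = X i j"
  using assms by (auto simp: stage_def)

lemma stage_shift: "X \<in> stage r N \<Longrightarrow> X (i + k * r) (j + k * N) = X i j"
proof (induction k)
  case (Suc k)
  then show ?case
    using stageD(3)[OF Suc.prems, of "i + k * r" "j + k * N"] by (simp add: ac_simps)
qed simp

lemma stage_mod: "X \<in> stage r N \<Longrightarrow> i div r = j div N \<Longrightarrow> X i j = X (i mod r) (j mod N)"
  using stage_shift[of X r N "i mod r" "i div r" "j mod N"] by (metis mod_div_mult_eq)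

lemma stage_mult:
  assumes "X \<in> stage r N"
  shows "X \<in> stage (r * t) (N * t)"
  unfolding stage_def
proof (intro CollectI conjI allI impI)
  fix i j
  show "X i j \<in> \<int>" by (rule stageD[OF assms])
  show "X i j \<noteq> 0 \<Longrightarrow> i div (r * t) = j div (N * t)"
    using stageD(2)[OF assms] by (simp add: div_mult2_eq)
  show "X (i + r * t) (j + N * t) = X i j"
    using stage_shift[OF assms, of i t j] by (simp add: mult.commute)
qed

lemma subgp_stage: "subgp (stage r N)"
  unfolding subgp_def
proof (intro conjI ballI)
  show "0 \<in> stage r N" by (simp add: stage_def)
  fix X Y assume X: "X \<in> stage r N" and Y: "Y \<in> stage r N"
  have "i div r = j div N" if "X i j - Y i j \<noteq> 0" for i j
    using that stageD(2)[OF X, of i j] stageD(2)[OF Y, of i j] by (cases "X i j = 0") auto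
  then show "X - Y \<in> stage r N"
    using stageD(1,3)[OF X] stageD(1,3)[OF Y] by (simp add: stage_def)
qed

lemma positive_rat_fraction:
  assumes "q > (0::rat)"
  obtains r N where "r > 0" "N > 0" "of_nat r = q * of_nat N"
proof -
  obtain a b where ab: "quotient_of q = (a, b)" by (cases "quotient_of q")
  then have b: "b > 0" by (rule quotient_of_denom_pos)
  have q: "q = of_int a / of_int b" using ab by (rule quotient_of_div)
  then have a: "a > 0" using assms b by (simp add: zero_less_divide_iff)
  have "of_nat (nat a) = q * of_nat (nat b)" using a b q by simp
  then show ?thesis using a b by (intro that[of "nat a" "nat b"]) auto
qed

lemma pmatI: "r > 0 \<Longrightarrow> N > 0 \<Longrightarrow> of_nat r = q * of_nat N \<Longrightarrow> X \<in> stage r N \<Longrightarrow> X \<in> pmat q"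
  by (auto simp: pmat_def)

lemma pmatE:
  assumes "X \<in> pmat q"
  obtains r N where "r > 0" "N > 0" "of_nat r = q * of_nat N" "X \<in> stage r N"
  using assms by (auto simp: pmat_def)

text \<open>The period \<open>N\<close> determines the row count \<open>q N\<close>, and passing to
  a multiple of \<open>N\<close> merges neighbouring blocks.\<close>

lemma stage_mono:
  assumes "N > 0" "N dvd N'" "of_nat r = q * of_nat N" "of_nat r' = (q::rat) * of_nat N'"
  shows "stage r N \<subseteq> stage r' N'"
proof -
  obtain t where t: "N' = N * t" using assms(2) by blast
  have "(of_nat r' :: rat) = of_nat (r * t)" using assms t by simp
  then have "r' = r * t" by (simp only: of_nat_eq_iff)
  then show ?thesis using stage_mult t by blast
qed

text \<open>\<open>pmat q\<close> is the directed union of its stages: the product of two periods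
  serves both.\<close>

lemma pmat_common_stage:
  assumes "finite S" "S \<subseteq> pmat q" "q > 0"
  shows "\<exists>r N. r > 0 \<and> N > 0 \<and> of_nat r = q * of_nat N \<and> S \<subseteq> stage r N"
  using assms(1,2)
proof (induction S)
  case empty
  then show ?case using positive_rat_fraction[OF assms(3)] by (metis empty_subsetI)
next
  case (insert X S)
  then obtain r N where 1: "r > 0" "N > 0" "of_nat r = q * of_nat N" "S \<subseteq> stage r N" by auto
  obtain r' N' where 2: "r' > 0" "N' > 0" "of_nat r' = q * of_nat N'" "X \<in> stage r' N'"
    using insert.prems by (auto elim: pmatE)
  have eq: "of_nat (r * N') = q * of_nat (N * N')" using 1(3) by simp
  have "insert X S \<subseteq> stage (r * N') (N * N')"
    using stage_mono[OF 1(2) _ 1(3) eq] stage_mono[OF 2(2) _ 2(3) eq] 1(4) 2(4) by auto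
  then show ?case using 1 2 eq by (intro exI[of _ "r * N'"] exI[of _ "N * N'"]) auto
qed

lemma subgp_pmat:
  assumes "q > 0"
  shows "subgp (pmat q)"
  unfolding subgp_def
proof (intro conjI ballI)
  obtain r N where "r > 0" "N > 0" "of_nat r = q * of_nat N" by (rule positive_rat_fraction[OF assms])
  then show "0 \<in> pmat q" using subgp_0[OF subgp_stage] by (rule pmatI)
  fix X Y assume "X \<in> pmat q" "Y \<in> pmat q"
  then obtain r N where rN: "r > 0" "N > 0" "of_nat r = q * of_nat N" "{X, Y} \<subseteq> stage r N"
    using pmat_common_stage[of "{X, Y}" q] assms by auto
  then have "X - Y \<in> stage r N" by (intro subgp_diff subgp_stage) auto
  then show "X - Y \<in> pmat q" by (rule pmatI[OF rN(1-3)])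
qed

lemma linear_rmul: "linear (rmul m)"
  by (rule linearI) (auto simp: rmul_def fun_eq_iff split: prod.splits)

text \<open>Here \<open>j - b\<close> is the first column of the block of width \<open>K\<close>
  containing \<open>j\<close>. Columns are moved only inside such a block, hence inside a block of
  width \<open>N\<close>.\<close>

lemma rmul_stage:
  assumes X: "X \<in> stage r N" and "K dvd N"
  shows "rmul (K, a, b) X \<in> stage r N"
  unfolding stage_def
proof (intro CollectI conjI allI impI)
  fix i j
  show "rmul (K, a, b) X i j \<in> \<int>" using stageD(1)[OF X] by (simp add: rmul_def)
  obtain s where s: "N = K * s" using assms(2) by blast
  show "i div r = j div N" if "rmul (K, a, b) X i j \<noteq> 0"
  proof -
    have *: "a < K" "j mod K = b" "X i (j - b + a) \<noteq> 0" using that by (auto simp: rmul_def split: if_splits)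
    have "j - b = j div K * K" using *(2) by (metis minus_mod_eq_div_mult)
    then have "(j - b + a) div K = j div K" using *(1) by simp
    then have "(j - b + a) div N = j div N" by (simp add: s div_mult2_eq)
    then show ?thesis using stageD(2)[OF X *(3)] by simp
  qed
  have "X (i + r) (j + N - b + a) = X i (j - b + a)" if "j mod K = b"
  proof -
    have "b \<le> j" using that by auto
    then have "j + N - b + a = j - b + a + N" by simp
    then show ?thesis using stageD(3)[OF X, of i "j - b + a"] by (simp only:)
  qed
  then show "rmul (K, a, b) X (i + r) (j + N) = rmul (K, a, b) X i j"
    by (simp add: rmul_def s)
qed

lemma rmul_pmat:
  assumes X: "X \<in> pmat q" and q: "q > 0"
  shows "rmul m X \<in> pmat q"
proof -
  obtain K a b where m: "m = (K, a, b)" by (cases m)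
  show ?thesis
  proof (cases "K = 0")
    \<comment> \<open>Period 0 codes the zero operator, as no \<open>a\<close> is below 0.\<close>
    case True
    then have "rmul m X = 0" by (auto simp: m rmul_def fun_eq_iff)
    then show ?thesis using subgp_0[OF subgp_pmat[OF q]] by simp
  next
    case False
    obtain r N where rN: "r > 0" "N > 0" "of_nat r = q * of_nat N" "X \<in> stage r N"
      using X by (rule pmatE)
    have "rmul m X \<in> stage (r * K) (N * K)" unfolding m by (intro rmul_stage stage_mult rN) simp
    then show ?thesis using rN False by (intro pmatI[of "r * K" "N * K"]) auto
  qed
qed

lemma reduced_pmat:
  assumes "prime p"
  shows "reduced p (pmat q)"
  by (rule reduced_coordinates[where l = "\<lambda>(i, j) X. X i j" and N = "\<lambda>_. \<int>"])
     (auto simp: reduced_Ints[OF assms] fun_eq_iff elim!: pmatE dest: stageD(1) intro!: linearI)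

text \<open>The matrix of the stage whose diagonal blocks are the indicator of \<open>S\<close>.
  Singletons give a basis of the stage, general sets all its matrices with entries 0 and 1.\<close>

definition unitm :: "nat \<Rightarrow> nat \<Rightarrow> (nat \<times> nat) set \<Rightarrow> nat \<Rightarrow> nat \<Rightarrow> real" where
  "unitm r N S i j = (if i div r = j div N \<and> (i mod r, j mod N) \<in> S then 1 else 0)"

lemma unitm_stage: "r > 0 \<Longrightarrow> N > 0 \<Longrightarrow> unitm r N S \<in> stage r N"
  by (auto simp: stage_def unitm_def)

lemma stage_decompose:
  assumes X: "X \<in> stage r N" and r: "r > 0" and N: "N > 0"
  shows "X = (\<Sum>(c, d)\<in>{..<r} \<times> {..<N}. X c d *\<^sub>R unitm r N {(c, d)})"
proof (intro ext)
  fix i j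
  have fun_sum: "(\<Sum>x\<in>A. F x) i j = (\<Sum>x\<in>A. F x i j)" for A and F :: "nat \<times> nat \<Rightarrow> nat \<Rightarrow> nat \<Rightarrow> real"
    by (induction A rule: infinite_finite_induct) auto
  have "(\<Sum>(c, d)\<in>{..<r} \<times> {..<N}. X c d *\<^sub>R unitm r N {(c, d)}) i j
      = (\<Sum>x\<in>{..<r} \<times> {..<N}. if x = (i mod r, j mod N)
          then (if i div r = j div N then X (i mod r) (j mod N) else 0) else 0)"
    unfolding fun_sum by (intro sum.cong) (auto simp: unitm_def split: if_splits)
  also have "\<dots> = (if i div r = j div N then X (i mod r) (j mod N) else 0)"
    using r N by (subst sum.delta) auto
  also have "\<dots> = X i j" using stage_mod[OF X, of i j] stageD(2)[OF X, of i j] by auto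
  finally show "X i j = (\<Sum>(c, d)\<in>{..<r} \<times> {..<N}. X c d *\<^sub>R unitm r N {(c, d)}) i j" ..
qed

text \<open>The columns through \<open>0\<close> of the first block generate all of \<^const>\<open>pmat\<close> under right
  multiplication, at every finer stage.\<close>

lemma unitm_refine:
  assumes pos: "r > 0" "N > 0" and c: "c < r * s" and d: "d < N * s"
  shows "unitm (r * s) (N * s) {(c, d)} = rmul (N * s, c div r * N, d) (unitm r N {(c mod r, 0)})"
proof (intro ext)
  fix i j
  have cs: "c div r < s" using c pos by (simp add: less_mult_imp_div_less mult.commute)
  then have a: "c div r * N < N * s" using pos by simp
  show "unitm (r * s) (N * s) {(c, d)} i j = rmul (N * s, c div r * N, d) (unitm r N {(c mod r, 0)}) i j"
  proof (cases "j mod (N * s) = d")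
    case False
    then show ?thesis by (simp add: unitm_def rmul_def)
  next
    case True
    let ?J = "j div (N * s)"
    have "j - d = ?J * (N * s)" using True by (metis minus_mod_eq_div_mult)
    then have jd: "j - d + c div r * N = (?J * s + c div r) * N" by (simp add: algebra_simps)
    \<comment> \<open>Row \<open>c\<close> of a large block is row \<open>c mod r\<close> of its
      small block number \<open>c div r\<close>, whose first column within the large block is
      \<open>c div r * N\<close>.\<close>
    have "(i div (r * s) = ?J \<and> i mod (r * s) = c) \<longleftrightarrow> i = ?J * (r * s) + c"
    proof
      assume "i = ?J * (r * s) + c"
      moreover have "0 < r * s" by (rule le_less_trans[OF le0 c])
      ultimately show "i div (r * s) = ?J \<and> i mod (r * s) = c" using c by simp
    qed (metis div_mult_mod_eq)
    also have "\<dots> \<longleftrightarrow> i = (?J * s + c div r) * r + c mod r" by (simp add: algebra_simps)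
    also have "\<dots> \<longleftrightarrow> (i div r = ?J * s + c div r \<and> i mod r = c mod r)"
    proof
      assume "i = (?J * s + c div r) * r + c mod r"
      then show "i div r = ?J * s + c div r \<and> i mod r = c mod r" using pos by simp
    qed (metis div_mult_mod_eq)
    finally show ?thesis using True a d pos jd by (auto simp: unitm_def rmul_def)
  qed
qed

text \<open>The map is determined by the images of finitely many unit matrices of one stage, and
  these images lie in a common stage with period \<open>N1\<close>. For \<open>N\<close> divisible
  by \<open>N0 * N1\<close>, every unit matrix of stage \<open>N\<close> arises from them by an
  operator of period \<open>N\<close>, which preserves the target stage.\<close>

lemma commuting_hom_stage:
  assumes f: "f \<in> hom (grp (pmat q)) (grp (pmat q'))" and q: "q > 0" and q': "q' > 0"
    and comm: "\<And>k X. X \<in> pmat q \<Longrightarrow> f (rop k X) = rop k (f X)"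
  shows "\<exists>L>0. \<forall>N r r'. N > 0 \<longrightarrow> L dvd N \<longrightarrow> of_nat r = q * of_nat N \<longrightarrow> of_nat r' = q' * of_nat N \<longrightarrow>
    f ` stage r N \<subseteq> stage r' N"
proof -
  have rmul_f: "f (rmul m X) = rmul m (f X)" if "X \<in> pmat q" for m X
    using comm[OF that, of "to_nat m"] by (simp add: rop_def)
  obtain r0 N0 where 0: "r0 > 0" "N0 > 0" "of_nat r0 = q * of_nat N0"
    by (rule positive_rat_fraction[OF q])
  have u: "unitm r0 N0 S \<in> pmat q" for S by (rule pmatI[OF 0 unitm_stage[OF 0(1,2)]])
  let ?S = "(\<lambda>c. f (unitm r0 N0 {(c, 0)})) ` {..<r0}"
  obtain r1 N1 where 1: "r1 > 0" "N1 > 0" "of_nat r1 = q' * of_nat N1" "?S \<subseteq> stage r1 N1"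
    using pmat_common_stage[of ?S q'] q' hom_in[OF f u] by auto
  have "f ` stage r N \<subseteq> stage r' N"
    if N: "N > 0" "N0 * N1 dvd N" and r: "of_nat r = q * of_nat N" and r': "of_nat r' = q' * of_nat N" for N r r'
  proof
    fix Y assume "Y \<in> f ` stage r N"
    then obtain X where X: "X \<in> stage r N" and Y: "Y = f X" by blast
    obtain s where s: "N = N0 * s" using N(2) by (metis dvdE mult.assoc)
    have "(of_nat r :: rat) = of_nat (r0 * s)" using r 0 s by simp
    then have rs: "r = r0 * s" by (simp only: of_nat_eq_iff)
    have pos: "r > 0" using N(1) s 0 rs by auto
    have st: "f (unitm r0 N0 {(c, 0)}) \<in> stage r' N" if "c < r0" for c
    proof -
      have "N1 dvd N" using N(2) by (rule dvd_mult_right)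
      then have "stage r1 N1 \<subseteq> stage r' N" by (rule stage_mono[OF 1(2) _ 1(3) r'])
      then show ?thesis using 1(4) that by blast
    qed
    have fu: "f (unitm r N {(c, d)}) \<in> stage r' N" if "c < r" "d < N" for c d
    proof -
      have "unitm r N {(c, d)} = rmul (N, c div r0 * N0, d) (unitm r0 N0 {(c mod r0, 0)})"
        unfolding rs s by (rule unitm_refine) (use that 0 rs s in auto)
      then have "f (unitm r N {(c, d)}) = rmul (N, c div r0 * N0, d) (f (unitm r0 N0 {(c mod r0, 0)}))"
        by (simp add: rmul_f[OF u])
      then show ?thesis using rmul_stage[OF st] 0(1) by simp
    qed
    have uP: "unitm r N S \<in> pmat q" for S by (rule pmatI[OF pos N(1) r unitm_stage[OF pos N(1)]])
    have XI: "X c d \<in> \<int>" for c d by (rule stageD[OF X])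
    have "f X = f (\<Sum>(c, d)\<in>{..<r} \<times> {..<N}. X c d *\<^sub>R unitm r N {(c, d)})"
      using stage_decompose[OF X pos N(1)] by (rule arg_cong)
    also have "\<dots> = (\<Sum>(c, d)\<in>{..<r} \<times> {..<N}. f (X c d *\<^sub>R unitm r N {(c, d)}))"
      unfolding case_prod_unfold
      by (rule hom_sum[OF f subgp_pmat[OF q]]) (intro subgp_scaleR_int subgp_pmat q uP XI)
    also have "\<dots> \<in> stage r' N"
      unfolding case_prod_unfold hom_scaleR_int[OF f subgp_pmat[OF q] uP XI]
      by (rule subgp_sum[OF subgp_stage]) (intro subgp_scaleR_int subgp_stage fu XI, auto)
    finally show "Y \<in> stage r' N" by (simp add: Y)
  qed
  then show ?thesis using 0 1 by (intro exI[of _ "N0 * N1"]) auto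
qed

text \<open>Both stages are free of rank \<open>r N\<close> and \<open>r' N\<close>; the ranks are compared by counting residues modulo 2.\<close>

lemma stage_rank_le:
  assumes r: "r > 0" and r': "r' > 0" and N: "N > 0"
    and f: "f \<in> hom (grp (stage r N)) (grp (stage r' N))"
    and g: "g \<in> hom (grp (stage r' N)) (grp (stage r N))"
    and gf: "\<And>X. X \<in> stage r N \<Longrightarrow> g (f X) = X"
  shows "r \<le> r'"
proof -
  \<comment> \<open>The parity pattern of the image of a matrix with entries 0 and 1. Its
    injectivity in \<open>S\<close> compares the ranks.\<close>
  let ?O = "\<lambda>S. {x \<in> {..<r'} \<times> {..<N}. odd \<lfloor>f (unitm r N S) (fst x) (snd x)\<rfloor>}"
  have u: "unitm r N S \<in> stage r N" for S by (rule unitm_stage[OF r N])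
  have "inj_on ?O (Pow ({..<r} \<times> {..<N}))"
  proof (rule inj_onI)
    fix S T assume S: "S \<in> Pow ({..<r} \<times> {..<N})" and T: "T \<in> Pow ({..<r} \<times> {..<N})" and eq: "?O S = ?O T"
    define Z where "Z = f (unitm r N S) - f (unitm r N T)"
    have Z: "Z \<in> stage r' N" unfolding Z_def by (intro subgp_diff subgp_stage hom_in[OF f] u)
    have half: "Z c d / 2 \<in> \<int>" if "c < r'" "d < N" for c d
    proof -
      obtain a b where ab: "f (unitm r N S) c d = of_int a" "f (unitm r N T) c d = of_int b"
        using stageD(1)[OF hom_in[OF f u]] by (meson Ints_cases)
      have "(c, d) \<in> ?O S \<longleftrightarrow> (c, d) \<in> ?O T" using eq by simp
      then have "even (a - b)" using that ab by auto
      then obtain k where "a - b = 2 * k" by blast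
      then have "Z c d / 2 = of_int k" using ab by (simp add: Z_def flip: of_int_diff)
      then show ?thesis by simp
    qed
    \<comment> \<open>Equal parities allow \<open>Z\<close> to be halved within the stage. Applying
      \<open>g\<close> makes the difference of the two 0-1 matrices even, hence zero on the
      block.\<close>
    define W where "W = Z /\<^sub>R 2"
    have W: "W \<in> stage r' N"
      unfolding stage_def
    proof (intro CollectI conjI allI impI)
      fix i j
      show "W (i + r') (j + N) = W i j" using stageD(3)[OF Z] by (simp add: W_def)
      show "W i j \<noteq> 0 \<Longrightarrow> i div r' = j div N" using stageD(2)[OF Z] by (simp add: W_def)
      show "W i j \<in> \<int>"
      proof (cases "i div r' = j div N")
        case True
        then show ?thesis using stage_mod[OF Z True] half[of "i mod r'" "j mod N"] r' N by (simp add: W_def)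
      next
        case False
        then show ?thesis using stageD(2)[OF Z, of i j] by (cases "Z i j = 0") (auto simp: W_def)
      qed
    qed
    have "unitm r N S - unitm r N T = g Z"
      using gf[OF u] hom_diff[OF g subgp_stage hom_in[OF f u] hom_in[OF f u]] by (simp add: Z_def)
    also have "Z = real 2 *\<^sub>R W" by (simp add: W_def)
    also have "g \<dots> = real 2 *\<^sub>R g W" by (rule hom_scaleR_nat[OF g subgp_stage W])
    finally have eq2: "unitm r N S - unitm r N T = real 2 *\<^sub>R g W" .
    have diff: "unitm r N S c d - unitm r N T c d = 2 * g W c d" for c d
      using fun_cong[OF fun_cong[OF eq2, of c], of d] by simp
    have "(c, d) \<in> S \<longleftrightarrow> (c, d) \<in> T" if "c < r" "d < N" for c d
    proof (rule ccontr)
      assume "\<not> ?thesis"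
      then have "\<bar>unitm r N S c d - unitm r N T c d\<bar> = 1" using that by (auto simp: unitm_def)
      moreover obtain k where "g W c d = of_int k" using stageD(1)[OF hom_in[OF g W]] by (meson Ints_cases)
      ultimately have "\<bar>real_of_int (2 * k)\<bar> = 1" using diff[of c d] by simp
      then have "\<bar>2 * k\<bar> = 1" by linarith
      then show False by presburger
    qed
    then show "S = T" using S T by (auto simp: subset_iff)
  qed
  moreover have "?O ` Pow ({..<r} \<times> {..<N}) \<subseteq> Pow ({..<r'} \<times> {..<N})" by blast
  ultimately have "card (Pow ({..<r} \<times> {..<N})) \<le> card (Pow ({..<r'} \<times> {..<N}))"
    by (rule card_inj_on_le) simp
  then have "r * N \<le> r' * N" by (simp add: card_Pow card_cartesian_product)
  then show ?thesis using N by simp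
qed

text \<open>At a suitable common period \<open>N\<close> the isomorphism and its inverse restrict to
  the stages with \<open>q N\<close> and \<open>q' N\<close> rows per block; comparing ranks gives
  equality.\<close>

theorem pmat_rank_unique:
  assumes q: "q > 0" and q': "q' > 0"
    and f: "f \<in> iso (grp (pmat q)) (grp (pmat q'))"
    and comm: "\<And>k X. X \<in> pmat q \<Longrightarrow> f (rop k X) = rop k (f X)"
  shows "q = q'"
proof -
  have fh: "f \<in> hom (grp (pmat q)) (grp (pmat q'))" using f by (simp add: iso_def)
  obtain g where g: "g \<in> hom (grp (pmat q')) (grp (pmat q))"
    and gf: "\<And>x. x \<in> pmat q \<Longrightarrow> g (f x) = x" and fg: "\<And>y. y \<in> pmat q' \<Longrightarrow> f (g y) = y"
    using iso_grp_inverse[OF f subgp_pmat[OF q]] by metis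
  have gcomm: "g (rop k Y) = rop k (g Y)" if "Y \<in> pmat q'" for k Y
  proof -
    have gY: "g Y \<in> pmat q" by (rule hom_in[OF g that])
    have "g (rop k Y) = g (f (rop k (g Y)))" using comm[OF gY] fg[OF that] by simp
    also have "\<dots> = rop k (g Y)" unfolding rop_def by (rule gf[OF rmul_pmat[OF gY q]])
    finally show ?thesis .
  qed
  obtain L where L: "L > 0" "\<And>N r r'. N > 0 \<Longrightarrow> L dvd N \<Longrightarrow> of_nat r = q * of_nat N \<Longrightarrow>
      of_nat r' = q' * of_nat N \<Longrightarrow> f ` stage r N \<subseteq> stage r' N"
    using commuting_hom_stage[OF fh q q' comm] by blast
  obtain L' where L': "L' > 0" "\<And>N r r'. N > 0 \<Longrightarrow> L' dvd N \<Longrightarrow> of_nat r = q' * of_nat N \<Longrightarrow>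
      of_nat r' = q * of_nat N \<Longrightarrow> g ` stage r N \<subseteq> stage r' N"
    using commuting_hom_stage[OF g q' q gcomm] by blast
  obtain a b where ab: "a > 0" "b > 0" "of_nat a = q * of_nat b" by (rule positive_rat_fraction[OF q])
  obtain a' b' where ab': "a' > 0" "b' > 0" "of_nat a' = q' * of_nat b'" by (rule positive_rat_fraction[OF q'])
  \<comment> \<open>Divisible by \<open>L\<close> and \<open>L'\<close>, so that both maps respect
    the stages, and by \<open>b\<close> and \<open>b'\<close>, so that \<open>q N\<close> and
    \<open>q' N\<close> are the integers \<open>r\<close> and \<open>r'\<close>.\<close>
  define N where "N = L * L' * b * b'"
  define r where "r = L * L' * a * b'"
  define r' where "r' = L * L' * b * a'"
  have N: "N > 0" "L dvd N" "L' dvd N" using L L' ab ab' by (auto simp: N_def)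
  have r: "r > 0" "of_nat r = q * of_nat N" and r': "r' > 0" "of_nat r' = q' * of_nat N"
    using L L' ab ab' by (auto simp: N_def r_def r'_def)
  have sub: "stage r N \<subseteq> pmat q" "stage r' N \<subseteq> pmat q'" using N r r' by (auto intro: pmatI)
  have f': "f \<in> hom (grp (stage r N)) (grp (stage r' N))"
    by (rule hom_grp_subset[OF fh sub(1) L(2)[OF N(1,2) r(2) r'(2)]])
  have g': "g \<in> hom (grp (stage r' N)) (grp (stage r N))"
    by (rule hom_grp_subset[OF g sub(2) L'(2)[OF N(1,3) r'(2) r(2)]])
  have "r \<le> r'" by (rule stage_rank_le[OF r(1) r'(1) N(1) f' g']) (use gf sub in auto)
  moreover have "r' \<le> r" by (rule stage_rank_le[OF r'(1) r(1) N(1) g' f']) (use fg sub in auto)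
  ultimately have "r = r'" by simp
  then have "q * of_nat N = q' * of_nat N" using r(2) r'(2) by metis
  then show ?thesis using N(1) by simp
qed

section \<open>Finite powers\<close>

text \<open>The value 0 from \<open>n\<close> on makes the finite power a subgroup of a space of
  functions on the natural numbers.\<close>

definition copies :: "nat \<Rightarrow> 'a set \<Rightarrow> (nat \<Rightarrow> 'a::zero) set" where
  "copies n S = {F. (\<forall>k<n. F k \<in> S) \<and> (\<forall>k\<ge>n. F k = 0)}"

lemma copiesD: "F \<in> copies n S \<Longrightarrow> k < n \<Longrightarrow> F k \<in> S"
  and copies_outside: "F \<in> copies n S \<Longrightarrow> k \<ge> n \<Longrightarrow> F k = 0"
  by (simp_all add: copies_def)

lemma copiesI: "(\<And>k. k < n \<Longrightarrow> F k \<in> S) \<Longrightarrow> (\<And>k. k \<ge> n \<Longrightarrow> F k = 0) \<Longrightarrow> F \<in> copies n S"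
  by (simp add: copies_def)

lemma subgp_copies: "subgp S \<Longrightarrow> subgp (copies n S)"
  by (simp add: subgp_def copies_def)

text \<open>Elements of \<open>direct_power\<close> are \<open>undefined\<close> from
  \<open>n\<close> on; the isomorphism replaces this default by 0.\<close>

lemma direct_power_iso_copies:
  assumes G: "comm_group G" and S: "subgp S" and f: "f \<in> iso G (grp S)"
  shows "direct_power G n \<cong> grp (copies n S)"
proof -
  let ?g = "inv_into (carrier G) f"
  let ?F = "\<lambda>x k. if k < n then f (x k) else 0" and ?G = "\<lambda>X. \<lambda>k\<in>{..<n}. ?g (X k)"
  have bij: "bij_betw f (carrier G) S" and hom: "f \<in> hom G (grp S)"
    using f by (auto simp: iso_def)
  have fS: "f x \<in> S" if "x \<in> carrier G" for x using bij_betwE[OF bij] that by blast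
  have gG: "?g y \<in> carrier G" if "y \<in> S" for y
    using bij_betwE[OF bij_betw_inv_into[OF bij]] that by blast
  note car = carrier_direct_power[OF G, of n]
  have mult: "x \<otimes>\<^bsub>direct_power G n\<^esub> y = (\<lambda>i\<in>{..<n}. x i \<otimes>\<^bsub>G\<^esub> y i)" for x y
    by (simp add: direct_power_def)
  have "?F \<in> iso (direct_power G n) (grp (copies n S))"
    unfolding iso_def
  proof (intro CollectI conjI)
    show "?F \<in> hom (direct_power G n) (grp (copies n S))"
    proof (rule homI)
      show "?F x \<in> carrier (grp (copies n S))" if "x \<in> carrier (direct_power G n)" for x
        using that unfolding car by (auto simp: copies_def intro: fS)
      show "?F (x \<otimes>\<^bsub>direct_power G n\<^esub> y) = ?F x \<otimes>\<^bsub>grp (copies n S)\<^esub> ?F y"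
        if "x \<in> carrier (direct_power G n)" "y \<in> carrier (direct_power G n)" for x y
      proof
        fix k
        show "?F (x \<otimes>\<^bsub>direct_power G n\<^esub> y) k = (?F x \<otimes>\<^bsub>grp (copies n S)\<^esub> ?F y) k"
        proof (cases "k < n")
          case True
          then have "x k \<in> carrier G" "y k \<in> carrier G" using that unfolding car by auto
          then show ?thesis using True hom_mult[OF hom] by (simp add: mult)
        qed simp
      qed
    qed
    show "bij_betw ?F (carrier (direct_power G n)) (carrier (grp (copies n S)))"
      unfolding car grp_simps
    proof (rule bij_betwI[where g = ?G])
      show "?F \<in> ({..<n} \<rightarrow>\<^sub>E carrier G) \<rightarrow> copies n S"
      proof (intro Pi_I copiesI)
        show "?F x k \<in> S" if "x \<in> {..<n} \<rightarrow>\<^sub>E carrier G" "k < n" for x k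
          using PiE_mem[OF that(1), of k] that(2) by (simp add: fS)
      qed simp
      show "?G \<in> copies n S \<rightarrow> ({..<n} \<rightarrow>\<^sub>E carrier G)"
      proof (intro Pi_I restrict_PiE_iff[THEN iffD2] ballI)
        show "?g (F k) \<in> carrier G" if "F \<in> copies n S" "k \<in> {..<n}" for F k
          by (rule gG[OF copiesD[OF that(1)]]) (use that(2) in simp)
      qed
      show "?G (?F x) = x" if x: "x \<in> {..<n} \<rightarrow>\<^sub>E carrier G" for x
      proof (rule extensionalityI)
        show "x \<in> extensional {..<n}" using that by (simp add: PiE_def)
        show "?G (?F x) k = x k" if "k \<in> {..<n}" for k
          using that bij_betw_inv_into_left[OF bij PiE_mem[OF x that]] by simp
      qed simp
      show "?F (?G F) = F" if F: "F \<in> copies n S" for F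
      proof
        show "?F (?G F) k = F k" for k
          using copies_outside[OF F, of k] bij_betw_inv_into_right[OF bij copiesD[OF F, of k]] by auto
      qed
    qed
  qed
  then show ?thesis by (rule is_isoI)
qed

lemma copies_Times_iso: "grp (copies n (S \<times> T)) \<cong> grp (copies n S \<times> copies n T)"
proof (rule is_isoI, rule grp_isoI)
  show "(\<lambda>F. (\<lambda>k. fst (F k), \<lambda>k. snd (F k))) \<in> hom (grp (copies n (S \<times> T))) (grp (copies n S \<times> copies n T))"
    by (auto simp: hom_grp_iff copies_def mem_Times_iff fun_eq_iff)
  show "(\<lambda>(F, G) k. (F k, G k)) \<in> copies n S \<times> copies n T \<rightarrow> copies n (S \<times> T)"
    by (auto simp: copies_def zero_prod_def)
qed auto

lemma Times_iso:
  assumes "grp S \<cong> grp S'" "grp T \<cong> grp T'"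
  shows "grp (S \<times> T) \<cong> grp (S' \<times> T')"
proof -
  obtain f g where "f \<in> iso (grp S) (grp S')" "g \<in> iso (grp T) (grp T')"
    using assms by (auto simp: is_iso_def)
  then have "map_prod f g \<in> iso (grp (S \<times> T)) (grp (S' \<times> T'))"
    by (auto simp: iso_def hom_grp_iff intro: bij_betw_map_prod)
  then show ?thesis by (rule is_isoI)
qed

lemma loc_copies:
  assumes M: "subgp M"
  shows "loc p (copies n M) = copies n (loc p M)"
proof (intro equalityI subsetI)
  fix F assume "F \<in> loc p (copies n M)"
  then obtain d where d: "d > 0" "coprime d p" "real d *\<^sub>R F \<in> copies n M" by (rule locE)
  show "F \<in> copies n (loc p M)"
  proof (rule copiesI)
    show "F k \<in> loc p M" if "k < n" for k using copiesD[OF d(3) that] d by (intro locI[of d]) auto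
    show "F k = 0" if "n \<le> k" for k using copies_outside[OF d(3) that] d by simp
  qed
next
  fix F assume F: "F \<in> copies n (loc p M)"
  \<comment> \<open>A common denominator of the first \<open>m\<close> coordinates, built by
    induction; finiteness of \<open>n\<close> is essential here.\<close>
  have "\<exists>d>0. coprime d p \<and> (\<forall>k<m. real d *\<^sub>R F k \<in> M)" if "m \<le> n" for m
    using that
  proof (induction m)
    case 0
    show ?case by (intro exI[of _ 1]) simp
  next
    case (Suc m)
    then obtain c where c: "c > 0" "coprime c p" "\<And>k. k < m \<Longrightarrow> real c *\<^sub>R F k \<in> M" by auto
    obtain d where d: "d > 0" "coprime d p" "real d *\<^sub>R F m \<in> M"
      using copiesD[OF F, of m] Suc.prems by (auto elim: locE)
    have "real (c * d) *\<^sub>R F k \<in> M" if "k < Suc m" for k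
    proof (cases "k = m")
      case True
      then show ?thesis using subgp_scaleR_nat[OF M d(3), of c] by simp
    next
      case False
      then show ?thesis using subgp_scaleR_nat[OF M c(3), of k d] that by (simp add: mult.commute)
    qed
    then show ?case using c d by (intro exI[of _ "c * d"]) auto
  qed
  from this[OF order_refl] obtain d where d: "d > 0" "coprime d p" "\<And>k. k < n \<Longrightarrow> real d *\<^sub>R F k \<in> M"
    by blast
  show "F \<in> loc p (copies n M)"
    by (rule locI[OF d(1,2)], rule copiesI) (simp_all add: d(3) copies_outside[OF F])
qed

lemma reduced_copies:
  assumes "subgp M" "reduced p M"
  shows "reduced p (copies n M)"
proof (rule reduced_coordinates[where l = "\<lambda>k F. F k" and N = "\<lambda>_. M"])
  show "F k \<in> M" if "F \<in> copies n M" for F k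
    using that assms(1) by (cases "k < n") (auto simp: copies_def)
qed (auto intro: linearI assms(2))

definition copies_op :: "(nat \<Rightarrow> 'a \<Rightarrow> 'a) \<Rightarrow> nat \<Rightarrow> (nat \<Rightarrow> 'a) \<Rightarrow> nat \<Rightarrow> 'a" where
  "copies_op \<psi> j F = (\<lambda>k. \<psi> j (F k))"

context realizable
begin

lemma realizable_copies: "realizable e (copies_op \<psi>) (copies n M)"
proof (rule realizable.intro)
  show "inj e" by (rule inj_e)
  show "prime (e j)" for j by (rule prime_e)
  show "subgp (copies n M)" by (rule subgp_copies[OF subgp_M])
  show "linear (copies_op \<psi> k)" for k
    by (rule linearI) (auto simp: copies_op_def linear_add[OF linear_op] linear_scale[OF linear_op])
  show "copies_op \<psi> k F \<in> copies n M" if "F \<in> copies n M" for k F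
    using that op_closed by (auto simp: copies_def copies_op_def linear_0[OF linear_op])
  show "reduced (e j) (copies n M)" for j by (rule reduced_copies[OF subgp_M reduced_M])
qed

text \<open>The maps \<open>dec\<close> act coordinatewise and localisation commutes with finite
  powers, so the two constructions differ only by regrouping pairs and sequences.\<close>

lemma realize_copies: "grp (realize e (copies_op \<psi>) (copies n M)) \<cong> grp (copies n (realize e \<psi> M))"
proof -
  have dec: "dec (copies_op \<psi>) j v = (\<lambda>k. dec \<psi> j (fst v k, snd v k))" for j v
    by (auto simp: dec_def copies_op_def)
  let ?f = "\<lambda>v k. (fst v k, snd v k)" and ?g = "\<lambda>F. (\<lambda>k. fst (F k), \<lambda>k. snd (F k))"
  have mem: "v \<in> realize e (copies_op \<psi>) (copies n M) \<longleftrightarrow> ?f v \<in> copies n (realize e \<psi> M)" for v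
  proof
    assume v: "v \<in> realize e (copies_op \<psi>) (copies n M)"
    then have 1: "(\<lambda>k. dec \<psi> j (fst v k, snd v k)) \<in> copies n (loc (e j) M)" for j
      by (simp add: realize_def loc_copies[OF subgp_M] dec)
    have 2: "fst v \<in> copies n (loc p M)" "snd v \<in> copies n (loc p M)" if "prime p" "p \<notin> range e" for p
      using v that by (simp_all add: realize_def loc_copies[OF subgp_M])
    show "?f v \<in> copies n (realize e \<psi> M)"
    proof (rule copiesI)
      show "(fst v k, snd v k) \<in> realize e \<psi> M" if "k < n" for k
        using copiesD[OF 1 that] copiesD[OF 2(1) that] copiesD[OF 2(2) that] by (simp add: realize_def)
      show "(fst v k, snd v k) = 0" if "n \<le> k" for k
        using copies_outside[OF 1[of 0] that] copies_outside[OF 1[of 1] that] by (simp add: dec_def zero_prod_def)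
    qed
  next
    assume v: "?f v \<in> copies n (realize e \<psi> M)"
    have in_M: "(fst v k, snd v k) \<in> realize e \<psi> M" if "k < n" for k using copiesD[OF v that] .
    have z: "fst v k = 0" "snd v k = 0" if "n \<le> k" for k
      using copies_outside[OF v that] by (simp_all add: zero_prod_def)
    have "dec (copies_op \<psi>) j v \<in> copies n (loc (e j) M)" for j
      unfolding dec
    proof (rule copiesI)
      show "dec \<psi> j (fst v k, snd v k) \<in> loc (e j) M" if "k < n" for k by (rule realize_dec[OF in_M[OF that]])
      show "dec \<psi> j (fst v k, snd v k) = 0" if "n \<le> k" for k
        using linear_0[OF linear_dec, of j] by (simp add: z[OF that] zero_prod_def)
    qed
    moreover have "fst v \<in> copies n (loc p M)" "snd v \<in> copies n (loc p M)" if "prime p" "p \<notin> range e" for p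
      using in_M that z by (auto simp: realize_def intro!: copiesI)
    ultimately show "v \<in> realize e (copies_op \<psi>) (copies n M)"
      by (simp add: realize_def loc_copies[OF subgp_M])
  qed
  have "?f \<in> iso (grp (realize e (copies_op \<psi>) (copies n M))) (grp (copies n (realize e \<psi> M)))"
  proof (rule grp_isoI[where g = ?g])
    show "?f \<in> hom (grp (realize e (copies_op \<psi>) (copies n M))) (grp (copies n (realize e \<psi> M)))"
      unfolding hom_grp_iff using mem by (auto simp: fun_eq_iff)
    show "?g \<in> copies n (realize e \<psi> M) \<rightarrow> realize e (copies_op \<psi>) (copies n M)"
      by (rule Pi_I) (simp add: mem)
  qed simp_all
  then show ?thesis by (rule is_isoI)
qed

end

text \<open>On matrices the rows are interleaved. Thus \<open>n\<close> diagonal blocks with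
  \<open>r\<close> rows each, one from every factor, become one diagonal block with
  \<open>n r\<close> rows.\<close>

definition interleave :: "nat \<Rightarrow> (nat \<Rightarrow> nat \<Rightarrow> 'a) \<Rightarrow> nat \<Rightarrow> 'a" where
  "interleave n F i = F (i mod n) (i div n)"

lemma interleave_iso:
  fixes S T :: "(nat \<Rightarrow> 'a::real_vector) set"
  assumes n: "n > 0" and into: "\<And>F. F \<in> copies n S \<Longrightarrow> interleave n F \<in> T"
    and rows: "\<And>X k. X \<in> T \<Longrightarrow> k < n \<Longrightarrow> (\<lambda>i. X (n * i + k)) \<in> S"
  shows "interleave n \<in> iso (grp (copies n S)) (grp T)"
proof (rule grp_isoI[where g = "\<lambda>X k. if k < n then (\<lambda>i. X (n * i + k)) else 0"])
  show "interleave n \<in> hom (grp (copies n S)) (grp T)"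
    unfolding hom_grp_iff using into by (auto simp: interleave_def fun_eq_iff)
  show "(\<lambda>X k. if k < n then (\<lambda>i. X (n * i + k)) else 0) \<in> T \<rightarrow> copies n S"
    using rows by (auto simp: copies_def)
  show "(\<lambda>k. if k < n then (\<lambda>i. interleave n F (n * i + k)) else 0) = F" if "F \<in> copies n S" for F
    using copies_outside[OF that] by (auto simp: interleave_def fun_eq_iff)
  show "interleave n (\<lambda>k. if k < n then (\<lambda>i. X (n * i + k)) else 0) = X" for X
    using n by (simp add: interleave_def fun_eq_iff)
qed

lemma pmat_interleave:
  assumes n: "n > 0" and q: "q > 0"
  shows "interleave n \<in> iso (grp (copies n (pmat q))) (grp (pmat (of_nat n * q)))"
proof (rule interleave_iso[OF n])
  fix F assume F: "F \<in> copies n (pmat q)"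
  then have "F ` {..<n} \<subseteq> pmat q" using copiesD by blast
  then obtain r N where rN: "r > 0" "N > 0" "of_nat r = q * of_nat N" "F ` {..<n} \<subseteq> stage r N"
    using pmat_common_stage[of "F ` {..<n}" q] q by auto
  have st: "F (i mod n) \<in> stage r N" for i using rN(4) n by auto
  have "interleave n F \<in> stage (n * r) N"
    unfolding stage_def
  proof (intro CollectI conjI allI impI)
    fix i j
    show "interleave n F i j \<in> \<int>" using stageD(1)[OF st] by (simp add: interleave_def)
    show "i div (n * r) = j div N" if "interleave n F i j \<noteq> 0"
      using stageD(2)[OF st, of i "i div n" j] that by (simp add: interleave_def div_mult2_eq)
    show "interleave n F (i + n * r) (j + N) = interleave n F i j"
      using stageD(3)[OF st, of i "i div n" j] n by (simp add: interleave_def add.commute)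
  qed
  then show "interleave n F \<in> pmat (of_nat n * q)" using rN n by (intro pmatI[of "n * r" N]) auto
next
  fix X k assume X: "X \<in> pmat (of_nat n * q)" and k: "k < n"
  obtain r N where rN: "r > 0" "N > 0" "of_nat r = of_nat n * q * of_nat N" "X \<in> stage r N"
    using X by (rule pmatE)
  \<comment> \<open>Passing from period \<open>N\<close> to \<open>N n\<close> makes the number of
    rows in a block divisible by \<open>n\<close>, so that every residue class modulo
    \<open>n\<close> gets \<open>r\<close> of them.\<close>
  have X': "X \<in> stage (r * n) (N * n)" by (rule stage_mult[OF rN(4)])
  have "(\<lambda>i. X (n * i + k)) \<in> stage r (N * n)"
    unfolding stage_def
  proof (intro CollectI conjI allI impI)
    fix i j
    show "X (n * i + k) j \<in> \<int>" by (rule stageD(1)[OF X'])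
    show "i div r = j div (N * n)" if "X (n * i + k) j \<noteq> 0"
    proof -
      have "(n * i + k) div (r * n) = i div r"
        using k by (simp add: mult.commute[of r] div_mult2_eq)
      then show ?thesis using stageD(2)[OF X' that] by simp
    qed
    have "n * (i + r) + k = n * i + k + r * n" by (simp add: algebra_simps)
    then show "X (n * (i + r) + k) (j + N * n) = X (n * i + k) j"
      using stageD(3)[OF X', of "n * i + k" j] by (simp only:)
  qed
  then show "(\<lambda>i. X (n * i + k)) \<in> pmat q" using rN n by (intro pmatI[of r "N * n"]) auto
qed

lemma interleave_rop: "interleave n (copies_op rop k F) = rop k (interleave n F)"
  by (auto simp: interleave_def copies_op_def rop_def rmul_def fun_eq_iff split: prod.splits)

section \<open>Groups remembering a positive rational number\<close>

text \<open>The infinite product absorbs finite powers, unlike the group of integers, and still has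
  the integers as a summand.\<close>

definition int_seqs :: "(nat \<Rightarrow> real) set" where
  "int_seqs = {f. \<forall>i. f i \<in> \<int>}"

lemma subgp_int_seqs: "subgp int_seqs"
  by (simp add: subgp_def int_seqs_def)

lemma int_seqs_copies:
  assumes "n > 0"
  shows "grp (copies n int_seqs) \<cong> grp int_seqs"
  by (rule is_isoI, rule interleave_iso[OF assms]) (use assms in \<open>auto simp: copies_def int_seqs_def interleave_def\<close>)

lemma Ints_infinitely_divisible:
  fixes x :: real
  assumes "p > (1::nat)" "\<And>k. x / real (p ^ k) \<in> \<int>"
  shows "x = 0"
proof (rule ccontr)
  assume "x \<noteq> 0"
  obtain k where k: "\<bar>x\<bar> < real p ^ k" using real_arch_pow[of "real p"] assms(1) by auto
  have "\<bar>x / real (p ^ k)\<bar> < 1" using k assms(1) by (simp add: field_simps)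
  with assms(2)[of k] have "x / real (p ^ k) = 0" by (intro Ints_nonzero_abs_less1)
  with \<open>x \<noteq> 0\<close> assms(1) show False by simp
qed

locale prime_sequence =
  fixes e :: "nat \<Rightarrow> nat"
  assumes inj_e: "inj e" and prime_e: "prime (e j)"
begin

definition A :: "rat \<Rightarrow> ((nat \<Rightarrow> nat \<Rightarrow> real) \<times> (nat \<Rightarrow> nat \<Rightarrow> real)) set" where
  "A q = realize e rop (pmat q)"

definition B :: "rat \<Rightarrow> (((nat \<Rightarrow> nat \<Rightarrow> real) \<times> (nat \<Rightarrow> nat \<Rightarrow> real)) \<times> (nat \<Rightarrow> real)) set" where
  "B q = A q \<times> int_seqs"

lemma realizable_pmat:
  assumes q: "q > 0"
  shows "realizable e rop (pmat q)"
proof (rule realizable.intro)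
  show "linear (rop k)" for k unfolding rop_def by (rule linear_rmul)
  show "rop k X \<in> pmat q" if "X \<in> pmat q" for k X
    unfolding rop_def by (rule rmul_pmat[OF that q])
qed (simp_all add: inj_e prime_e subgp_pmat[OF q] reduced_pmat)

lemma subgp_A: "q > 0 \<Longrightarrow> subgp (A q)"
  unfolding A_def by (rule realizable.subgp_realize[OF realizable_pmat])

lemma subgp_B: "q > 0 \<Longrightarrow> subgp (B q)"
  unfolding B_def by (intro subgp_Times subgp_A subgp_int_seqs)

text \<open>Interleaving acts on rows and the operators act on columns, so the isomorphism of
  modules lifts to the realised groups.\<close>

lemma A_copies:
  assumes n: "n > 0" and q: "q > 0"
  shows "grp (copies n (A q)) \<cong> grp (A (of_nat n * q))"
proof -
  interpret R: realizable e rop "pmat q" by (rule realizable_pmat[OF q])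
  have nq: "of_nat n * q > 0" using n q by simp
  interpret pair: realizable_pair e "copies_op rop" "copies n (pmat q)" rop "pmat (of_nat n * q)"
    by (intro realizable_pair.intro R.realizable_copies realizable_pmat nq)
  have "grp (realize e (copies_op rop) (copies n (pmat q))) \<cong> grp (A (of_nat n * q))"
    unfolding A_def by (rule pair.iso_lift[OF pmat_interleave[OF n q]]) (simp add: interleave_rop)
  moreover have "grp (copies n (A q)) \<cong> grp (realize e (copies_op rop) (copies n (pmat q)))"
    unfolding A_def
    by (rule group.iso_sym[OF group_grp[OF pair.R1.subgp_realize] R.realize_copies])
  ultimately show ?thesis by (rule iso_trans[rotated])
qed

lemma B_copies:
  assumes n: "n > 0" and q: "q > 0"
  shows "grp (copies n (B q)) \<cong> grp (B (of_nat n * q))"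
  unfolding B_def
  by (rule iso_trans[OF copies_Times_iso Times_iso[OF A_copies[OF n q] int_seqs_copies[OF n]]])

text \<open>The base map of an isomorphism is an isomorphism of the underlying matrix modules, whose
  rank is an invariant.\<close>

lemma A_unique:
  assumes q: "q > 0" "q' > 0" and iso: "grp (A q) \<cong> grp (A q')"
  shows "q = q'"
proof -
  interpret pair: realizable_pair e rop "pmat q" rop "pmat q'"
    by (intro realizable_pair.intro realizable_pmat q)
  obtain \<phi> where \<phi>: "\<phi> \<in> iso (grp (realize e rop (pmat q))) (grp (realize e rop (pmat q')))"
    using iso by (auto simp: is_iso_def A_def)
  then have "\<phi> \<in> hom (grp (realize e rop (pmat q))) (grp (realize e rop (pmat q')))"
    by (simp add: iso_def)
  from pmat_rank_unique[OF q pair.iso_base[OF \<phi>] pair.base_op[OF this]] show ?thesis .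
qed

text \<open>Elements \<open>(x, 0)\<close> and \<open>(0, y)\<close> with entries in
  \<open>pmat q\<close> are divisible in \<open>A q\<close> by all powers of \<open>e 1\<close> and
  \<open>e 0\<close> respectively, so they are sent to 0. Every element has a positive multiple that
  is a sum of two such elements.\<close>

lemma A_hom_Ints:
  assumes q: "q > 0" and h: "h \<in> hom (grp (A q)) (grp (\<int> :: real set))" and a: "a \<in> A q"
  shows "h a = 0"
proof -
  interpret R: realizable e rop "pmat q" by (rule realizable_pmat[OF q])
  note sA = subgp_A[OF q]
  have div: "h v = 0" if v: "v \<in> pmat q \<times> pmat q" "dec rop j v = 0" for v j
  proof (rule Ints_infinitely_divisible[where p = "e j"])
    show p: "e j > 1" by (rule prime_gt_1_nat[OF prime_e])
    fix k
    let ?w = "v /\<^sub>R real (e j ^ k)"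
    have w: "?w \<in> A q" unfolding A_def by (rule R.realize_divide[OF v])
    have "real (e j ^ k) *\<^sub>R ?w = v" using p by simp
    then have "h v = real (e j ^ k) * h ?w"
      using hom_scaleR_nat[OF h sA w, of "e j ^ k"] by simp
    then have "h v / real (e j ^ k) = h ?w" using p by simp
    then show "h v / real (e j ^ k) \<in> \<int>" using hom_in[OF h w] by simp
  qed
  obtain d where d: "d > 0" "real d *\<^sub>R a \<in> pmat q \<times> pmat q"
    using a unfolding A_def by (rule R.realize_denominator)
  obtain x y where xy: "real d *\<^sub>R a = (x, y)" "x \<in> pmat q" "y \<in> pmat q" using d(2) by blast
  have 0: "0 \<in> pmat q" using R.subgp_M by simp
  have in_A: "v \<in> A q" if "v \<in> pmat q \<times> pmat q" for v using that R.realize_incl by (auto simp: A_def)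
  have "real d * h a = h (real d *\<^sub>R a)" using hom_scaleR_nat[OF h sA a] by simp
  also have "real d *\<^sub>R a = (x, 0) + (0, y)" by (simp add: xy)
  also have "h \<dots> = h (x, 0) + h (0, y)" using xy 0 by (intro hom_add[OF h] in_A) auto
  also have "h (x, 0) = 0" using xy 0 by (intro div[of _ 1]) (auto simp: dec_def)
  also have "h (0, y) = 0" using xy 0 by (intro div[of _ 0]) (auto simp: dec_def)
  finally show ?thesis using d by simp
qed

text \<open>A homomorphism from \<open>A q\<close> to integer sequences vanishes in each coordinate.
  Hence an isomorphism and its inverse preserve the first factors and restrict to inverse
  isomorphisms between them.\<close>

lemma B_unique:
  assumes q: "q > 0" and q': "q' > 0" and iso: "grp (B q) \<cong> grp (B q')"
  shows "q = q'"
proof -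
  obtain f where f: "f \<in> iso (grp (B q)) (grp (B q'))" using iso by (auto simp: is_iso_def)
  then have fh: "f \<in> hom (grp (B q)) (grp (B q'))" by (simp add: iso_def)
  obtain g where gh: "g \<in> hom (grp (B q')) (grp (B q))" and gf: "\<And>x. x \<in> B q \<Longrightarrow> g (f x) = x"
    and fg: "\<And>y. y \<in> B q' \<Longrightarrow> f (g y) = y"
    using iso_grp_inverse[OF f subgp_B[OF q]] by metis
  have incl: "(a, 0) \<in> B s" if "a \<in> A s" for a s
    using that subgp_int_seqs by (simp add: B_def)
  have to_A: "\<exists>a'\<in>A t. k (a, 0) = (a', 0)"
    if k: "k \<in> hom (grp (B s)) (grp (B t))" and a: "a \<in> A s" and s: "s > 0" for k s t a
  proof -
    have kB: "k (a, 0) \<in> A t \<times> int_seqs" using hom_in[OF k incl[OF a]] by (simp add: B_def)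
    have "snd (k (a, 0)) i = 0" for i
    proof (rule A_hom_Ints[OF s _ a, where h = "\<lambda>a. snd (k (a, 0)) i"])
      show "(\<lambda>a. snd (k (a, 0)) i) \<in> hom (grp (A s)) (grp \<int>)"
        unfolding hom_grp_iff
      proof (intro conjI ballI)
        fix x assume x: "x \<in> A s"
        show "snd (k (x, 0)) i \<in> \<int>"
          using hom_in[OF k incl[OF x]] by (auto simp: B_def int_seqs_def mem_Times_iff)
        fix y assume y: "y \<in> A s"
        show "snd (k (x + y, 0)) i = snd (k (x, 0)) i + snd (k (y, 0)) i"
          using hom_add[OF k incl[OF x] incl[OF y]] by simp
      qed
    qed
    then have "snd (k (a, 0)) = 0" by (simp add: fun_eq_iff)
    then show ?thesis using kB by (metis mem_Times_iff prod.collapse)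
  qed
  have "(\<lambda>a. fst (f (a, 0))) \<in> iso (grp (A q)) (grp (A q'))"
  proof (rule grp_isoI[where g = "\<lambda>a. fst (g (a, 0))"])
    show "(\<lambda>a. fst (f (a, 0))) \<in> hom (grp (A q)) (grp (A q'))"
      unfolding hom_grp_iff
    proof (intro conjI ballI)
      fix x assume x: "x \<in> A q"
      show "fst (f (x, 0)) \<in> A q'" using to_A[OF fh x q] by auto
      fix y assume y: "y \<in> A q"
      show "fst (f (x + y, 0)) = fst (f (x, 0)) + fst (f (y, 0))"
        using hom_add[OF fh incl[OF x] incl[OF y]] by simp
    qed
    show "(\<lambda>a. fst (g (a, 0))) \<in> A q' \<rightarrow> A q"
    proof
      fix y assume "y \<in> A q'"
      from to_A[OF gh this q'] show "fst (g (y, 0)) \<in> A q" by auto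
    qed
    show "fst (g (fst (f (a, 0)), 0)) = a" if a: "a \<in> A q" for a
    proof -
      obtain b where "f (a, 0) = (b, 0)" using to_A[OF fh a q] by blast
      then show ?thesis using gf[OF incl[OF a]] by simp
    qed
    show "fst (f (fst (g (a, 0)), 0)) = a" if a: "a \<in> A q'" for a
    proof -
      obtain b where "g (a, 0) = (b, 0)" using to_A[OF gh a q'] by blast
      then show ?thesis using fg[OF incl[OF a]] by simp
    qed
  qed
  then show ?thesis using A_unique[OF q q'] is_isoI by blast
qed

end

section \<open>The group\<close>

lemma reduced_zero: "reduced p {0}"
  unfolding reduced_def
proof (intro allI impI)
  fix x :: 'a assume "\<forall>k. x /\<^sub>R real (p ^ k) \<in> loc p {0}"
  then have "x /\<^sub>R real (p ^ 0) \<in> loc p {0}" by blast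
  then show "x = 0" by (auto elim: locE)
qed

lemma reduced_Times:
  assumes "reduced p S" "reduced p T"
  shows "reduced p (S \<times> T)"
  unfolding reduced_def
proof (intro allI impI)
  fix v assume v: "\<forall>k. v /\<^sub>R real (p ^ k) \<in> loc p (S \<times> T)"
  have "fst v /\<^sub>R real (p ^ k) \<in> loc p S \<and> snd v /\<^sub>R real (p ^ k) \<in> loc p T" for k
  proof -
    obtain d where d: "d > 0" "coprime d p" "real d *\<^sub>R (v /\<^sub>R real (p ^ k)) \<in> S \<times> T"
      using v by (meson locE)
    then show ?thesis by (auto simp: mem_Times_iff intro: locI[OF d(1,2)])
  qed
  then have "fst v = 0" "snd v = 0" using reducedD[OF assms(1)] reducedD[OF assms(2)] by blast+
  then show "v = 0" by (simp add: prod_eq_iff)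
qed

lemma reduced_int_seqs: "prime p \<Longrightarrow> reduced p int_seqs"
  by (rule reduced_coordinates[where l = "\<lambda>k F. F k" and N = "\<lambda>_. \<int>"])
     (auto simp: int_seqs_def intro: linearI reduced_Ints)

lemma reduced_direct_sum:
  assumes "\<And>i. i \<in> I \<Longrightarrow> reduced p (C i)"
  shows "reduced p (direct_sum I C)"
proof (rule reduced_coordinates[where l = "\<lambda>k F. F k" and N = "\<lambda>i. if i \<in> I then C i else {0}"])
  show "F i \<in> (if i \<in> I then C i else {0})" if "F \<in> direct_sum I C" for F i
    using that by (simp add: direct_sum_def)
  show "reduced p (if i \<in> I then C i else {0})" for i
    using assms by (simp add: reduced_zero)
qed (auto intro: linearI)

text \<open>At a prime outside the range of \<open>e\<close> the realisation has both coordinates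
  integral. This is why the outer realisation uses a disjoint sequence of primes.\<close>

lemma (in prime_sequence) reduced_B:
  assumes p: "prime p" "p \<notin> range e"
  shows "reduced p (B q)"
proof -
  have "A q \<subseteq> loc p (pmat q) \<times> loc p (pmat q)"
    using p by (auto simp: A_def realize_def)
  moreover have "reduced p (loc p (pmat q) \<times> loc p (pmat q))"
    by (intro reduced_Times reduced_loc reduced_pmat p)
  ultimately have "reduced p (A q)" by (rule reduced_subset[rotated])
  then show ?thesis unfolding B_def by (intro reduced_Times reduced_int_seqs p)
qed

lemma (in prime_sequence) realizable_direct_sum:
  fixes C :: "'i::countable \<Rightarrow> 'a::real_vector set"
  assumes sub: "\<And>i. i \<in> I \<Longrightarrow> subgp (C i)" and red: "\<And>i j. i \<in> I \<Longrightarrow> reduced (e j) (C i)"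
  shows "realizable e proj (direct_sum I C)"
proof (rule realizable.intro)
  show "proj k F \<in> direct_sum I C" if "F \<in> direct_sum I C" for k F by (rule proj_in_direct_sum[OF sub that])
  show "reduced (e j) (direct_sum I C)" for j by (rule reduced_direct_sum[OF red])
qed (rule inj_e prime_e subgp_direct_sum[OF sub] linear_proj; assumption)+

text \<open>Exchanging the two arguments preserves finite supports because only finitely many copies
  are involved.\<close>

lemma direct_sum_swap:
  fixes C :: "'i::countable \<Rightarrow> 'a::real_vector set"
  shows "(\<lambda>F i k. F k i) \<in> iso (grp (copies n (direct_sum I C))) (grp (direct_sum I (\<lambda>i. copies n (C i))))"
proof (rule grp_isoI[where g = "\<lambda>F k i. F i k"])
  show "(\<lambda>F i k. F k i) \<in> hom (grp (copies n (direct_sum I C))) (grp (direct_sum I (\<lambda>i. copies n (C i))))"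
    unfolding hom_grp_iff
  proof (intro conjI ballI)
    fix F assume F: "F \<in> copies n (direct_sum I C)"
    have D: "F k \<in> direct_sum I C" if "k < n" for k by (rule copiesD[OF F that])
    have fin: "finite {i. F k i \<noteq> 0}" if "k < n" for k using D[OF that] by (simp add: direct_sum_def)
    have 0: "F k = 0" if "\<not> k < n" for k using copies_outside[OF F] that by simp
    have "{i. (\<lambda>k. F k i) \<noteq> 0} \<subseteq> (\<Union>k<n. {i. F k i \<noteq> 0})"
    proof
      fix i assume "i \<in> {i. (\<lambda>k. F k i) \<noteq> 0}"
      then obtain k where k: "F k i \<noteq> 0" by (auto simp: fun_eq_iff)
      then have "k < n" using 0[of k] by (cases "k < n") auto
      with k show "i \<in> (\<Union>k<n. {i. F k i \<noteq> 0})" by blast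
    qed
    then have "finite {i. (\<lambda>k. F k i) \<noteq> 0}" by (rule finite_subset) (use fin in auto)
    moreover have "(\<lambda>k. F k i) \<in> copies n (C i)" if "i \<in> I" for i
      by (rule copiesI) (use direct_sumD[OF D that] 0 in auto)
    moreover have "(\<lambda>k. F k i) = 0" if "i \<notin> I" for i
    proof
      show "F k i = 0 k" for k using direct_sum_outside[OF D that] 0[of k] by (cases "k < n") auto
    qed
    ultimately show "(\<lambda>i k. F k i) \<in> direct_sum I (\<lambda>i. copies n (C i))"
      by (simp add: direct_sum_def)
  qed (simp add: fun_eq_iff)
  show "(\<lambda>F k i. F i k) \<in> direct_sum I (\<lambda>i. copies n (C i)) \<rightarrow> copies n (direct_sum I C)"
  proof (intro Pi_I copiesI)
    fix F k assume F: "F \<in> direct_sum I (\<lambda>i. copies n (C i))"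
    have out: "F i k = 0" if "i \<notin> I" for i using direct_sum_outside[OF F that] by simp
    show "(\<lambda>i. F i k) \<in> direct_sum I C" if k: "k < n"
    proof -
      have "{i. F i k \<noteq> 0} \<subseteq> {i. F i \<noteq> 0}" by auto
      moreover have "finite {i. F i \<noteq> 0}" using F by (simp add: direct_sum_def)
      ultimately have "finite {i. F i k \<noteq> 0}" by (rule finite_subset)
      then show ?thesis using copiesD[OF direct_sumD[OF F] k] out by (simp add: direct_sum_def)
    qed
    show "(\<lambda>i. F i k) = 0" if "n \<le> k"
    proof
      show "F i k = 0 i" for i
        using copies_outside[OF direct_sumD[OF F] that] out by (cases "i \<in> I") auto
    qed
  qed
qed simp_all

lemma swap_proj: "(\<lambda>i k. copies_op proj j F k i) = proj j (\<lambda>i k. F k i)"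
  by (auto simp: copies_op_def proj_def single_def fun_eq_iff)

text \<open>Graded endomorphisms act on each summand separately, so only the isomorphism types of
  the summands matter and not their labels. The bijection \<sigma> acts on the whole index type and
  thereby matches every projection with a projection, including those outside
  \<open>I\<close>.\<close>

lemma commutant_reindex:
  fixes C :: "'i::countable \<Rightarrow> 'a::real_vector set" and C' :: "'i \<Rightarrow> 'b::real_vector set"
  assumes ts: "\<And>i. \<tau> (\<sigma> i) = i" and st: "\<And>i. \<sigma> (\<tau> i) = i"
    and C: "\<And>i. i \<in> I \<Longrightarrow> subgp (C i)" and iso: "\<And>i. i \<in> I \<Longrightarrow> grp (C i) \<cong> grp (C' (\<sigma> i))"
    and C': "\<And>i. i \<in> I \<Longrightarrow> subgp (C' (\<sigma> i))"
  shows "commutant proj (direct_sum I C) \<simeq> commutant proj (direct_sum (\<sigma> ` I) C')"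
proof -
  have "\<exists>f g. f \<in> hom (grp (C i)) (grp (C' (\<sigma> i))) \<and> g \<in> hom (grp (C' (\<sigma> i))) (grp (C i)) \<and>
      (\<forall>x\<in>C i. g (f x) = x) \<and> (\<forall>y\<in>C' (\<sigma> i). f (g y) = y)" if i: "i \<in> I" for i
  proof -
    obtain f where f: "f \<in> iso (grp (C i)) (grp (C' (\<sigma> i)))"
      using iso[OF i] by (auto simp: is_iso_def)
    then have "f \<in> hom (grp (C i)) (grp (C' (\<sigma> i)))" by (simp add: iso_def)
    then show ?thesis using iso_grp_inverse[OF f C[OF i]] by metis
  qed
  then obtain f g where f: "\<And>i. i \<in> I \<Longrightarrow> f i \<in> hom (grp (C i)) (grp (C' (\<sigma> i)))"
    and g: "\<And>i. i \<in> I \<Longrightarrow> g i \<in> hom (grp (C' (\<sigma> i))) (grp (C i))"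
    and gf: "\<And>i x. i \<in> I \<Longrightarrow> x \<in> C i \<Longrightarrow> g i (f i x) = x"
    and fg: "\<And>i y. i \<in> I \<Longrightarrow> y \<in> C' (\<sigma> i) \<Longrightarrow> f i (g i y) = y"
    by metis
  let ?M = "direct_sum I C" and ?N = "direct_sum (\<sigma> ` I) C'"
  let ?f = "\<lambda>F x. if \<tau> x \<in> I then f (\<tau> x) (F (\<tau> x)) else 0"
  let ?g = "\<lambda>G i. if i \<in> I then g i (G (\<sigma> i)) else 0"
  have f0: "f i 0 = 0" if "i \<in> I" for i by (rule hom_0[OF f[OF that] C[OF that]])
  have g0: "g i 0 = 0" if "i \<in> I" for i by (rule hom_0[OF g[OF that] C'[OF that]])
  have C'': "subgp (C' x)" if "x \<in> \<sigma> ` I" for x using that C' by blast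
  have img: "x \<in> \<sigma> ` I \<longleftrightarrow> \<tau> x \<in> I" for x by (metis imageE imageI st ts)
  have fhom: "?f \<in> hom (grp ?M) (grp ?N)"
    unfolding hom_grp_iff
  proof (intro conjI ballI)
    fix F assume F: "F \<in> ?M"
    have "{x. ?f F x \<noteq> 0} \<subseteq> \<sigma> ` {i. F i \<noteq> 0}"
    proof
      fix x assume "x \<in> {x. ?f F x \<noteq> 0}"
      then have "F (\<tau> x) \<noteq> 0" using f0 by (auto split: if_splits)
      then show "x \<in> \<sigma> ` {i. F i \<noteq> 0}" using st[of x] by (metis (mono_tags) image_eqI mem_Collect_eq)
    qed
    then have fin: "finite {x. ?f F x \<noteq> 0}"
      by (rule finite_subset) (use F in \<open>simp add: direct_sum_def\<close>)
    have "f i (F i) \<in> C' (\<sigma> i)" if "i \<in> I" for i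
      by (rule hom_in[OF f[OF that] direct_sumD[OF F that]])
    then show "?f F \<in> ?N" unfolding direct_sum_def using fin by (simp add: img ts)
    fix G assume G: "G \<in> ?M"
    show "?f (F + G) = ?f F + ?f G"
    proof
      show "?f (F + G) x = (?f F + ?f G) x" for x
        using hom_add[OF f direct_sumD[OF F] direct_sumD[OF G], of "\<tau> x"] by auto
    qed
  qed
  have ghom: "?g \<in> hom (grp ?N) (grp ?M)"
    unfolding hom_grp_iff
  proof (intro conjI ballI)
    fix F assume F: "F \<in> ?N"
    have "{i. ?g F i \<noteq> 0} \<subseteq> \<tau> ` {x. F x \<noteq> 0}"
    proof
      fix i assume "i \<in> {i. ?g F i \<noteq> 0}"
      then have "F (\<sigma> i) \<noteq> 0" using g0 by (auto split: if_splits)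
      then show "i \<in> \<tau> ` {x. F x \<noteq> 0}" using ts[of i] by (metis (mono_tags) image_eqI mem_Collect_eq)
    qed
    then have fin: "finite {i. ?g F i \<noteq> 0}"
      by (rule finite_subset) (use F in \<open>simp add: direct_sum_def\<close>)
    have "?g F i \<in> C i" if "i \<in> I" for i
      using hom_in[OF g[OF that] direct_sumD[OF F]] that by simp
    then show "?g F \<in> ?M" unfolding direct_sum_def using fin by simp
    fix G assume G: "G \<in> ?N"
    show "?g (F + G) = ?g F + ?g G"
    proof
      show "?g (F + G) i = (?g F + ?g G) i" for i
        using hom_add[OF g direct_sumD[OF F] direct_sumD[OF G], of i] by auto
    qed
  qed
  have single: "?f (single i (F i)) = single (\<sigma> i) (?f F (\<sigma> i))" for F i
  proof
    fix x
    show "?f (single i (F i)) x = single (\<sigma> i) (?f F (\<sigma> i)) x"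
    proof (cases "x = \<sigma> i")
      case True
      then show ?thesis by (simp add: ts)
    next
      case False
      then have "\<tau> x \<noteq> i" using st by metis
      then show ?thesis using False f0 by (simp add: single_def)
    qed
  qed
  show ?thesis
  proof (rule commutant_conj[OF _ _ fhom ghom])
    show "subgp ?M" "subgp ?N" by (rule subgp_direct_sum[OF C], assumption, rule subgp_direct_sum[OF C''])
    show "?g (?f F) = F" if "F \<in> ?M" for F
    proof
      show "?g (?f F) i = F i" for i
        using gf[OF _ direct_sumD[OF that], of i] direct_sum_outside[OF that, of i] by (auto simp: ts)
    qed
    show "?f (?g G) = G" if "G \<in> ?N" for G
    proof
      show "?f (?g G) x = G x" for x
        using fg[of "\<tau> x" "G x"] direct_sumD[OF that, of x] direct_sum_outside[OF that, of x]
        by (auto simp: img st)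
    qed
    show "proj k \<in> hom (grp ?M) (grp ?M)" for k by (rule proj_hom_direct_sum[OF C])
    show "proj k \<in> hom (grp ?N) (grp ?N)" for k by (rule proj_hom_direct_sum[OF C''])
    show "\<exists>l. \<forall>F\<in>?M. ?f (proj k F) = proj l (?f F)" for k
      by (rule exI[of _ "to_nat (\<sigma> (from_nat k))"]) (simp only: proj_to_nat proj_def[of k] single, simp)
    show "\<exists>k. \<forall>F\<in>?M. ?f (proj k F) = proj l (?f F)" for l
      by (rule exI[of _ "to_nat (\<tau> (from_nat l))"]) (simp only: proj_to_nat proj_def[of l] single st, simp)
  qed
qed

text \<open>In contrast to the ring, the map commutes with each projection under its own index. So
  it preserves every component, and its inverse does too.\<close>

lemma component_iso:
  fixes C :: "'i::countable \<Rightarrow> 'a::real_vector set" and C' :: "'i \<Rightarrow> 'b::real_vector set"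
  assumes C: "\<And>i. i \<in> I \<Longrightarrow> subgp (C i)" and C': "\<And>i. i \<in> I \<Longrightarrow> subgp (C' i)"
    and f: "f \<in> iso (grp (direct_sum I C)) (grp (direct_sum I C'))"
    and comm: "\<And>k F. F \<in> direct_sum I C \<Longrightarrow> f (proj k F) = proj k (f F)"
    and i: "i \<in> I"
  shows "grp (C i) \<cong> grp (C' i)"
proof -
  let ?M = "direct_sum I C" and ?N = "direct_sum I C'"
  have fh: "f \<in> hom (grp ?M) (grp ?N)" using f by (simp add: iso_def)
  obtain g where gh: "g \<in> hom (grp ?N) (grp ?M)" and gf: "\<And>x. x \<in> ?M \<Longrightarrow> g (f x) = x"
    and fg: "\<And>y. y \<in> ?N \<Longrightarrow> f (g y) = y"
    using iso_grp_inverse[OF f subgp_direct_sum[of I C]] C by metis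
  have sM: "single i b \<in> ?M" if "b \<in> C i" for b
    using single_in_direct_sum[of I C i b] C i that by blast
  have sN: "single i b \<in> ?N" if "b \<in> C' i" for b
    using single_in_direct_sum[of I C' i b] C' i that by blast
  have fs: "f (single i b) = single i (f (single i b) i)" if "b \<in> C i" for b
    using comm[OF sM[OF that], of "to_nat i"] by simp
  have gs: "g (single i b) = single i (g (single i b) i)" if "b \<in> C' i" for b
  proof -
    have G: "g (single i b) \<in> ?M" by (rule hom_in[OF gh sN[OF that]])
    have "f (single i (g (single i b) i)) = single i b"
      using comm[OF G, of "to_nat i"] fg[OF sN[OF that]] by simp
    then show ?thesis using gf[OF sM[OF direct_sumD[OF G i]]] by simp
  qed
  have "(\<lambda>b. f (single i b) i) \<in> iso (grp (C i)) (grp (C' i))"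
  proof (rule grp_isoI[where g = "\<lambda>b. g (single i b) i"])
    show "(\<lambda>b. f (single i b) i) \<in> hom (grp (C i)) (grp (C' i))"
      unfolding hom_grp_iff
    proof (intro conjI ballI)
      fix b assume b: "b \<in> C i"
      show "f (single i b) i \<in> C' i" by (rule direct_sumD[OF hom_in[OF fh sM[OF b]] i])
      fix c assume c: "c \<in> C i"
      show "f (single i (b + c)) i = f (single i b) i + f (single i c) i"
        by (simp add: single_add hom_add[OF fh sM[OF b] sM[OF c]])
    qed
    show "(\<lambda>b. g (single i b) i) \<in> C' i \<rightarrow> C i"
      by (rule Pi_I, rule direct_sumD[OF hom_in[OF gh sN] i])
    show "g (single i (f (single i b) i)) i = b" if "b \<in> C i" for b
      using fs[OF that] gf[OF sM[OF that]] by simp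
    show "f (single i (g (single i b) i)) i = b" if "b \<in> C' i" for b
      using gs[OF that] fg[OF sN[OF that]] by simp
  qed
  then show ?thesis by (rule is_isoI)
qed

lemma endomorphism_ring_cong:
  assumes G: "group G" and K: "group K" and iso: "G \<cong> K"
  shows "endomorphism_ring G \<simeq> endomorphism_ring K"
proof -
  interpret G: group G by (rule G)
  interpret K: group K by (rule K)
  obtain f where f: "f \<in> iso G K" using iso by (auto simp: is_iso_def)
  define g where "g = inv_into (carrier G) f"
  have g: "g \<in> iso K G" unfolding g_def by (rule G.iso_set_sym[OF f])
  have bij: "bij_betw f (carrier G) (carrier K)" using f by (simp add: iso_def)
  have gf: "g (f x) = x" if "x \<in> carrier G" for x
    unfolding g_def by (rule bij_betw_inv_into_left[OF bij that])
  have fg: "f (g y) = y" if "y \<in> carrier K" for y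
    unfolding g_def by (rule bij_betw_inv_into_right[OF bij that])
  have fh: "f \<in> hom G K" and gh: "g \<in> hom K G" using f g by (simp_all add: iso_def)
  note fC = hom_in_carrier[OF fh] and gC = hom_in_carrier[OF gh]
  let ?E = "endomorphism_ring G" and ?D = "endomorphism_ring K"
  let ?h = "\<lambda>a. \<lambda>y\<in>carrier K. f (a (g y))" and ?k = "\<lambda>b. \<lambda>x\<in>carrier G. g (b (f x))"
  have E: "a \<in> hom G G" "a \<in> extensional (carrier G)" if "a \<in> carrier ?E" for a
    using that by (simp_all add: endomorphism_ring_def)
  have D: "a \<in> hom K K" "a \<in> extensional (carrier K)" if "a \<in> carrier ?D" for a
    using that by (simp_all add: endomorphism_ring_def)
  have h: "?h a \<in> carrier ?D" if a: "a \<in> carrier ?E" for a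
  proof -
    have "?h a \<in> hom K K"
      by (rule homI) (simp_all add: fC gC hom_in_carrier[OF E(1)[OF a]] hom_mult[OF gh]
          hom_mult[OF E(1)[OF a]] hom_mult[OF fh])
    then show ?thesis by (simp add: endomorphism_ring_def)
  qed
  have k: "?k a \<in> carrier ?E" if a: "a \<in> carrier ?D" for a
  proof -
    have "?k a \<in> hom G G"
      by (rule homI) (simp_all add: fC gC hom_in_carrier[OF D(1)[OF a]] hom_mult[OF gh]
          hom_mult[OF D(1)[OF a]] hom_mult[OF fh])
    then show ?thesis by (simp add: endomorphism_ring_def)
  qed
  have "?h \<in> ring_iso ?E ?D"
  proof (rule ring_iso_memI)
    show "?h a \<in> carrier ?D" if "a \<in> carrier ?E" for a by (rule h[OF that])
    show "?h (a \<otimes>\<^bsub>?E\<^esub> b) = ?h a \<otimes>\<^bsub>?D\<^esub> ?h b" if "a \<in> carrier ?E" "b \<in> carrier ?E" for a b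
      by (rule ext) (simp add: endomorphism_ring_def compose_def gC fC gf hom_in_carrier[OF E(1)[OF that(2)]])
    show "?h (a \<oplus>\<^bsub>?E\<^esub> b) = ?h a \<oplus>\<^bsub>?D\<^esub> ?h b" if "a \<in> carrier ?E" "b \<in> carrier ?E" for a b
      by (rule ext) (simp add: endomorphism_ring_def gC hom_mult[OF fh] hom_in_carrier[OF E(1)[OF that(1)]]
          hom_in_carrier[OF E(1)[OF that(2)]])
    show "?h \<one>\<^bsub>?E\<^esub> = \<one>\<^bsub>?D\<^esub>"
      by (rule ext) (simp add: endomorphism_ring_def gC fg)
    show "bij_betw ?h (carrier ?E) (carrier ?D)"
    proof (rule bij_betwI[where g = ?k])
      show "?h \<in> carrier ?E \<rightarrow> carrier ?D" by (intro Pi_I h)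
      show "?k \<in> carrier ?D \<rightarrow> carrier ?E" by (intro Pi_I k)
      show "?k (?h a) = a" if "a \<in> carrier ?E" for a
        by (rule extensionalityI[OF restrict_extensional E(2)[OF that]])
           (simp add: fC gf hom_in_carrier[OF E(1)[OF that]])
      show "?h (?k a) = a" if "a \<in> carrier ?D" for a
        by (rule extensionalityI[OF restrict_extensional D(2)[OF that]])
           (simp add: gC fg hom_in_carrier[OF D(1)[OF that]])
    qed
  qed
  then show ?thesis by (auto simp: is_ring_iso_def)
qed

text \<open>A real number is coded by its lower Dedekind cut in the countable set of
  rationals.\<close>

lemma inj_real_nat_set: "\<exists>\<iota> :: real \<Rightarrow> nat set. inj \<iota>"
proof
  show "inj (\<lambda>r::real. {to_nat q |q::rat. of_rat q < r})"
  proof (rule injI)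
    fix x y :: real
    assume eq: "{to_nat q |q::rat. of_rat q < x} = {to_nat q |q::rat. of_rat q < y}"
    have iff: "of_rat q < x \<longleftrightarrow> of_rat q < y" for q :: rat
    proof -
      have "to_nat q \<in> {to_nat q |q::rat. of_rat q < x} \<longleftrightarrow> to_nat q \<in> {to_nat q |q::rat. of_rat q < y}"
        by (simp only: eq)
      then show ?thesis by simp
    qed
    show "x = y"
    proof (rule linorder_cases[of x y])
      assume "x < y"
      then obtain q where "x < of_rat q" "of_rat q < y" using of_rat_dense by blast
      then show ?thesis using iff[of q] by simp
    next
      assume "y < x"
      then obtain q where "y < of_rat q" "of_rat q < x" using of_rat_dense by blast
      then show ?thesis using iff[of q] by simp
    qed
  qed
qed

text \<open>Countably many sets of natural numbers are merged into one through a coding of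
  pairs.\<close>

lemma inj_fun_nat_set:
  assumes "\<exists>\<iota> :: 'a \<Rightarrow> nat set. inj \<iota>"
  shows "\<exists>\<kappa> :: ('i::countable \<Rightarrow> 'a) \<Rightarrow> nat set. inj \<kappa>"
proof -
  obtain \<iota> :: "'a \<Rightarrow> nat set" where \<iota>: "inj \<iota>" using assms by blast
  have "inj (\<lambda>f :: 'i \<Rightarrow> 'a. {to_nat (i, k) |i k. k \<in> \<iota> (f i)})"
  proof (rule injI, rule ext)
    fix f g :: "'i \<Rightarrow> 'a" and i
    assume eq: "{to_nat (i, k) |i k. k \<in> \<iota> (f i)} = {to_nat (i, k) |i k. k \<in> \<iota> (g i)}"
    have "k \<in> \<iota> (f i) \<longleftrightarrow> k \<in> \<iota> (g i)" for k
    proof -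
      have "to_nat (i, k) \<in> {to_nat (i, k) |i k. k \<in> \<iota> (f i)} \<longleftrightarrow>
          to_nat (i, k) \<in> {to_nat (i, k) |i k. k \<in> \<iota> (g i)}"
        by (simp only: eq)
      then show ?thesis by simp
    qed
    then have "\<iota> (f i) = \<iota> (g i)" by (rule Set.set_eqI)
    then show "f i = g i" by (rule injD[OF \<iota>])
  qed
  then show ?thesis by blast
qed

text \<open>The two codes are placed on the even and on the odd numbers.\<close>

lemma inj_prod_nat_set:
  assumes "\<exists>\<iota> :: 'a \<Rightarrow> nat set. inj \<iota>" "\<exists>\<iota> :: 'b \<Rightarrow> nat set. inj \<iota>"
  shows "\<exists>\<kappa> :: 'a \<times> 'b \<Rightarrow> nat set. inj \<kappa>"
proof -
  obtain \<iota> :: "'a \<Rightarrow> nat set" and \<iota>' :: "'b \<Rightarrow> nat set" where \<iota>: "inj \<iota>" "inj \<iota>'" using assms by blast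
  have "inj (\<lambda>(x, y). {n. if even n then n div 2 \<in> \<iota> x else n div 2 \<in> \<iota>' y})" (is "inj ?\<kappa>")
  proof (rule injI)
    fix v w assume eq: "?\<kappa> v = ?\<kappa> w"
    have "\<iota> (fst v) = \<iota> (fst w)"
    proof (rule Set.set_eqI)
      show "k \<in> \<iota> (fst v) \<longleftrightarrow> k \<in> \<iota> (fst w)" for k
        using arg_cong[OF eq, of "\<lambda>S. 2 * k \<in> S"] by (simp add: case_prod_unfold)
    qed
    moreover have "\<iota>' (snd v) = \<iota>' (snd w)"
    proof (rule Set.set_eqI)
      show "k \<in> \<iota>' (snd v) \<longleftrightarrow> k \<in> \<iota>' (snd w)" for k
        using arg_cong[OF eq, of "\<lambda>S. 2 * k + 1 \<in> S"] by (simp add: case_prod_unfold)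
    qed
    ultimately show "v = w" using injD[OF \<iota>(1)] injD[OF \<iota>(2)] by (intro prod_eqI) auto
  qed
  then show ?thesis by blast
qed

lemma label_copy:
  fixes S :: "'a::real_vector set"
  assumes S: "subgp S" and "\<exists>\<iota> :: 'a \<Rightarrow> nat set. inj \<iota>"
  obtains G :: "label monoid" and h where "comm_group G" "torsion_free G" "h \<in> iso G (grp S)"
proof -
  obtain \<kappa> :: "'a \<Rightarrow> nat set" where "inj \<kappa>" using assms(2) by blast
  \<comment> \<open>Singletons embed the sets of natural numbers into the labels.\<close>
  define \<iota> :: "'a \<Rightarrow> label" where "\<iota> x = {\<kappa> x}" for x
  have \<iota>: "inj \<iota>" using \<open>inj \<kappa>\<close> by (auto simp: \<iota>_def inj_def)
  define h where "h = inv_into UNIV \<iota>"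
  have h: "h (\<iota> x) = x" for x using \<iota> by (simp add: h_def)
  define G where "G = \<lparr>carrier = \<iota> ` S, monoid.mult = (\<lambda>a b. \<iota> (h a + h b)), one = \<iota> 0\<rparr>"
  have hi: "h \<in> iso G (grp S)"
    by (auto simp: iso_def hom_def G_def h subgp_add[OF S] intro!: bij_betwI[where g = \<iota>])
  have G: "comm_group G"
    by (rule comm_groupI)
       (auto simp: G_def h subgp_add[OF S] subgp_0[OF S] add_ac intro!: bexI[of _ "- _"] subgp_neg[OF S])
  interpret G: comm_group G by (rule G)
  have pow: "h (x [^]\<^bsub>G\<^esub> n) = real n *\<^sub>R h x" for x and n :: nat
    by (induction n) (simp_all add: G_def h scaleR_add_left)
  have "torsion_free G"
    unfolding torsion_free_def
  proof (intro ballI allI impI)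
    fix x and n :: nat assume x: "x \<in> carrier G" and n: "0 < n" and "x [^]\<^bsub>G\<^esub> n = \<one>\<^bsub>G\<^esub>"
    then have "real n *\<^sub>R h x = 0" using pow[of x n] by (simp add: G_def h)
    then have "h x = 0" using n by simp
    then show "x = \<one>\<^bsub>G\<^esub>" using x by (auto simp: G_def h)
  qed
  from that[OF G this hi] show ?thesis .
qed

text \<open>The primes with even and with odd position in the increasing enumeration.\<close>

lemma two_prime_sequences:
  obtains e e' where "prime_sequence e" "prime_sequence e'" "range e \<inter> range e' = {}"
proof
  let ?p = "enumerate {p::nat. prime p}"
  have inj: "inj ?p" using strict_mono_enumerate[OF primes_infinite] by (rule strict_mono_imp_inj_on)
  have pr: "prime (?p k)" for k using enumerate_in_set[OF primes_infinite] by blast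
  show "prime_sequence (\<lambda>k. ?p (2 * k))" "prime_sequence (\<lambda>k. ?p (2 * k + 1))"
    using pr by (auto intro!: prime_sequence.intro injI dest!: injD[OF inj])
  have "2 * i \<noteq> 2 * j + 1" for i j :: nat by presburger
  then show "range (\<lambda>k. ?p (2 * k)) \<inter> range (\<lambda>k. ?p (2 * k + 1)) = {}"
    by (auto dest!: injD[OF inj])
qed

section \<open>Construction of the group and comparison of its powers\<close>

theorem corollary1p3:
  fixes r :: "(nat \<times> nat) set"
  assumes "equiv {0<..} r"
    and "\<And>n m k. 0 < n \<Longrightarrow> 0 < m \<Longrightarrow> 0 < k \<Longrightarrow> (n, m) \<in> r \<longleftrightarrow> (n * k, m * k) \<in> r"
  shows "\<exists>G :: label monoid. comm_group G \<and> torsion_free G \<and>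
    (\<forall>n m. 0 < n \<longrightarrow> 0 < m \<longrightarrow>
       (endomorphism_ring (direct_power G n) \<simeq> endomorphism_ring (direct_power G m) \<longleftrightarrow> (n, m) \<in> r)) \<and>
    (\<forall>n m. 0 < n \<longrightarrow> 0 < m \<longrightarrow> (direct_power G n \<cong> direct_power G m \<longleftrightarrow> n = m))"
proof -
  define H :: "rat set" where "H = {q. \<exists>n m. 0 < n \<and> 0 < m \<and> (n, m) \<in> r \<and> q = of_nat n / of_nat m}"
  have refl: "(n, n) \<in> r" if "n > 0" for n
    using assms(1) that by (auto simp: equiv_def refl_on_def)
  have sym: "(m, n) \<in> r" if "(n, m) \<in> r" for n m
    using assms(1) that by (auto simp: equiv_def dest: symD)
  have trans: "(n, k) \<in> r" if "(n, m) \<in> r" "(m, k) \<in> r" for n m k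
    using assms(1) that by (auto simp: equiv_def dest: transD)
  have H_iff: "of_nat n / of_nat m \<in> H \<longleftrightarrow> (n, m) \<in> r" if nm: "n > 0" "m > 0" for n m
  proof
    assume "of_nat n / of_nat m \<in> H"
    then obtain a b where ab: "0 < a" "0 < b" "(a, b) \<in> r"
      "of_nat n / of_nat m = (of_nat a / of_nat b :: rat)" by (auto simp: H_def)
    then have "(of_nat (n * b) :: rat) = of_nat (a * m)" using nm by (simp add: field_simps)
    then have eq: "n * b = a * m" by (simp only: of_nat_eq_iff)
    \<comment> \<open>Equality of the fractions means \<open>n b = a m\<close>, so the relation
      between \<open>a\<close> and \<open>b\<close> scaled by \<open>m\<close> is the relation
      between \<open>n\<close> and \<open>m\<close> scaled by \<open>b\<close>, which
      cancels.\<close>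
    have "(a * m, b * m) \<in> r" using assms(2) ab nm by blast
    then have "(n * b, m * b) \<in> r" by (simp only: eq mult.commute[of m b])
    then show "(n, m) \<in> r" using assms(2) ab nm by blast
  qed (use nm in \<open>auto simp: H_def\<close>)
  have H_pos: "h > 0" if "h \<in> H" for h using that by (auto simp: H_def)
  have H1: "1 \<in> H" using H_iff[of 1 1] refl[of 1] by simp
  have H_div: "h / h' \<in> H" if h: "h \<in> H" "h' \<in> H" for h h'
  proof -
    obtain a b where ab: "0 < a" "0 < b" "(a, b) \<in> r" "h = of_nat a / of_nat b" using h(1) by (auto simp: H_def)
    obtain c d where cd: "0 < c" "0 < d" "(c, d) \<in> r" "h' = of_nat c / of_nat d" using h(2) by (auto simp: H_def)
    \<comment> \<open>The pair \<open>a d\<close>, \<open>b c\<close> for the quotient is linked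
      through the middle term \<open>b d\<close>.\<close>
    have "(a * d, b * d) \<in> r" using assms(2) ab cd by blast
    moreover have "(d * b, c * b) \<in> r" using assms(2) ab cd sym by blast
    ultimately have "(a * d, b * c) \<in> r" using trans by (simp add: mult.commute)
    moreover have "h / h' = of_nat (a * d) / of_nat (b * c)" using ab cd by simp
    ultimately show ?thesis using H_iff[of "a * d" "b * c"] ab cd by simp
  qed
  have H_mult: "h * h' \<in> H" if "h \<in> H" "h' \<in> H" for h h'
    using H_div[OF that(1) H_div[OF H1 that(2)]] by simp

  \<comment> \<open>The primes of \<open>e\<close> are used inside the groups \<open>B q\<close>,
    those of \<open>e'\<close> to encode the projections of their direct sum.\<close>
  obtain e e' where "prime_sequence e" and e': "prime_sequence e'" and disj: "range e \<inter> range e' = {}"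
    by (rule two_prime_sequences)
  interpret prime_sequence e by fact
  interpret e': prime_sequence e' by (rule e')
  have sB: "subgp (B q)" if "q > 0" for q by (rule subgp_B[OF that])
  have rB: "reduced (e' j) (B q)" for j q
    by (rule reduced_B[OF e'.prime_e]) (use disj in auto)

  \<comment> \<open>\<open>N n\<close> keeps the labels from \<open>H\<close> and takes powers of
    the summands; \<open>D n\<close> uses instead the labels from \<open>n H\<close> and the
    isomorphic summands \<open>B q\<close>.\<close>
  define M where "M = direct_sum H B"
  define N where "N n = direct_sum H (\<lambda>h. copies n (B h))" for n
  define D where "D n = commutant proj (direct_sum ((\<lambda>h. of_nat n * h) ` H) B)" for n
  have sC: "subgp (copies n (B h))" if "h \<in> H" for n h
    by (rule subgp_copies[OF sB[OF H_pos[OF that]]])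
  have rC: "reduced (e' j) (copies n (B h))" if "h \<in> H" for n h j
    by (rule reduced_copies[OF sB[OF H_pos[OF that]] rB])
  have RM: "realizable e' proj M"
    unfolding M_def by (rule e'.realizable_direct_sum[OF sB[OF H_pos] rB])
  have RN: "realizable e' proj (N n)" for n
    unfolding N_def by (rule e'.realizable_direct_sum[OF sC rC])
  interpret M: realizable e' proj M by (rule RM)

  obtain \<iota> :: "((rat \<Rightarrow> ((nat \<Rightarrow> nat \<Rightarrow> real) \<times> (nat \<Rightarrow> nat \<Rightarrow> real)) \<times> (nat \<Rightarrow> real)) \<times>
      (rat \<Rightarrow> ((nat \<Rightarrow> nat \<Rightarrow> real) \<times> (nat \<Rightarrow> nat \<Rightarrow> real)) \<times> (nat \<Rightarrow> real))) \<Rightarrow> nat set" where "inj \<iota>"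
    using inj_prod_nat_set inj_fun_nat_set inj_real_nat_set by metis
  then obtain G :: "label monoid" and h where G: "comm_group G" "torsion_free G"
    and h: "h \<in> iso G (grp (realize e' proj M))"
    using label_copy[OF M.subgp_realize] by blast

  \<comment> \<open>The power is moved first inside the realisation and then inside the direct sum,
    both compatibly with the projections.\<close>
  have dp: "direct_power G n \<cong> grp (realize e' proj (N n))" for n
  proof -
    interpret pair: realizable_pair e' "copies_op proj" "copies n M" proj "N n"
      by (intro realizable_pair.intro M.realizable_copies RN)
    have "direct_power G n \<cong> grp (copies n (realize e' proj M))"
      by (rule direct_power_iso_copies[OF G(1) M.subgp_realize h])
    also have "\<dots> \<cong> grp (realize e' (copies_op proj) (copies n M))"
      by (rule group.iso_sym[OF group_grp[OF pair.R1.subgp_realize] M.realize_copies])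
    also have "\<dots> \<cong> grp (realize e' proj (N n))"
    proof (rule pair.iso_lift)
      show "(\<lambda>F i k. F k i) \<in> iso (grp (copies n M)) (grp (N n))"
        unfolding M_def N_def by (rule direct_sum_swap)
    qed (rule swap_proj)
    finally show ?thesis .
  qed
  have dp_group: "group (direct_power G n)" for n
    by (rule comm_group.axioms(2)[OF comm_group_direct_power[OF G(1)]])

  have ring_E: "ring (endomorphism_ring (direct_power G n))" for n
    by (rule ring_endomorphism_ring[OF comm_group_direct_power[OF G(1)]])
  have E_D: "endomorphism_ring (direct_power G n) \<simeq> D n" if n: "n > 0" for n
  proof -
    interpret N: realizable e' proj "N n" by (rule RN)
    have 1: "endomorphism_ring (direct_power G n) \<simeq> endomorphism_ring (grp (realize e' proj (N n)))"
      by (rule endomorphism_ring_cong[OF dp_group group_grp[OF N.subgp_realize] dp])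
    have 2: "commutant proj (N n) \<simeq> D n"
      unfolding N_def D_def
    proof (rule commutant_reindex[where \<tau> = "\<lambda>x. x / of_nat n"])
      show "grp (copies n (B h)) \<cong> grp (B (of_nat n * h))" if "h \<in> H" for h
        by (rule B_copies[OF n H_pos[OF that]])
    qed (use n sC sB H_pos in auto)
    show ?thesis
      by (rule ring_iso_trans[OF ring_iso_trans[OF 1 N.endomorphism_ring_realize] 2])
  qed

  have rings: "endomorphism_ring (direct_power G n) \<simeq> endomorphism_ring (direct_power G m) \<longleftrightarrow> (n, m) \<in> r"
    if n: "n > 0" and m: "m > 0" for n m
  proof
    assume "(n, m) \<in> r"
    then have q: "of_nat n / of_nat m \<in> H" using H_iff n m by blast
    \<comment> \<open>\<open>H\<close> is a multiplicative group containing \<open>n / m\<close>, so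
      multiplication by \<open>n / m\<close> permutes it.\<close>
    have "(\<lambda>h. of_nat n * h) ` H = (\<lambda>h. of_nat m * h) ` H"
    proof (intro equalityI subsetI)
      fix x assume "x \<in> (\<lambda>h. of_nat n * h) ` H"
      then obtain h where h: "h \<in> H" "x = of_nat n * h" by blast
      then have "x = of_nat m * (of_nat n / of_nat m * h)" using m by simp
      then show "x \<in> (\<lambda>h. of_nat m * h) ` H" using H_mult[OF q h(1)] by blast
    next
      fix x assume "x \<in> (\<lambda>h. of_nat m * h) ` H"
      then obtain h where h: "h \<in> H" "x = of_nat m * h" by blast
      then have "x = of_nat n * (h / (of_nat n / of_nat m))" using n m by simp
      then show "x \<in> (\<lambda>h. of_nat n * h) ` H" using H_div[OF h(1) q] by blast
    qed
    then have "D n = D m" by (simp add: D_def)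
    then have "D n \<simeq> endomorphism_ring (direct_power G m)"
      using ring_iso_sym[OF ring_E E_D[OF m]] by simp
    then show "endomorphism_ring (direct_power G n) \<simeq> endomorphism_ring (direct_power G m)"
      by (rule ring_iso_trans[OF E_D[OF n]])
  next
    assume "endomorphism_ring (direct_power G n) \<simeq> endomorphism_ring (direct_power G m)"
    then have "D n \<simeq> D m"
      by (rule ring_iso_trans[OF ring_iso_trans[OF ring_iso_sym[OF ring_E E_D[OF n]]] E_D[OF m]])
    then obtain \<Phi> where \<Phi>: "\<Phi> \<in> ring_iso (D n) (D m)" by (auto simp: is_ring_iso_def)
    \<comment> \<open>The cyclic summand is the entry at 0 of the integer sequence in
      \<open>B q\<close>.\<close>
    let ?g = "\<lambda>q :: rat. \<lambda>b. snd b (0::nat)" and ?u = "\<lambda>q :: rat. (0, \<lambda>i. if i = 0 then 1 else 0)"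
    have P: "pointed_family ((\<lambda>h. of_nat k * h) ` H) B ?g ?u" if "k > 0" for k
    proof
      fix q assume "q \<in> (\<lambda>h. of_nat k * h) ` H"
      then have q: "q > 0" using H_pos that by auto
      show "subgp (B q)" by (rule sB[OF q])
      show "?g q \<in> hom (grp (B q)) (grp \<int>)"
        by (auto simp: hom_grp_iff B_def int_seqs_def)
      show "?u q \<in> B q" using subgp_0[OF subgp_A[OF q]] by (auto simp: B_def int_seqs_def)
    qed simp
    \<comment> \<open>The summand labelled \<open>n\<close>, present because 1 is in
      \<open>H\<close>, must match one labelled \<open>m h\<close>; then \<open>n = m h\<close>, so
      \<open>n / m\<close> is in \<open>H\<close>.\<close>
    have "of_nat n * 1 \<in> (\<lambda>h. of_nat n * h) ` H" using H1 by blast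
    then obtain q' where q': "q' \<in> (\<lambda>h. of_nat m * h) ` H" "grp (B (of_nat n * 1)) \<cong> grp (B q')"
      using summand_correspondence[OF P[OF n] P[OF m] \<Phi>[unfolded D_def]] by blast
    then obtain h where h: "h \<in> H" "q' = of_nat m * h" by blast
    have "of_nat n * 1 = q'"
      by (rule B_unique[OF _ _ q'(2)]) (use n m h H_pos in auto)
    then have "of_nat n / of_nat m = h" using h m by (simp add: field_simps)
    then show "(n, m) \<in> r" using H_iff[OF n m] h by simp
  qed

  have groups: "direct_power G n \<cong> direct_power G m \<longleftrightarrow> n = m" if n: "n > 0" and m: "m > 0" for n m
  proof
    assume iso: "direct_power G n \<cong> direct_power G m"
    interpret pair: realizable_pair e' proj "N n" proj "N m"
      by (intro realizable_pair.intro RN)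
    have "grp (realize e' proj (N n)) \<cong> direct_power G n"
      by (rule group.iso_sym[OF dp_group dp])
    also note iso
    also note dp
    finally obtain \<phi> where \<phi>: "\<phi> \<in> iso (grp (realize e' proj (N n))) (grp (realize e' proj (N m)))"
      by (auto simp: is_iso_def)
    then have \<phi>h: "\<phi> \<in> hom (grp (realize e' proj (N n))) (grp (realize e' proj (N m)))"
      by (simp add: iso_def)
    \<comment> \<open>The isomorphism respects the labels, so the summands at label 1 are
      isomorphic: the \<open>n\<close>-th and the \<open>m\<close>-th power of
      \<open>B 1\<close>.\<close>
    have 1: "grp (copies n (B 1)) \<cong> grp (copies m (B 1))"
      by (rule component_iso[where I = H and C = "\<lambda>h. copies n (B h)" and C' = "\<lambda>h. copies m (B h)",
            OF sC sC pair.iso_base[OF \<phi>, unfolded N_def] pair.base_op[OF \<phi>h, unfolded N_def] H1])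
    have 2: "grp (B (of_nat n * 1)) \<cong> grp (copies n (B 1))"
      by (rule group.iso_sym[OF group_grp[OF sC[OF H1]] B_copies[OF n]]) simp
    have 3: "grp (copies m (B 1)) \<cong> grp (B (of_nat m * 1))"
      by (rule B_copies[OF m]) simp
    have "grp (B (of_nat n * 1)) \<cong> grp (B (of_nat m * 1))"
      by (rule iso_trans[OF iso_trans[OF 2 1] 3])
    from B_unique[OF _ _ this] show "n = m" using n m by simp
  qed (simp add: iso_refl)
  show ?thesis using G rings groups by blast
qed

end
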